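(* Let $f(x)=x^\alpha L(x)>0$ with $\alpha\in[0,1]$ and $L$ slowly varying at infinity; if $\alpha=1$, suppose in addition that $\lim_{x\to\infty}L(x)=0$. Assume also that $f$ satisfies the standing assumption stated in the context. Let $G_k(\ell)=\sum_{j=1}^\ell f(j)^{-k}$ for $k,\ell\in\mathbb{N}$, extended to $\mathbb{R}_+$ by linear interpolation with $G_k(0)=0$, let $G_k(\infty)=\lim_{\ell\to\infty}G_k(\ell)$, and let $$V(t)=f(r(t))\,G_2(r(t))^{1/2},\qquad r(t)=\lceil G_1^{-1}(t)\rceil.$$ Then there exists a random variable $Z$ such that $$\frac{\xi_f(t)-G_1^{-1}(t)}{V(t)}\Rightarrow Z,\qquad t\to\infty,$$ where $\Rightarrow$ denotes convergence in distribution. Moreover, $Z$ has a standard normal distribution when $G_2(\infty)=\infty$, and when $G_2(\infty)<\infty$, $Z$ has moment generating function $$\kappa(\theta)=E\big[e^{\theta Z}\big]=\exp\Big(\sum_{k=2}^\infty\frac{(-\theta)^k}{k}a_k\Big),\qquad a_k=\frac{G_k(\infty)}{G_2(\infty)^{k/2}},\qquad |\theta|<1.$$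
   Context: $\mathbb{N}=\{1,2,\dots\}$. $\{\xi_f(t):t\ge0\}$ is the Markovian pure birth process with $\xi_f(0)=0$ and birth rates $P(\xi_f(t+dt)=k+1\mid\xi_f(t)=k)=f(k+1)\,dt+o(dt)$, $k\ge0$; its $n$th birth time is distributed as $\sum_{i=1}^n\mathcal{E}_i/f(i)$ with $\mathcal{E}_i$ i.i.d. exponential of mean one. Standing assumption on $f$: with $\hat\rho(\theta)=\sum_{n\ge1}\prod_{i=1}^n\frac{f(i)}{\theta+f(i)}$, there exists $\lambda>0$ with $\hat\rho(\lambda)=1$; $f(k)\le C_fk$ for all $k\ge1$ and some $C_f<\infty$; $\inf_{i\ge1}f(i)>0$; and with $\underline\theta=\inf\{\theta>0:\hat\rho(\theta)<\infty\}$, $\lim_{\theta\searrow\underline\theta}\hat\rho(\theta)>1$. A function $L$ is slowly varying at infinity if $L(cx)/L(x)\to1$ as $x\to\infty$ for every $c>0$. $G_1^{-1}$ is the inverse of the (strictly increasing, continuous) interpolated function $G_1$.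
   Formalization: The slowly varying function L is additionally assumed Lebesgue measurable on [1,∞), as is usual in the theory; without this the claim fails for L built from a Hamel basis containing the logarithms of the primes. *)

theory Defs
  imports "HOL-Probability.Probability" "HOL-Library.Landau_Symbols"
begin

definition slowly_varying :: "(real \<Rightarrow> real) \<Rightarrow> bool" where
  "slowly_varying L \<longleftrightarrow> (\<forall>c>0. ((\<lambda>x. L (c * x) / L x) \<longlongrightarrow> 1) at_top)"

text \<open>The series is taken in the extended nonnegative reals, so that it may be infinite.\<close>

definition rho_hat :: "(real \<Rightarrow> real) \<Rightarrow> real \<Rightarrow> ennreal" where
  "rho_hat f \<theta> = (\<Sum>n. ennreal (\<Prod>i=1..Suc n. f (real i) / (\<theta> + f (real i))))"

definition theta_low :: "(real \<Rightarrow> real) \<Rightarrow> real" where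
  "theta_low f = Inf {\<theta>. 0 < \<theta> \<and> rho_hat f \<theta> < \<infinity>}"

definition standing_assumption :: "(real \<Rightarrow> real) \<Rightarrow> bool" where
  "standing_assumption f \<longleftrightarrow>
     (\<exists>\<mu>>0. rho_hat f \<mu> = 1) \<and>
     (\<exists>C. \<forall>k::nat. 1 \<le> k \<longrightarrow> f (real k) \<le> C * real k) \<and>
     0 < (INF i\<in>{1::nat..}. f (real i)) \<and>
     (\<exists>l>1. (rho_hat f \<longlongrightarrow> l) (at_right (theta_low f)))"

text \<open>
  A time-homogeneous Markov process on the time axis \<open>[0,\<infinity>)\<close> with nondecreasing right-continuous
  paths in the discrete space of natural numbers, started at \<open>0\<close>, which in state \<open>k\<close> jumps
  to \<open>k + 1\<close> at rate \<open>f (k + 1)\<close>. Conditional probabilities are only constrained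
  where the conditioning event has positive probability. The last clause is the usual requirement
  that births occur one at a time; the rate of the step to \<open>k + 1\<close> alone does not exclude
  larger jumps.
\<close>

definition pure_birth_process ::
  "'a measure \<Rightarrow> (real \<Rightarrow> real) \<Rightarrow> (real \<Rightarrow> 'a \<Rightarrow> nat) \<Rightarrow> bool" where
  "pure_birth_process M f \<xi> \<longleftrightarrow>
     prob_space M \<and>
     (\<forall>t\<ge>0. \<xi> t \<in> measurable M (count_space UNIV)) \<and>
     (AE \<omega> in M. \<xi> 0 \<omega> = 0) \<and>
     (AE \<omega> in M. mono_on {0..} (\<lambda>t. \<xi> t \<omega>)) \<and>
     (AE \<omega> in M. \<forall>t\<ge>0. continuous (at_right t) (\<lambda>s. \<xi> s \<omega>)) \<and>
     (\<forall>(n::nat) (s::nat \<Rightarrow> real) (x::nat \<Rightarrow> nat) t k.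
        0 \<le> s 0 \<and> (\<forall>i<n. s i \<le> s (Suc i)) \<and> s n \<le> t \<and>
        \<P>(\<omega> in M. \<forall>i\<le>n. \<xi> (s i) \<omega> = x i) > 0 \<longrightarrow>
        \<P>(\<omega> in M. \<xi> t \<omega> = k \<bar> \<forall>i\<le>n. \<xi> (s i) \<omega> = x i) =
        \<P>(\<omega> in M. \<xi> t \<omega> = k \<bar> \<xi> (s n) \<omega> = x n)) \<and>
     (\<forall>s\<ge>0. \<forall>t\<ge>0. \<forall>h\<ge>0. \<forall>j k.
        \<P>(\<omega> in M. \<xi> s \<omega> = j) > 0 \<and> \<P>(\<omega> in M. \<xi> t \<omega> = j) > 0 \<longrightarrow>
        \<P>(\<omega> in M. \<xi> (s + h) \<omega> = k \<bar> \<xi> s \<omega> = j) =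
        \<P>(\<omega> in M. \<xi> (t + h) \<omega> = k \<bar> \<xi> t \<omega> = j)) \<and>
     (\<forall>t\<ge>0. \<forall>k. \<P>(\<omega> in M. \<xi> t \<omega> = k) > 0 \<longrightarrow>
        (\<lambda>h. \<P>(\<omega> in M. \<xi> (t + h) \<omega> = k + 1 \<bar> \<xi> t \<omega> = k) - f (real (k + 1)) * h)
          \<in> o[at_right 0](\<lambda>h. h) \<and>
        (\<lambda>h. \<P>(\<omega> in M. \<xi> (t + h) \<omega> > k + 1 \<bar> \<xi> t \<omega> = k)) \<in> o[at_right 0](\<lambda>h. h))"

text \<open>Linear interpolation on \<open>[0,\<infinity>)\<close> of the partial sums of \<open>f(j)\<^sup>-\<^sup>k\<close>.\<close>

definition G_fun :: "(real \<Rightarrow> real) \<Rightarrow> nat \<Rightarrow> real \<Rightarrow> real" where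
  "G_fun f k x =
     (\<Sum>j=1..nat \<lfloor>x\<rfloor>. 1 / f (real j) ^ k) + (x - \<lfloor>x\<rfloor>) * (1 / f (\<lfloor>x\<rfloor> + 1) ^ k)"

definition G_infty :: "(real \<Rightarrow> real) \<Rightarrow> nat \<Rightarrow> ereal" where
  "G_infty f k = lim (\<lambda>l::nat. ereal (G_fun f k (real l)))"

definition G1_inv :: "(real \<Rightarrow> real) \<Rightarrow> real \<Rightarrow> real" where
  "G1_inv f = the_inv_into {0..} (G_fun f 1)"

definition r_fun :: "(real \<Rightarrow> real) \<Rightarrow> real \<Rightarrow> int" where
  "r_fun f t = \<lceil>G1_inv f t\<rceil>"

definition V_fun :: "(real \<Rightarrow> real) \<Rightarrow> real \<Rightarrow> real" where
  "V_fun f t = f (r_fun f t) * sqrt (G_fun f 2 (r_fun f t))"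

definition a_coeff :: "(real \<Rightarrow> real) \<Rightarrow> nat \<Rightarrow> real" where
  "a_coeff f k = real_of_ereal (G_infty f k) / real_of_ereal (G_infty f 2) powr (real k / 2)"

text \<open>
  Convergence in distribution along an arbitrary filter, by pointwise convergence of the
  distribution functions at the continuity points of the limit, as in \<^const>\<open>weak_conv_m\<close>,
  which is restricted to sequences.
\<close>

definition converges_in_distribution ::
  "'a measure \<Rightarrow> ('i \<Rightarrow> 'a \<Rightarrow> real) \<Rightarrow> 'i filter \<Rightarrow> 'b measure \<Rightarrow> ('b \<Rightarrow> real) \<Rightarrow> bool" where
  "converges_in_distribution M X F N Z \<longleftrightarrow>
     (\<forall>x. isCont (cdf (distr N borel Z)) x \<longrightarrow>
        ((\<lambda>i. cdf (distr M borel (X i)) x) \<longlongrightarrow> cdf (distr N borel Z) x) F)"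

end

theory Submission
  imports Defs "HOL-Real_Asymp.Real_Asymp"
begin

text \<open>
  The process has reached state \<open>n\<close> by time \<open>t\<close> exactly when the \<open>n\<close>th birth has happened, so
  \<open>P(\<xi>(t) \<ge> n) = P(T\<^sub>n \<le> t)\<close> with \<open>T\<^sub>n = \<Sum>\<^bsub>i\<le>n\<^esub> E\<^sub>i / f(i)\<close> for independent standard exponential variables
  \<open>E\<^sub>i\<close>. Only one-dimensional marginals of \<open>\<xi>\<close> matter, and the identity is obtained from the infinitesimal
  description, which time homogeneity makes uniform in time: the tails \<open>P(\<xi>(t) \<ge> n)\<close> solve the integrated forward equations
  (\<open>tail_recursion\<close>), and the distribution functions of the \<open>T\<^sub>n\<close> solve the same
  recursion (\<open>emeasure_birth_time_Suc\<close>); the two are matched by induction in \<open>tail_eq_birth_time\<close>.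

  The centred variable \<open>W\<^sub>n = G\<^sub>1(n) - T\<^sub>n\<close> is a sum of independent mean zero terms
  with variance \<open>G\<^sub>2(n)\<close>. Its characteristic function is an explicit product. If
  \<open>G\<^sub>2(n) \<rightarrow> \<infinity>\<close>, each factor is Gaussian up to a cubic error and \<open>W\<^sub>n / sqrt(G\<^sub>2(n))\<close> is
  asymptotically standard normal (\<open>centred_sum_normal_limit\<close>). If \<open>G\<^sub>2\<close> is bounded,
  \<open>W\<^sub>n / sqrt(G\<^sub>2(\<infinity>))\<close> converges to a law whose moment generating function is the
  limit of the explicit products \<open>\<Prod>\<^sub>i exp(\<theta> b\<^sub>i) / (1 + \<theta> b\<^sub>i)\<close>; taking logarithms and
  exchanging two summations gives the stated series
  (\<open>centred_sum_limit_finite_variance\<close>, \<open>cumulant_series\<close>).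

  To pass from birth times back to the process, write \<open>y = G\<^sub>1\<^sup>-\<^sup>1(t)\<close>, \<open>r = \<lceil>y\<rceil>\<close> and let \<open>n\<close> be the first
  integer above \<open>y + x V(t)\<close>. Then \<open>(\<xi>(t) - y) / V(t) \<le> x\<close> is the event \<open>\<xi>(t) < n\<close>, which has the probability of
  \<open>T\<^sub>n > t\<close>, that is of \<open>W\<^sub>n < G\<^sub>1(n) - t\<close>. The threshold is close to \<open>x sqrt(G\<^sub>2(n))\<close> because
  \<open>f\<close> is almost constant between \<open>r\<close> and \<open>n\<close>, so that \<open>G\<^sub>1(n) - t\<close> is nearly \<open>(n - y) / f(r)\<close>,
  nearly \<open>x V(t) / f(r) = x sqrt(G\<^sub>2(r))\<close> (\<open>local_increments\<close>). Regular variation enters only here. It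
  supplies \<open>V = o(r)\<close> (\<open>scale_sublinear\<close>), \<open>V \<rightarrow> \<infinity>\<close> (\<open>scale_at_top\<close>) and
  \<open>f(j) / f(r) \<rightarrow> 1\<close> for \<open>j / r \<rightarrow> 1\<close> (\<open>ratio_near_1\<close>), all of which rest on the
  uniform convergence theorem for measurable slowly varying functions
  (\<open>uniform_slow_variation\<close>).
\<close>

section \<open>Uniform convergence for slowly varying functions\<close>

text \<open>
  The uniform convergence theorem, for \<open>h = ln \<circ> L\<close>. If it failed there would be \<open>x\<^sub>n \<rightarrow> \<infinity>\<close> and
  \<open>u\<^sub>n \<in> [1,2]\<close> with \<open>h(u\<^sub>n x\<^sub>n)\<close> far from \<open>h(x\<^sub>n)\<close>. By pointwise convergence and continuity of
  Lebesgue measure, for large \<open>n\<close> most factors \<open>w\<close> have \<open>h(w x\<^sub>n)\<close> close to \<open>h(x\<^sub>n)\<close>, and most factors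
  \<open>v\<close> have \<open>h(v u\<^sub>n x\<^sub>n)\<close> close to \<open>h(u\<^sub>n x\<^sub>n)\<close>. The two sets, the second one stretched by \<open>u\<^sub>n\<close>, are
  too large to be disjoint, and a common point \<open>w = u\<^sub>n v\<close> links \<open>h(x\<^sub>n)\<close> to \<open>h(u\<^sub>n x\<^sub>n)\<close>.
\<close>

lemma uniform_slow_variation:
  fixes h :: "real \<Rightarrow> real"
  assumes meas [measurable]: "h \<in> borel_measurable lebesgue"
    and slow: "\<And>c. 0 < c \<Longrightarrow> ((\<lambda>x. h (c * x) - h x) \<longlongrightarrow> 0) at_top"
    and e: "0 < e"
  shows "\<exists>X\<ge>1. \<forall>x\<ge>X. \<forall>u\<in>{1..2}. \<bar>h (u * x) - h x\<bar> \<le> e"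
proof (rule ccontr)
  assume "\<not> ?thesis"
  then have "\<forall>n::nat. \<exists>x u. max 1 (real n) \<le> x \<and> u \<in> {1..2} \<and> e < \<bar>h (u * x) - h x\<bar>"
    by (metis max.cobounded1 not_less)
  then obtain x u where x: "\<And>n. max 1 (real n) \<le> x n" and u: "\<And>n. u n \<in> {1..2}"
    and far: "\<And>n. e < \<bar>h (u n * x n) - h (x n)\<bar>"
    by metis
  have x_top: "filterlim x at_top sequentially"
    by (rule filterlim_at_top_mono[OF filterlim_real_sequentially]) (use x in \<open>auto intro!: always_eventually\<close>)
  have ux_top: "filterlim (\<lambda>n. u n * x n) at_top sequentially"
  proof (rule filterlim_at_top_mono[OF x_top], intro always_eventually allI)
    fix n
    have "1 * x n \<le> u n * x n"
      using u[of n] x[of n] by (intro mult_right_mono) auto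
    then show "x n \<le> u n * x n" by simp
  qed
  have scale_meas [measurable]: "(\<lambda>w. h (w * c)) \<in> borel_measurable lebesgue" for c
    using measurable_compose[OF lebesgue_measurable_scaling meas, of c]
    by (simp add: mult.commute)
  define good where "good b z k = {w \<in> {1..b}. \<forall>n\<ge>k. \<bar>h (w * z n) - h (z n)\<bar> \<le> e / 2}"
    for b :: real and z :: "nat \<Rightarrow> real" and k :: nat
  have good_meas: "good b z k \<in> sets lebesgue" for b z k
  proof -
    have "good b z k = {1..b} \<inter> (\<Inter>n\<in>{k..}. {w \<in> space lebesgue. \<bar>h (w * z n) - h (z n)\<bar> \<le> e / 2})"
      by (auto simp: good_def)
    also have "\<dots> \<in> sets lebesgue"
    proof -
      have "{w \<in> space lebesgue. \<bar>h (w * z n) - h (z n)\<bar> \<le> e / 2} \<in> sets lebesgue" for n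
        by measurable
      then show ?thesis
        by (intro sets.Int sets.countable_INT') auto
    qed
    finally show ?thesis .
  qed
  have good_lim: "(\<lambda>k. measure lebesgue (good b z k)) \<longlonglongrightarrow> b - 1"
    if b: "1 \<le> b" and z: "filterlim z at_top sequentially" for b z
  proof -
    have "(\<Union>k. good b z k) = {1..b}"
    proof (intro equalityI subsetI)
      fix w assume w: "w \<in> {1..b}"
      have "((\<lambda>n. h (w * z n) - h (z n)) \<longlongrightarrow> 0) sequentially"
        using w by (intro filterlim_compose[OF slow z]) auto
      then have "eventually (\<lambda>n. \<bar>h (w * z n) - h (z n)\<bar> < e / 2) sequentially"
        using e by (auto simp: tendsto_iff dest!: spec[of _ "e / 2"])
      then obtain k where "\<forall>n\<ge>k. \<bar>h (w * z n) - h (z n)\<bar> < e / 2"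
        by (auto simp: eventually_sequentially)
      then have "w \<in> good b z k"
        using w by (auto simp: good_def intro: less_imp_le)
      then show "w \<in> (\<Union>k. good b z k)" by auto
    qed (auto simp: good_def)
    moreover have "(\<lambda>k. measure lebesgue (good b z k)) \<longlonglongrightarrow> measure lebesgue (\<Union>k. good b z k)"
    proof (rule Lim_measure_incseq)
      show "range (good b z) \<subseteq> sets lebesgue" using good_meas by auto
      show "incseq (good b z)" by (auto simp: incseq_def good_def)
      show "emeasure lebesgue (\<Union>k. good b z k) \<noteq> \<infinity>"
        using \<open>(\<Union>k. good b z k) = {1..b}\<close> b by simp
    qed
    ultimately show ?thesis using b by simp
  qed
  \<comment> \<open>Both sets lie in the interval from 1 to 4, of length 3, once the second is stretched by a factor
    of at least 1; the bounds 5/2 and 1/2 add up to 3, which rules out disjointness.\<close>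
  have "eventually (\<lambda>k. 5 / 2 < measure lebesgue (good 4 x k)) sequentially"
    by (rule order_tendstoD(1)[OF good_lim[OF _ x_top]]) auto
  moreover have "eventually (\<lambda>k. 1 / 2 < measure lebesgue (good 2 (\<lambda>n. u n * x n) k)) sequentially"
    by (rule order_tendstoD(1)[OF good_lim[OF _ ux_top]]) auto
  ultimately have "eventually (\<lambda>k. 5 / 2 < measure lebesgue (good 4 x k) \<and>
      1 / 2 < measure lebesgue (good 2 (\<lambda>n. u n * x n) k)) sequentially"
    by (rule eventually_conj)
  then obtain k where kA: "5 / 2 < measure lebesgue (good 4 x k)"
    and kB: "1 / 2 < measure lebesgue (good 2 (\<lambda>n. u n * x n) k)"
    by (auto simp: eventually_sequentially)
  define A where "A = good 4 x k"
  define B where "B = (*) (u k) ` good 2 (\<lambda>n. u n * x n) k"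
  have uk: "1 \<le> u k" "u k \<le> 2" using u[of k] by auto
  have "B = (\<lambda>v. u k *\<^sub>R v + 0) ` good 2 (\<lambda>n. u n * x n) k"
    by (auto simp: B_def)
  then have "measure lebesgue B = u k * measure lebesgue (good 2 (\<lambda>n. u n * x n) k)"
    using measure_lebesgue_affine[of "u k" 0 "good 2 (\<lambda>n. u n * x n) k"] uk by (simp add: add.commute)
  moreover have "1 * measure lebesgue (good 2 (\<lambda>n. u n * x n) k)
      \<le> u k * measure lebesgue (good 2 (\<lambda>n. u n * x n) k)"
    using uk by (intro mult_right_mono) auto
  ultimately have B_large: "1 / 2 < measure lebesgue B" using kB by linarith
  have A_sets: "A \<in> sets lebesgue" unfolding A_def by (rule good_meas)
  have B_sets: "B \<in> sets lebesgue"
  proof -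
    have "B = (*\<^sub>R) (1 / u k) -` good 2 (\<lambda>n. u n * x n) k \<inter> space lebesgue"
      using uk by (auto simp: B_def image_iff intro!: bexI[of _ "_ / u k"])
    then show ?thesis
      using measurable_sets[OF lebesgue_measurable_scaling good_meas] by metis
  qed
  have A_sub: "A \<subseteq> {1..4}" by (auto simp: A_def good_def)
  have B_sub: "B \<subseteq> {1..4}"
  proof
    fix w assume "w \<in> B"
    then obtain v where v: "w = u k * v" "1 \<le> v" "v \<le> 2" by (auto simp: B_def good_def)
    have "1 * 1 \<le> u k * v" "u k * v \<le> 2 * 2" using uk v by (intro mult_mono; simp)+
    then show "w \<in> {1..4}" using v by auto
  qed
  have "A \<inter> B \<noteq> {}"
  proof
    assume disj: "A \<inter> B = {}"
    have fm: "S \<in> fmeasurable lebesgue" if "S \<in> sets lebesgue" "S \<subseteq> {1..4}" for S :: "real set"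
      by (rule fmeasurableI2[of "{1..4}"]) (use that in auto)
    have "measure lebesgue A + measure lebesgue B = measure lebesgue (A \<union> B)"
      using disj fm[OF A_sets A_sub] fm[OF B_sets B_sub]
      by (intro measure_Union[symmetric]) (auto dest: fmeasurableD2 simp del: emeasure_completion)
    also have "\<dots> \<le> measure lebesgue {1..4::real}"
      using A_sets B_sets A_sub B_sub by (intro measure_mono_fmeasurable) auto
    also have "\<dots> = 3" by simp
    finally show False using kA B_large by (simp add: A_def)
  qed
  then obtain v where "u k * v \<in> A" "v \<in> good 2 (\<lambda>n. u n * x n) k" by (auto simp: B_def)
  then have "\<bar>h (u k * v * x k) - h (x k)\<bar> \<le> e / 2" "\<bar>h (u k * v * x k) - h (u k * x k)\<bar> \<le> e / 2"
    by (auto simp: A_def good_def mult.commute mult.left_commute)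
  then show False using far[of k] by linarith
qed

text \<open>
  Chaining the uniform bound over doublings of the argument: every doubling costs at most \<open>e\<close>, and the
  leftover factor below 2 costs one more \<open>e\<close>. This turns a uniform estimate on \<open>[1,2]\<close> into Potter's
  power bounds.
\<close>

lemma slow_variation_log_bound:
  fixes h :: "real \<Rightarrow> real"
  assumes X: "1 \<le> X" and unif: "\<And>x u. X \<le> x \<Longrightarrow> u \<in> {1..2} \<Longrightarrow> \<bar>h (u * x) - h x\<bar> \<le> e"
    and e: "0 \<le> e" and xy: "X \<le> x" "x \<le> y"
  shows "\<bar>h y - h x\<bar> \<le> e + e * log 2 (y / x)"
proof -
  have x0: "0 < x" using X xy by simp
  have *: "\<bar>h y - h x\<bar> \<le> e + e * log 2 (y / x)" if "x \<le> y" "y \<le> 2 ^ k * x" for k y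
    using that
  proof (induction k arbitrary: y)
    case 0
    then show ?case using e x0 by simp
  next
    case (Suc k)
    have y0: "0 < y" using Suc x0 by simp
    show ?case
    proof (cases "y \<le> 2 * x")
      case True
      have "\<bar>h ((y / x) * x) - h x\<bar> \<le> e"
        using True Suc x0 xy by (intro unif) (auto simp: field_simps)
      moreover have "0 \<le> e * log 2 (y / x)"
        using e x0 Suc by (intro mult_nonneg_nonneg) (auto simp: field_simps)
      ultimately show ?thesis using x0 by simp
    next
      case False
      have "\<bar>h (y / 2) - h x\<bar> \<le> e + e * log 2 (y / 2 / x)"
        using False Suc by (intro Suc.IH) auto
      moreover have "log 2 (y / 2 / x) = log 2 (y / x) - 1"
        using x0 y0 by (simp add: log_divide log_mult)
      moreover have "\<bar>h (2 * (y / 2)) - h (y / 2)\<bar> \<le> e"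
        using False xy by (intro unif) auto
      moreover have "e * log 2 (y / x) = e + e * log 2 (y / 2 / x)"
        by (subst calculation(2)) (simp add: right_diff_distrib)
      ultimately show ?thesis by simp
    qed
  qed
  obtain k where "y / x < 2 ^ k" using real_arch_pow[of 2 "y / x"] by auto
  then show ?thesis using xy x0 by (intro *[of y k]) (auto simp: field_simps)
qed

section \<open>Regularly varying rates\<close>

locale regularly_varying_rates =
  fixes f L :: "real \<Rightarrow> real" and \<alpha> :: real
  assumes f_eq: "1 \<le> x \<Longrightarrow> f x = x powr \<alpha> * L x"
    and f_pos: "1 \<le> x \<Longrightarrow> 0 < f x"
    and alpha: "0 \<le> \<alpha>" "\<alpha> \<le> 1"
    and L_measurable: "L \<in> borel_measurable (restrict_space lebesgue {1..})"
    and L_slow: "slowly_varying L"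
    and L_zero: "\<alpha> = 1 \<Longrightarrow> (L \<longlongrightarrow> 0) at_top"
begin

lemma L_pos: "1 \<le> x \<Longrightarrow> 0 < L x"
  using f_pos[of x] f_eq[of x] by (simp add: zero_less_mult_iff)

lemma ln_L_uniform:
  assumes "0 < e"
  shows "\<exists>X\<ge>1. \<forall>x\<ge>X. \<forall>u\<in>{1..2}. \<bar>ln (L (u * x)) - ln (L x)\<bar> \<le> e"
proof -
  define h where "h x = (if x \<in> {1..} then ln (L x) else 0)" for x
  have "(\<lambda>x. ln (L x)) \<in> borel_measurable (restrict_space lebesgue {1..})"
    by (intro borel_measurable_ln L_measurable)
  then have "h \<in> borel_measurable lebesgue"
    unfolding h_def by (subst (asm) measurable_restrict_space_iff[where c = 0]) auto
  moreover have "((\<lambda>x. h (c * x) - h x) \<longlongrightarrow> 0) at_top" if c: "0 < c" for c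
  proof -
    have "((\<lambda>x. ln (L (c * x) / L x)) \<longlongrightarrow> ln 1) at_top"
      using L_slow c by (intro tendsto_ln) (auto simp: slowly_varying_def)
    moreover have "eventually (\<lambda>x. ln (L (c * x) / L x) = h (c * x) - h x) at_top"
      using eventually_ge_at_top[of "max 1 (1 / c)"]
    proof eventually_elim
      case (elim x)
      then have "1 \<le> x" "1 \<le> c * x" using c by (auto simp: field_simps)
      then show ?case using L_pos[of x] L_pos[of "c * x"] by (simp add: h_def ln_div)
    qed
    ultimately show ?thesis by (simp add: filterlim_cong)
  qed
  ultimately obtain X where X: "1 \<le> X" "\<And>x u. X \<le> x \<Longrightarrow> u \<in> {1..2} \<Longrightarrow> \<bar>h (u * x) - h x\<bar> \<le> e"
    using uniform_slow_variation[of h e] assms by blast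
  have "\<bar>ln (L (u * x)) - ln (L x)\<bar> \<le> e" if "X \<le> x" "u \<in> {1..2}" for x u
  proof -
    have "1 * 1 \<le> u * x" using that X(1) by (intro mult_mono) auto
    then show ?thesis using X(2)[OF that] that X(1) by (simp add: h_def)
  qed
  with X(1) show ?thesis by blast
qed

text \<open>
  On the logarithmic scale the power and the slowly varying factor separate additively.
\<close>

lemma ratio_eq_exp:
  assumes "1 \<le> x" "1 \<le> y"
  shows "f x / f y = exp (\<alpha> * ln (x / y) + (ln (L x) - ln (L y)))"
  using assms L_pos[of x] L_pos[of y]
  by (simp add: f_eq powr_def exp_add exp_diff ln_div right_diff_distrib)

text \<open>
  The rate is asymptotically constant on windows around \<open>r\<close> of width \<open>o(r)\<close>. Both \<open>\<alpha> ln(r/y)\<close> and the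
  increment of \<open>ln L\<close> are small there, the latter by uniform convergence applied to \<open>r/y\<close> or to
  \<open>y/r\<close>, whichever is at least 1.
\<close>

lemma ratio_near_1:
  assumes "0 < \<epsilon>"
  shows "\<exists>\<delta>>0. \<exists>R. \<forall>r\<ge>R. \<forall>y. \<bar>y - r\<bar> \<le> \<delta> * r \<longrightarrow> \<bar>f r / f y - 1\<bar> \<le> \<epsilon>"
proof -
  have "isCont exp (0::real)" by simp
  then obtain d where d: "0 < d" "\<And>z::real. \<bar>z\<bar> < d \<Longrightarrow> \<bar>exp z - 1\<bar> < \<epsilon>"
    using assms unfolding continuous_at_eps_delta by (auto simp: dist_real_def)
  obtain X where X: "1 \<le> X" "\<And>x u. X \<le> x \<Longrightarrow> u \<in> {1..2} \<Longrightarrow> \<bar>ln (L (u * x)) - ln (L x)\<bar> \<le> d / 3"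
    using ln_L_uniform[of "d / 3"] d(1) by auto
  \<comment> \<open>The bound 1/2 keeps the window inside a single doubling, and d/6 makes
    \<open>\<bar>ln (r / y)\<bar> \<le> 2 * \<delta>\<close> at most d/3.\<close>
  define \<delta> where "\<delta> = min (1 / 2) (d / 6)"
  have "\<bar>f r / f y - 1\<bar> \<le> \<epsilon>" if r: "2 * X \<le> r" and y: "\<bar>y - r\<bar> \<le> \<delta> * r" for r y
  proof -
    have r0: "0 < r" using r X(1) by simp
    have "\<delta> * r \<le> 1 / 2 * r" using r0 by (intro mult_right_mono) (auto simp: \<delta>_def)
    then have yr: "r / 2 \<le> y" "y \<le> 3 / 2 * r" using y by linarith+
    have yX: "X \<le> y" using yr r by simp
    have y0: "0 < y" using yX X(1) by simp
    define s where "s = y / r - 1"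
    have s: "\<bar>s\<bar> \<le> \<delta>" using y r0 by (simp add: s_def abs_le_iff field_simps)
    have "\<bar>ln (1 + s) - s\<bar> \<le> 2 * s\<^sup>2"
      using s by (intro abs_ln_one_plus_x_minus_x_bound) (auto simp: \<delta>_def)
    also have "2 * s\<^sup>2 = 2 * \<bar>s\<bar> * \<bar>s\<bar>" by (simp add: power2_eq_square)
    also have "\<dots> \<le> 1 * \<bar>s\<bar>" using s by (intro mult_right_mono) (auto simp: \<delta>_def)
    finally have "\<bar>ln (1 + s)\<bar> \<le> 2 * \<delta>" using s by linarith
    moreover have "ln (1 + s) = - ln (r / y)" using r0 y0 by (simp add: s_def ln_div)
    ultimately have ln_small: "\<bar>ln (r / y)\<bar> \<le> d / 3" by (simp add: \<delta>_def)
    have "\<bar>\<alpha> * ln (r / y)\<bar> \<le> 1 * \<bar>ln (r / y)\<bar>"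
      unfolding abs_mult using alpha by (intro mult_right_mono) auto
    moreover have "\<bar>ln (L r) - ln (L y)\<bar> \<le> d / 3"
    proof (cases "y \<le> r")
      case True
      have "\<bar>ln (L (r / y * y)) - ln (L y)\<bar> \<le> d / 3"
        using yX True yr y0 by (intro X(2)) (auto simp: field_simps)
      then show ?thesis using y0 by simp
    next
      case False
      have "\<bar>ln (L (y / r * r)) - ln (L r)\<bar> \<le> d / 3"
        using r X(1) False yr r0 by (intro X(2)) (auto simp: field_simps)
      then show ?thesis using r0 by (simp add: abs_minus_commute)
    qed
    ultimately have "\<bar>\<alpha> * ln (r / y) + (ln (L r) - ln (L y))\<bar> < d"
      using ln_small d(1) by linarith
    then show ?thesis
      using d(2) r yX X(1) by (subst ratio_eq_exp) (auto intro: less_imp_le)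
  qed
  moreover have "0 < \<delta>" using d(1) by (simp add: \<delta>_def)
  ultimately show ?thesis by blast
qed

lemma ratio_lower_bound_half:
  "\<exists>R\<ge>1. \<exists>c>0. \<forall>r\<ge>R. \<forall>y\<in>{r / 2..r}. c \<le> f r / f y"
proof -
  obtain X where X: "1 \<le> X" "\<And>x u. X \<le> x \<Longrightarrow> u \<in> {1..2} \<Longrightarrow> \<bar>ln (L (u * x)) - ln (L x)\<bar> \<le> 1"
    using ln_L_uniform[of 1] by auto
  have "exp (- 1) \<le> f r / f y" if r: "2 * X \<le> r" and y: "y \<in> {r / 2..r}" for r y
  proof -
    have y0: "X \<le> y" "0 < y" using r y X(1) by auto
    have "\<bar>ln (L (r / y * y)) - ln (L y)\<bar> \<le> 1"
      using y y0 by (intro X(2)) (auto simp: field_simps)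
    moreover have "0 \<le> \<alpha> * ln (r / y)"
      using y y0 alpha by (intro mult_nonneg_nonneg) (auto simp: field_simps)
    ultimately have "- 1 \<le> \<alpha> * ln (r / y) + (ln (L r) - ln (L y))" using y0 by auto
    then show ?thesis using r y y0 X(1) by (subst ratio_eq_exp) auto
  qed
  moreover have "1 \<le> 2 * X" using X(1) by simp
  ultimately show ?thesis by (metis exp_gt_zero)
qed

text \<open>
  With \<open>e = \<eta> ln 2\<close> the logarithmic bound \<open>e + e log\<^sub>2(y/x)\<close> is a constant plus \<open>\<eta> ln(y/x)\<close>, which
  exponentiates to a power of \<open>y/x\<close>.
\<close>

lemma potter_bounds:
  assumes \<eta>: "0 < \<eta>"
  shows "\<exists>X\<ge>1. \<exists>C>0. \<forall>x\<ge>X. \<forall>y\<ge>x.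
    (y / x) powr (\<alpha> - \<eta>) \<le> C * (f y / f x) \<and> f y / f x \<le> C * (y / x) powr (\<alpha> + \<eta>)"
proof -
  define e where "e = \<eta> * ln 2"
  have e: "0 < e" using \<eta> by (simp add: e_def)
  obtain X where X: "1 \<le> X" "\<And>x u. X \<le> x \<Longrightarrow> u \<in> {1..2} \<Longrightarrow> \<bar>ln (L (u * x)) - ln (L x)\<bar> \<le> e"
    using ln_L_uniform[OF e] by auto
  have "(y / x) powr (\<alpha> - \<eta>) \<le> exp e * (f y / f x) \<and> f y / f x \<le> exp e * (y / x) powr (\<alpha> + \<eta>)"
    if xy: "X \<le> x" "x \<le> y" for x y
  proof -
    have pos: "0 < y / x" using xy X(1) by simp
    have "\<bar>ln (L y) - ln (L x)\<bar> \<le> e + e * log 2 (y / x)"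
      using slow_variation_log_bound[of X "\<lambda>x. ln (L x)" e x y] X xy e by auto
    also have "e * log 2 (y / x) = \<eta> * ln (y / x)" by (simp add: e_def log_def)
    finally have *: "\<bar>ln (L y) - ln (L x)\<bar> \<le> e + \<eta> * ln (y / x)" .
    have "f y / f x = exp (\<alpha> * ln (y / x) + (ln (L y) - ln (L x)))"
      using xy X(1) by (intro ratio_eq_exp) auto
    then show ?thesis
      using * pos xy X(1) by (simp add: powr_def flip: exp_add) (simp add: algebra_simps abs_le_iff)
  qed
  moreover have "0 < exp e" by simp
  ultimately show ?thesis using X(1) by blast
qed


text \<open>
  For \<open>\<alpha> < 1\<close> a Potter bound with exponent below 1 applies; for \<open>\<alpha> = 1\<close> the quotient is \<open>L\<close> itself.
\<close>

lemma rate_sublinear: "((\<lambda>r. f r / r) \<longlongrightarrow> 0) at_top"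
proof (cases "\<alpha> = 1")
  case True
  have "eventually (\<lambda>r. L r = f r / r) at_top"
    using eventually_ge_at_top[of 1] by eventually_elim (auto simp: f_eq True)
  then show ?thesis using L_zero[OF True] by (rule Lim_transform_eventually[rotated])
next
  case False
  define \<eta> where "\<eta> = (1 - \<alpha>) / 2"
  have \<eta>: "0 < \<eta>" "\<alpha> + \<eta> < 1" using False alpha by (simp_all add: \<eta>_def field_simps)
  obtain X C where X: "1 \<le> X" "0 < C" "\<And>y. X \<le> y \<Longrightarrow> f y / f X \<le> C * (y / X) powr (\<alpha> + \<eta>)"
    using potter_bounds[OF \<eta>(1)] by blast
  have "((\<lambda>r. (f X * C / X powr (\<alpha> + \<eta>)) * r powr (\<alpha> + \<eta> - 1)) \<longlongrightarrow> 0) at_top"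
    using \<eta> by (intro tendsto_mult_right_zero tendsto_neg_powr filterlim_ident) auto
  then show ?thesis
  proof (rule tendsto_sandwich[rotated 3])
    show "((\<lambda>r. 0) \<longlongrightarrow> (0::real)) at_top" by simp
    show "eventually (\<lambda>r. 0 \<le> f r / r) at_top"
      using eventually_ge_at_top[of 1]
      by eventually_elim (use f_pos in \<open>auto intro!: divide_nonneg_pos less_imp_le\<close>)
    show "eventually (\<lambda>r. f r / r \<le> (f X * C / X powr (\<alpha> + \<eta>)) * r powr (\<alpha> + \<eta> - 1)) at_top"
      using eventually_ge_at_top[of X]
    proof eventually_elim
      case (elim r)
      have "f r \<le> f X * (C * (r / X) powr (\<alpha> + \<eta>))"
        using X(3)[OF elim] f_pos[OF X(1)] by (simp add: pos_divide_le_eq mult.commute)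
      then have "f r / r \<le> f X * (C * (r / X) powr (\<alpha> + \<eta>)) / r"
        using elim X(1) by (intro divide_right_mono) auto
      also have "\<dots> = (f X * C / X powr (\<alpha> + \<eta>)) * r powr (\<alpha> + \<eta> - 1)"
        using elim X(1) by (simp add: powr_divide powr_diff)
      finally show ?case .
    qed
  qed
qed

text \<open>
  The square-summable majorant that makes dominated convergence applicable to the scale below. For
  \<open>\<alpha> = 1\<close> it comes from \<open>f(r)/r\<close> being bounded while \<open>f(j)\<close> grows at least like \<open>j\<^sup>3\<^sup>/\<^sup>4\<close>. For \<open>\<alpha> < 1\<close> Potter's
  bound gives \<open>C (r/j)\<^sup>\<beta> / r\<close>, and \<open>\<beta> \<le> 1\<close> absorbs the power of \<open>r\<close>.
\<close>

lemma rate_ratio_dominated: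
  "\<exists>\<beta>>1/2. \<exists>C. \<exists>N\<ge>1. \<forall>r\<ge>N. \<forall>j. N \<le> j \<and> j \<le> r \<longrightarrow> f r / (r * f j) \<le> C * j powr (- \<beta>)"
proof (cases "\<alpha> = 1")
  case True
  obtain X C where X: "1 \<le> X" "0 < C" "\<And>y. X \<le> y \<Longrightarrow> (y / X) powr (\<alpha> - 1 / 4) \<le> C * (f y / f X)"
    using potter_bounds[of "1 / 4"] by auto
  have "eventually (\<lambda>r. f r / r < 1) at_top"
    using rate_sublinear by (rule order_tendstoD) simp
  then obtain Y where Y: "\<And>r. Y \<le> r \<Longrightarrow> f r / r < 1" by (auto simp: eventually_at_top_linorder)
  define C' where "C' = C * X powr (3 / 4) / f X"
  have "f r / (r * f j) \<le> C' * j powr (- (3 / 4))" if "max X Y \<le> r" "max X Y \<le> j" "j \<le> r" for r j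
  proof -
    have j: "X \<le> j" "0 < j" "0 < f j" using that X(1) f_pos[of j] by auto
    have "(j / X) powr (3 / 4) \<le> C * (f j / f X)" using X(3)[of j] that True by simp
    then have "j powr (3 / 4) / X powr (3 / 4) \<le> C * f j / f X"
      using j X(1) by (simp add: powr_divide)
    then have "1 / f j \<le> C' * j powr (- (3 / 4))"
      using j X(1,2) f_pos[OF X(1)] by (simp add: C'_def powr_minus field_simps)
    moreover have "f r / r * (1 / f j) \<le> 1 * (1 / f j)"
      using Y[of r] that j by (intro mult_right_mono) auto
    ultimately show ?thesis by simp
  qed
  then show ?thesis using X(1)
    by (intro exI[of _ "3 / 4"] conjI exI[of _ C'] exI[of _ "max X Y"]) auto
next
  case False
  \<comment> \<open>The midpoint between 1 and the larger of \<open>\<alpha>\<close> and 1/2: any exponent strictly between them works.\<close>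
  define \<beta> where "\<beta> = (1 + max \<alpha> (1 / 2)) / 2"
  have \<beta>: "1 / 2 < \<beta>" "\<beta> < 1" "\<alpha> < \<beta>" using False alpha by (auto simp: \<beta>_def)
  obtain X C where X: "1 \<le> X" "0 < C"
    "\<And>x y. X \<le> x \<Longrightarrow> x \<le> y \<Longrightarrow> f y / f x \<le> C * (y / x) powr (\<alpha> + (\<beta> - \<alpha>))"
    using potter_bounds[of "\<beta> - \<alpha>"] \<beta> by auto
  have "f r / (r * f j) \<le> C * j powr (- \<beta>)" if "X \<le> r" "X \<le> j" "j \<le> r" for r j
  proof -
    have r: "1 \<le> r" "1 \<le> j" using that X(1) by auto
    have "f r / f j / r \<le> C * (r / j) powr \<beta> / r"
      using X(3)[of j r] that r by (intro divide_right_mono) auto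
    also have "\<dots> = C * j powr (- \<beta>) * r powr (\<beta> - 1)"
      using r by (simp add: powr_divide powr_minus powr_diff field_simps)
    also have "\<dots> \<le> C * j powr (- \<beta>) * 1"
      using r \<beta> X(2) powr_mono[of "\<beta> - 1" 0 r] by (intro mult_left_mono) auto
    finally show ?thesis by (simp add: mult.commute)
  qed
  then show ?thesis using X(1) \<beta>(1)
    by (intro exI[of _ \<beta>] conjI exI[of _ C] exI[of _ X]) auto
qed

text \<open>
  The square of the scale divided by \<open>r\<close> is \<open>\<Sum>\<^bsub>j\<le>r\<^esub> (f(r) / (r f(j)))\<^sup>2\<close>. Every term tends to 0 since \<open>f(r)/r\<close>
  does, and the terms have a summable majorant, so Tannery's theorem applies.
\<close>

lemma scale_sublinear:
  "(\<lambda>r::nat. f r * sqrt (\<Sum>j=1..r. 1 / f (real j) ^ 2) / r) \<longlonglongrightarrow> 0"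
proof -
  obtain \<beta> C N where dom: "1 / 2 < \<beta>" "1 \<le> N"
    "\<And>r j. N \<le> r \<Longrightarrow> N \<le> j \<Longrightarrow> j \<le> r \<Longrightarrow> f r / (r * f j) \<le> C * j powr (- \<beta>)"
    using rate_ratio_dominated by blast
  define a where "a j r = (if 1 \<le> j \<and> j \<le> r then (f (real r) / (real r * f (real j)))\<^sup>2 else 0)" for j r :: nat
  have "(\<lambda>r. suminf (\<lambda>j. a j r)) \<longlonglongrightarrow> suminf (\<lambda>j. 0)"
  proof (rule tannerys_theorem[THEN conjunct2, THEN conjunct2])
    show "(\<lambda>r. a j r) \<longlonglongrightarrow> 0" for j
    proof (cases "1 \<le> j")
      case True
      have "(\<lambda>r::nat. (f (real r) / real r * (1 / f (real j)))\<^sup>2) \<longlonglongrightarrow> (0 * (1 / f (real j)))\<^sup>2"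
        by (intro tendsto_intros filterlim_compose[OF rate_sublinear filterlim_real_sequentially])
      moreover have "eventually (\<lambda>r. (f (real r) / real r * (1 / f (real j)))\<^sup>2 = a j r) sequentially"
        using eventually_ge_at_top[of j] by eventually_elim (use True in \<open>simp add: a_def\<close>)
      ultimately have "(\<lambda>r. a j r) \<longlonglongrightarrow> (0 * (1 / f (real j)))\<^sup>2"
        by (rule Lim_transform_eventually)
      then show ?thesis by simp
    qed (simp add: a_def)
    show "eventually (\<lambda>(j, r). norm (a j r) \<le> C\<^sup>2 * real j powr (- 2 * \<beta>)) (sequentially \<times>\<^sub>F sequentially)"
      unfolding eventually_prod_sequentially
    proof (intro exI[of _ "nat \<lceil>N\<rceil>"] allI impI, clarify)
      fix j r assume jr: "nat \<lceil>N\<rceil> \<le> j" "nat \<lceil>N\<rceil> \<le> r"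
      have NN: "N \<le> real j" "N \<le> real r" using jr by linarith+
      show "norm (a j r) \<le> C\<^sup>2 * real j powr (- 2 * \<beta>)"
      proof (cases "1 \<le> j \<and> j \<le> r")
        case True
        have "(f (real r) / (real r * f (real j)))\<^sup>2 \<le> (C * real j powr (- \<beta>))\<^sup>2"
          using dom(3)[of r j] NN True dom(2) f_pos[of r] f_pos[of j]
          by (intro power_mono) (auto intro!: divide_nonneg_nonneg mult_nonneg_nonneg less_imp_le)
        also have "\<dots> = C\<^sup>2 * real j powr (- 2 * \<beta>)"
          using True by (simp add: power_mult_distrib power2_eq_square flip: powr_add)
        finally show ?thesis using True by (simp add: a_def)
      qed (auto simp: a_def)
    qed
    show "summable (\<lambda>j. C\<^sup>2 * real j powr (- 2 * \<beta>))"
      using dom(1) by (intro summable_mult) (simp add: summable_real_powr_iff)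
  qed simp
  then have "(\<lambda>r. sqrt (suminf (\<lambda>j. a j r))) \<longlonglongrightarrow> sqrt 0"
    by (intro tendsto_intros) simp
  moreover have "eventually (\<lambda>r. sqrt (suminf (\<lambda>j. a j r)) =
      f (real r) * sqrt (\<Sum>j=1..r. 1 / f (real j) ^ 2) / real r) sequentially"
    using eventually_ge_at_top[of 1]
  proof eventually_elim
    case (elim r)
    have "suminf (\<lambda>j. a j r) = (\<Sum>j=1..r. a j r)"
      by (rule suminf_finite) (auto simp: a_def)
    also have "\<dots> = (\<Sum>j=1..r. (f (real r) / real r)\<^sup>2 * (1 / f (real j) ^ 2))"
      by (intro sum.cong refl) (auto simp: a_def power_divide power_mult_distrib)
    also have "\<dots> = (f (real r) / real r)\<^sup>2 * (\<Sum>j=1..r. 1 / f (real j) ^ 2)"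
      by (simp add: sum_distrib_left)
    finally show ?case
      using elim f_pos[of r] by (simp add: real_sqrt_mult abs_of_pos)
  qed
  ultimately show ?thesis by (simp add: filterlim_cong)
qed

text \<open>
  For \<open>r/2 \<le> j \<le> r\<close> the ratio \<open>f(r)/f(j)\<close> is bounded below, so these about \<open>r/2\<close> terms alone make the
  square of the scale grow linearly.
\<close>

lemma scale_at_top:
  "filterlim (\<lambda>r::nat. f r * sqrt (\<Sum>j=1..r. 1 / f (real j) ^ 2)) at_top sequentially"
proof -
  obtain R c where R: "1 \<le> R" "0 < c" "\<And>r y. R \<le> r \<Longrightarrow> y \<in> {r / 2..r} \<Longrightarrow> c \<le> f r / f y"
    using ratio_lower_bound_half by blast
  have "filterlim (\<lambda>r::nat. sqrt (c\<^sup>2 * (real r / 2 - 1))) at_top sequentially"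
    using R(2) by real_asymp
  then show ?thesis
  proof (rule filterlim_at_top_mono)
    show "eventually (\<lambda>r::nat. sqrt (c\<^sup>2 * (real r / 2 - 1))
        \<le> f r * sqrt (\<Sum>j=1..r. 1 / f (real j) ^ 2)) sequentially"
      using eventually_ge_at_top[of "nat \<lceil>R\<rceil>"]
    proof eventually_elim
      case (elim r)
      have r: "R \<le> real r" "1 \<le> real r" using elim R(1) by linarith+
      have fr: "0 < f (real r)" using f_pos r by simp
      define J where "J = {nat \<lceil>real r / 2\<rceil>..r}"
      have "real r / 2 - 1 \<le> real (card J)" by (simp add: J_def) linarith
      then have "c\<^sup>2 * (real r / 2 - 1) \<le> c\<^sup>2 * real (card J)" by (intro mult_left_mono) auto
      also have "\<dots> = (\<Sum>j\<in>J. c\<^sup>2)" by simp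
      also have "\<dots> \<le> (\<Sum>j\<in>J. (f r / f j)\<^sup>2)"
      proof (intro sum_mono power_mono)
        fix j assume "j \<in> J"
        then have "real j \<in> {real r / 2..real r}" unfolding J_def by (auto; linarith)
        then show "c \<le> f r / f j" by (rule R(3)[OF r(1)])
      qed (use R in auto)
      also have "\<dots> \<le> (\<Sum>j=1..r. (f r / f j)\<^sup>2)"
        using r by (intro sum_mono2) (auto simp: J_def Suc_le_eq)
      also have "\<dots> = (f r)\<^sup>2 * (\<Sum>j=1..r. 1 / f j ^ 2)"
        by (simp add: sum_distrib_left power_divide)
      finally have "sqrt (c\<^sup>2 * (real r / 2 - 1)) \<le> sqrt ((f r)\<^sup>2 * (\<Sum>j=1..r. 1 / f j ^ 2))"
        by (rule real_sqrt_le_mono)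
      then show ?case using fr by (simp add: real_sqrt_mult)
    qed
  qed
qed

end

section \<open>The forward equations of a pure birth process\<close>

text \<open>
  The next two lemmas turn an increment estimate that is uniform in \<open>t\<close> but only concerns forward
  steps into continuity and two-sided differentiability. A backward step from \<open>t\<close> to \<open>t - h\<close> is a
  forward step from \<open>t - h\<close>, which is why uniformity of the error is essential.
\<close>

lemma continuous_on_of_uniform_increments:
  fixes F g e :: "real \<Rightarrow> real"
  assumes step: "\<And>t h. 0 \<le> t \<Longrightarrow> 0 \<le> h \<Longrightarrow> \<bar>F (t + h) - F t - h * g t\<bar> \<le> e h"
    and e: "((\<lambda>h. e h / h) \<longlongrightarrow> 0) (at_right 0)"
    and g: "\<And>t. 0 \<le> t \<Longrightarrow> \<bar>g t\<bar> \<le> B"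
  shows "continuous_on {0..} F"
proof -
  have "((\<lambda>h. h * (e h / h) + h * B) \<longlongrightarrow> 0 * 0 + 0 * B) (at_right 0)"
    by (intro tendsto_intros e)
  moreover have "eventually (\<lambda>h. h * (e h / h) + h * B = e h + h * B) (at_right (0::real))"
    using eventually_at_right_less[of 0] by eventually_elim auto
  ultimately have lim: "((\<lambda>h. e h + h * B) \<longlongrightarrow> 0) (at_right 0)"
    using Lim_transform_eventually by fastforce
  have inc: "\<bar>F (t + h) - F t\<bar> \<le> e h + h * B" if "0 \<le> t" "0 \<le> h" for t h
  proof -
    have "\<bar>h * g t\<bar> \<le> h * B" using g[of t] that by (simp add: abs_mult mult_left_mono)
    then show ?thesis using step[OF that] by linarith
  qed
  show ?thesis
    unfolding continuous_on_iff
  proof (intro ballI allI impI)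
    fix t \<epsilon> :: real assume t: "t \<in> {0..}" and \<epsilon>: "0 < \<epsilon>"
    have "eventually (\<lambda>h. e h + h * B < \<epsilon>) (at_right 0)"
      using lim \<epsilon> by (rule order_tendstoD)
    then obtain d where d: "0 < d" "\<And>h. 0 < h \<Longrightarrow> h < d \<Longrightarrow> e h + h * B < \<epsilon>"
      by (auto simp: eventually_at_right_field)
    have "dist (F s) (F t) < \<epsilon>" if "s \<in> {0..}" "dist s t < d" for s
    proof (cases s t rule: linorder_cases)
      case less
      then show ?thesis
        using inc[of s "t - s"] d(2)[of "t - s"] that by (auto simp: dist_real_def abs_minus_commute)
    next
      case greater
      then show ?thesis
        using inc[of t "s - t"] d(2)[of "s - t"] that t by (auto simp: dist_real_def)
    qed (use \<epsilon> in simp)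
    with d(1) show "\<exists>d>0. \<forall>s\<in>{0..}. dist s t < d \<longrightarrow> dist (F s) (F t) < \<epsilon>" by blast
  qed
qed

lemma has_derivative_of_uniform_increments:
  fixes F g e :: "real \<Rightarrow> real"
  assumes step: "\<And>t h. 0 \<le> t \<Longrightarrow> 0 \<le> h \<Longrightarrow> \<bar>F (t + h) - F t - h * g t\<bar> \<le> e h"
    and e: "((\<lambda>h. e h / h) \<longlongrightarrow> 0) (at_right 0)"
    and g: "continuous_on {0..} g" and t: "0 < t"
  shows "(F has_real_derivative g t) (at t)"
  unfolding DERIV_def LIM_eq
proof (intro allI impI)
  fix \<epsilon> :: real assume \<epsilon>: "0 < \<epsilon>"
  have "eventually (\<lambda>h. e h / h < \<epsilon> / 2) (at_right 0)"
    using e \<epsilon> by (intro order_tendstoD) auto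
  then obtain d1 where d1: "0 < d1" "\<And>h. 0 < h \<Longrightarrow> h < d1 \<Longrightarrow> e h / h < \<epsilon> / 2"
    by (auto simp: eventually_at_right_field)
  obtain d2 where d2: "0 < d2" "\<And>s. 0 \<le> s \<Longrightarrow> \<bar>s - t\<bar> < d2 \<Longrightarrow> \<bar>g s - g t\<bar> < \<epsilon> / 2"
    using g t \<epsilon> unfolding continuous_on_iff
    by (metis atLeast_iff dist_real_def half_gt_zero less_imp_le)
  have quot: "\<bar>(F (s + h) - F s) / h - g s\<bar> < \<epsilon> / 2" if "0 \<le> s" "0 < h" "h < d1" for s h
  proof -
    have "\<bar>(F (s + h) - F s) / h - g s\<bar> = \<bar>F (s + h) - F s - h * g s\<bar> / h"
      using that by (simp add: abs_if field_simps)
    also have "\<dots> \<le> e h / h" using step[of s h] that by (intro divide_right_mono) auto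
    finally show ?thesis using d1(2)[of h] that by linarith
  qed
  have "norm ((F (t + h) - F t) / h - g t) < \<epsilon>" if "h \<noteq> 0" "norm h < min t (min d1 d2)" for h
  proof (cases "0 < h")
    case True
    then show ?thesis using quot[of t h] that t \<epsilon> by auto
  next
    case False
    have "\<bar>(F (t + h + - h) - F (t + h)) / (- h) - g (t + h)\<bar> < \<epsilon> / 2"
      using False that by (intro quot) auto
    moreover have "\<bar>g (t + h) - g t\<bar> < \<epsilon> / 2" using that by (intro d2) auto
    moreover have "(F (t + h + - h) - F (t + h)) / (- h) = (F (t + h) - F t) / h"
      using that by (simp add: field_simps)
    ultimately have "\<bar>(F (t + h) - F t) / h - g t\<bar> < \<epsilon>" by linarith
    then show ?thesis by simp
  qed
  moreover have "0 < min t (min d1 d2)" using t d1 d2 by simp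
  ultimately show "\<exists>d>0. \<forall>h. h \<noteq> 0 \<and> norm (h - 0) < d \<longrightarrow> norm ((F (t + h) - F t) / h - g t) < \<epsilon>"
    by (metis diff_zero)
qed

locale birth_process =
  fixes M :: "'a measure" and f :: "real \<Rightarrow> real" and \<xi> :: "real \<Rightarrow> 'a \<Rightarrow> nat"
  assumes birth: "pure_birth_process M f \<xi>"
begin

sublocale prob_space M
  using birth by (simp add: pure_birth_process_def)

lemma \<xi>_measurable [measurable]: "0 \<le> t \<Longrightarrow> \<xi> t \<in> measurable M (count_space UNIV)"
  using birth by (simp add: pure_birth_process_def)

lemma \<xi>_mono: "0 \<le> s \<Longrightarrow> s \<le> t \<Longrightarrow> AE \<omega> in M. \<xi> s \<omega> \<le> \<xi> t \<omega>"
proof -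
  assume st: "0 \<le> s" "s \<le> t"
  have "AE \<omega> in M. mono_on {0..} (\<lambda>t. \<xi> t \<omega>)"
    using birth by (simp add: pure_birth_process_def)
  then show ?thesis
    by eventually_elim (use st in \<open>auto simp: mono_on_def\<close>)
qed

lemma \<xi>_homogeneous:
  assumes "0 \<le> s" "0 \<le> t" "0 \<le> h" "0 < \<P>(\<omega> in M. \<xi> s \<omega> = j)" "0 < \<P>(\<omega> in M. \<xi> t \<omega> = j)"
  shows "\<P>(\<omega> in M. \<xi> (s + h) \<omega> = k \<bar> \<xi> s \<omega> = j) = \<P>(\<omega> in M. \<xi> (t + h) \<omega> = k \<bar> \<xi> t \<omega> = j)"
  using birth assms unfolding pure_birth_process_def by blast

text \<open>
  The infinitesimal description in quotient form.
\<close>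

lemma \<xi>_rates:
  assumes "0 \<le> t" "0 < \<P>(\<omega> in M. \<xi> t \<omega> = k)"
  shows "((\<lambda>h. \<P>(\<omega> in M. \<xi> (t + h) \<omega> = k + 1 \<bar> \<xi> t \<omega> = k) / h) \<longlongrightarrow> f (real (k + 1))) (at_right 0)"
    and "((\<lambda>h. \<P>(\<omega> in M. \<xi> (t + h) \<omega> > k + 1 \<bar> \<xi> t \<omega> = k) / h) \<longlongrightarrow> 0) (at_right 0)"
proof -
  have o: "(\<lambda>h. \<P>(\<omega> in M. \<xi> (t + h) \<omega> = k + 1 \<bar> \<xi> t \<omega> = k) - f (real (k + 1)) * h) \<in> o[at_right 0](\<lambda>h. h)"
    "(\<lambda>h. \<P>(\<omega> in M. \<xi> (t + h) \<omega> > k + 1 \<bar> \<xi> t \<omega> = k)) \<in> o[at_right 0](\<lambda>h. h)"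
    using birth assms unfolding pure_birth_process_def by blast+
  show "((\<lambda>h. \<P>(\<omega> in M. \<xi> (t + h) \<omega> > k + 1 \<bar> \<xi> t \<omega> = k) / h) \<longlongrightarrow> 0) (at_right 0)"
    by (rule smalloD_tendsto[OF o(2)])
  have "((\<lambda>h. (\<P>(\<omega> in M. \<xi> (t + h) \<omega> = k + 1 \<bar> \<xi> t \<omega> = k) - f (real (k + 1)) * h) / h + f (real (k + 1)))
      \<longlongrightarrow> 0 + f (real (k + 1))) (at_right 0)"
    by (intro tendsto_intros smalloD_tendsto[OF o(1)])
  moreover have "eventually (\<lambda>h::real. (\<P>(\<omega> in M. \<xi> (t + h) \<omega> = k + 1 \<bar> \<xi> t \<omega> = k) - f (real (k + 1)) * h) / h
      + f (real (k + 1)) = \<P>(\<omega> in M. \<xi> (t + h) \<omega> = k + 1 \<bar> \<xi> t \<omega> = k) / h) (at_right 0)"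
    using eventually_at_right_less[of 0] by eventually_elim (simp add: diff_divide_distrib)
  ultimately show "((\<lambda>h. \<P>(\<omega> in M. \<xi> (t + h) \<omega> = k + 1 \<bar> \<xi> t \<omega> = k) / h) \<longlongrightarrow> f (real (k + 1))) (at_right 0)"
    using Lim_transform_eventually by fastforce
qed

text \<open>
  Time homogeneity makes the conditional jump probabilities functions of the elapsed time only, so the
  errors \<open>o(h)\<close> hold uniformly over all starting times. Monotone paths express the probabilities of
  leaving \<open>j\<close>, and of jumping beyond \<open>j + 1\<close>, through the homogeneous single-state probabilities \<open>q\<close>. For
  a state that is never visited any functions with the right asymptotics will do.
\<close>

lemma jump_probabilities:
  "\<exists>a b. ((\<lambda>h. a h / h) \<longlongrightarrow> f (real (j + 1))) (at_right 0) \<and> ((\<lambda>h. b h / h) \<longlongrightarrow> 0) (at_right 0) \<and>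
    (\<forall>t\<ge>0. \<forall>h\<ge>0. \<P>(\<omega> in M. \<xi> t \<omega> = j \<and> j < \<xi> (t + h) \<omega>) = \<P>(\<omega> in M. \<xi> t \<omega> = j) * a h \<and>
       \<P>(\<omega> in M. \<xi> t \<omega> = j \<and> j + 1 < \<xi> (t + h) \<omega>) = \<P>(\<omega> in M. \<xi> t \<omega> = j) * b h)"
proof (cases "\<exists>t\<ge>0. 0 < \<P>(\<omega> in M. \<xi> t \<omega> = j)")
  case False
  have "\<P>(\<omega> in M. \<xi> t \<omega> = j \<and> j < \<xi> (t + h) \<omega>) = 0 \<and>
      \<P>(\<omega> in M. \<xi> t \<omega> = j \<and> j + 1 < \<xi> (t + h) \<omega>) = 0 \<and> \<P>(\<omega> in M. \<xi> t \<omega> = j) = 0"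
    if [arith]: "0 \<le> t" "0 \<le> h" for t h
  proof -
    have z: "\<P>(\<omega> in M. \<xi> t \<omega> = j) = 0"
      using False that measure_nonneg[of M "{\<omega> \<in> space M. \<xi> t \<omega> = j}"] by (auto simp: not_less intro: antisym)
    have "\<P>(\<omega> in M. \<xi> t \<omega> = j \<and> j < \<xi> (t + h) \<omega>) \<le> \<P>(\<omega> in M. \<xi> t \<omega> = j)"
      "\<P>(\<omega> in M. \<xi> t \<omega> = j \<and> j + 1 < \<xi> (t + h) \<omega>) \<le> \<P>(\<omega> in M. \<xi> t \<omega> = j)"
      by (intro finite_measure_mono; force)+
    with z show ?thesis by (simp add: measure_le_0_iff)
  qed
  note zero = this
  have "((\<lambda>h. f (real (j + 1)) * h / h) \<longlongrightarrow> f (real (j + 1))) (at_right 0)"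
    by (intro tendsto_eventually) (simp add: eventually_at_filter)
  moreover have "((\<lambda>h::real. 0 / h) \<longlongrightarrow> (0::real)) (at_right 0)" by simp
  ultimately show ?thesis
    by (intro exI[of _ "\<lambda>h. f (real (j + 1)) * h"] exI[of _ "\<lambda>h. 0"] conjI allI impI) (simp_all only: zero mult_zero_left)
next
  case True
  then obtain s where s: "0 \<le> s" "0 < \<P>(\<omega> in M. \<xi> s \<omega> = j)" by auto
  define q where "q k h = \<P>(\<omega> in M. \<xi> (s + h) \<omega> = k \<bar> \<xi> s \<omega> = j)" for k h
  have joint: "\<P>(\<omega> in M. \<xi> t \<omega> = j \<and> j < \<xi> (t + h) \<omega>) = \<P>(\<omega> in M. \<xi> t \<omega> = j) * (1 - q j h) \<and>
      \<P>(\<omega> in M. \<xi> t \<omega> = j \<and> j + 1 < \<xi> (t + h) \<omega>) = \<P>(\<omega> in M. \<xi> t \<omega> = j) * (1 - q j h - q (j + 1) h)"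
    if th [arith]: "0 \<le> t" "0 \<le> h" for t h
  proof -
    have J: "\<P>(\<omega> in M. \<xi> (t + h) \<omega> = k \<and> \<xi> t \<omega> = j) = \<P>(\<omega> in M. \<xi> t \<omega> = j) * q k h" for k
    proof (cases "\<P>(\<omega> in M. \<xi> t \<omega> = j) = 0")
      case True
      have "\<P>(\<omega> in M. \<xi> (t + h) \<omega> = k \<and> \<xi> t \<omega> = j) \<le> \<P>(\<omega> in M. \<xi> t \<omega> = j)"
        by (intro finite_measure_mono) force+
      with True show ?thesis by (simp add: measure_le_0_iff)
    next
      case False
      then have "0 < \<P>(\<omega> in M. \<xi> t \<omega> = j)" using measure_nonneg order_le_less by metis
      then have "q k h = \<P>(\<omega> in M. \<xi> (t + h) \<omega> = k \<bar> \<xi> t \<omega> = j)"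
        unfolding q_def using s th by (intro \<xi>_homogeneous)
      with False show ?thesis by (simp add: cond_prob_def)
    qed
    have mono: "AE \<omega> in M. \<xi> t \<omega> \<le> \<xi> (t + h) \<omega>" by (rule \<xi>_mono) auto
    have 1: "\<P>(\<omega> in M. \<xi> t \<omega> = j) = \<P>(\<omega> in M. \<xi> (t + h) \<omega> = j \<and> \<xi> t \<omega> = j)
        + \<P>(\<omega> in M. \<xi> t \<omega> = j \<and> j < \<xi> (t + h) \<omega>)"
    proof (subst finite_measure_Union[symmetric])
      show "\<P>(\<omega> in M. \<xi> t \<omega> = j) = measure M ({\<omega> \<in> space M. \<xi> (t + h) \<omega> = j \<and> \<xi> t \<omega> = j}
          \<union> {\<omega> \<in> space M. \<xi> t \<omega> = j \<and> j < \<xi> (t + h) \<omega>})"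
        by (rule finite_measure_eq_AE) (use mono in \<open>eventually_elim, auto\<close>, measurable)
    qed auto
    have 2: "\<P>(\<omega> in M. \<xi> t \<omega> = j \<and> j < \<xi> (t + h) \<omega>) = \<P>(\<omega> in M. \<xi> (t + h) \<omega> = j + 1 \<and> \<xi> t \<omega> = j)
        + \<P>(\<omega> in M. \<xi> t \<omega> = j \<and> j + 1 < \<xi> (t + h) \<omega>)"
      by (subst finite_measure_Union[symmetric])
         (auto intro!: arg_cong[where f = "measure M"])
    from 1 2 show ?thesis unfolding J right_diff_distrib by linarith
  qed
  have cond: "\<P>(\<omega> in M. \<xi> (s + h) \<omega> > j + 1 \<bar> \<xi> s \<omega> = j) = 1 - q j h - q (j + 1) h" if "0 \<le> h" for h
    using joint[OF s(1) that] s(2) by (simp add: cond_prob_def conj_commute)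
  have b: "((\<lambda>h. (1 - q j h - q (j + 1) h) / h) \<longlongrightarrow> 0) (at_right 0)"
  proof (rule Lim_transform_eventually[OF \<xi>_rates(2)[OF s]])
    show "eventually (\<lambda>h. \<P>(\<omega> in M. \<xi> (s + h) \<omega> > j + 1 \<bar> \<xi> s \<omega> = j) / h = (1 - q j h - q (j + 1) h) / h) (at_right 0)"
      using eventually_at_right_less[of 0] by eventually_elim (simp only: cond less_imp_le)
  qed
  have a: "((\<lambda>h. (1 - q j h) / h) \<longlongrightarrow> f (real (j + 1))) (at_right 0)"
    using tendsto_add[OF \<xi>_rates(1)[OF s] b]
    by (simp add: q_def flip: add_divide_distrib)
  show ?thesis
    by (intro exI[of _ "\<lambda>h. 1 - q j h"] exI[of _ "\<lambda>h. 1 - q j h - q (j + 1) h"] conjI allI impI a b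
        joint[THEN conjunct1] joint[THEN conjunct2])
qed

definition tail :: "nat \<Rightarrow> real \<Rightarrow> real" where
  "tail n t = \<P>(\<omega> in M. n \<le> \<xi> t \<omega>)"

lemma tail_bounds: "0 \<le> tail n t" "tail n t \<le> 1"
  by (auto simp: tail_def)

text \<open>
  To cross the level \<open>k\<close> during a step of length \<open>h\<close> the process either starts in \<open>k\<close> and leaves it, or
  starts below \<open>k\<close> and makes at least two births at once, which costs \<open>o(h)\<close>.
\<close>

lemma tail_increment:
  "\<exists>e. ((\<lambda>h. e h / h) \<longlongrightarrow> 0) (at_right 0) \<and> (\<forall>t\<ge>0. \<forall>h\<ge>0.
     \<bar>tail (Suc k) (t + h) - tail (Suc k) t - h * (f (real (Suc k)) * (tail k t - tail (Suc k) t))\<bar> \<le> e h)"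
proof -
  let ?c = "f (real (Suc k))"
  define Q where "Q j a b \<longleftrightarrow> ((\<lambda>h. a h / h) \<longlongrightarrow> f (real (j + 1))) (at_right 0) \<and>
    ((\<lambda>h. b h / h) \<longlongrightarrow> 0) (at_right 0) \<and>
    (\<forall>t\<ge>0. \<forall>h\<ge>0. \<P>(\<omega> in M. \<xi> t \<omega> = j \<and> j < \<xi> (t + h) \<omega>) = \<P>(\<omega> in M. \<xi> t \<omega> = j) * a h \<and>
       \<P>(\<omega> in M. \<xi> t \<omega> = j \<and> j + 1 < \<xi> (t + h) \<omega>) = \<P>(\<omega> in M. \<xi> t \<omega> = j) * b h)" for j a b
  have "\<exists>a b. Q j a b" for j
    unfolding Q_def by (rule jump_probabilities)
  then obtain a b where "\<And>j. Q j (a j) (b j)" by metis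
  then have a: "\<And>j. ((\<lambda>h. a j h / h) \<longlongrightarrow> f (real (j + 1))) (at_right 0)"
    and b: "\<And>j. ((\<lambda>h. b j h / h) \<longlongrightarrow> 0) (at_right 0)"
    and Pa: "\<And>j t h. 0 \<le> t \<Longrightarrow> 0 \<le> h \<Longrightarrow>
      \<P>(\<omega> in M. \<xi> t \<omega> = j \<and> j < \<xi> (t + h) \<omega>) = \<P>(\<omega> in M. \<xi> t \<omega> = j) * a j h"
    and Pb: "\<And>j t h. 0 \<le> t \<Longrightarrow> 0 \<le> h \<Longrightarrow>
      \<P>(\<omega> in M. \<xi> t \<omega> = j \<and> j + 1 < \<xi> (t + h) \<omega>) = \<P>(\<omega> in M. \<xi> t \<omega> = j) * b j h"
    unfolding Q_def by blast+
  define e where "e h = \<bar>a k h - ?c * h\<bar> + (\<Sum>j<k. \<bar>b j h\<bar>)" for h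
  have "((\<lambda>h. \<bar>a k h / h - ?c\<bar> + (\<Sum>j<k. \<bar>b j h / h\<bar>)) \<longlongrightarrow> \<bar>f (real (k + 1)) - ?c\<bar> + (\<Sum>j<k. \<bar>0\<bar>)) (at_right 0)"
    by (intro tendsto_intros a b)
  moreover have "eventually (\<lambda>h. \<bar>a k h / h - ?c\<bar> + (\<Sum>j<k. \<bar>b j h / h\<bar>) = e h / h) (at_right 0)"
    using eventually_at_right_less[of 0]
  proof eventually_elim
    case (elim h)
    then have "\<bar>a k h / h - ?c\<bar> = \<bar>a k h - ?c * h\<bar> / h"
      by (simp add: abs_if field_simps)
    with elim show ?case by (simp add: e_def add_divide_distrib sum_divide_distrib)
  qed
  ultimately have e: "((\<lambda>h. e h / h) \<longlongrightarrow> 0) (at_right 0)"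
    using Lim_transform_eventually by fastforce
  have "\<bar>tail (Suc k) (t + h) - tail (Suc k) t - h * (?c * (tail k t - tail (Suc k) t))\<bar> \<le> e h"
    if th [arith]: "0 \<le> t" "0 \<le> h" for t h
  proof -
    have mono: "AE \<omega> in M. \<xi> t \<omega> \<le> \<xi> (t + h) \<omega>" by (rule \<xi>_mono) auto
    define p where "p = \<P>(\<omega> in M. \<xi> t \<omega> = k)"
    have p: "tail k t - tail (Suc k) t = p"
    proof -
      have "tail k t = \<P>(\<omega> in M. \<xi> t \<omega> = k) + tail (Suc k) t"
        unfolding tail_def by (subst finite_measure_Union[symmetric]) (auto intro!: arg_cong[where f = "measure M"])
      then show ?thesis by (simp add: p_def)
    qed
    have "tail (Suc k) (t + h) = tail (Suc k) t + \<P>(\<omega> in M. \<xi> t \<omega> \<le> k \<and> k < \<xi> (t + h) \<omega>)"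
      unfolding tail_def
    proof (subst finite_measure_Union[symmetric])
      show "\<P>(\<omega> in M. Suc k \<le> \<xi> (t + h) \<omega>) = measure M ({\<omega> \<in> space M. Suc k \<le> \<xi> t \<omega>}
          \<union> {\<omega> \<in> space M. \<xi> t \<omega> \<le> k \<and> k < \<xi> (t + h) \<omega>})"
        by (rule finite_measure_eq_AE) (use mono in \<open>eventually_elim, auto\<close>, measurable)
    qed auto
    moreover have "\<P>(\<omega> in M. \<xi> t \<omega> \<le> k \<and> k < \<xi> (t + h) \<omega>) = (\<Sum>j\<le>k. \<P>(\<omega> in M. \<xi> t \<omega> = j \<and> k < \<xi> (t + h) \<omega>))"
      by (subst finite_measure_finite_Union[symmetric])
         (auto simp: disjoint_family_on_def intro!: arg_cong[where f = "measure M"])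
    moreover have "\<dots> = (\<Sum>j<k. \<P>(\<omega> in M. \<xi> t \<omega> = j \<and> k < \<xi> (t + h) \<omega>)) + p * a k h"
      using Pa[of t h k] by (simp add: p_def flip: lessThan_Suc_atMost)
    ultimately have inc: "tail (Suc k) (t + h) - tail (Suc k) t =
        (\<Sum>j<k. \<P>(\<omega> in M. \<xi> t \<omega> = j \<and> k < \<xi> (t + h) \<omega>)) + p * a k h"
      by simp
    have "\<P>(\<omega> in M. \<xi> t \<omega> = j \<and> k < \<xi> (t + h) \<omega>) \<le> \<bar>b j h\<bar>" if "j < k" for j
    proof -
      have "\<P>(\<omega> in M. \<xi> t \<omega> = j \<and> k < \<xi> (t + h) \<omega>) \<le> \<P>(\<omega> in M. \<xi> t \<omega> = j \<and> j + 1 < \<xi> (t + h) \<omega>)"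
        using that by (intro finite_measure_mono) force+
      also have "\<dots> \<le> \<P>(\<omega> in M. \<xi> t \<omega> = j) * \<bar>b j h\<bar>"
        unfolding Pb[OF th] by (intro mult_left_mono) auto
      also have "\<dots> \<le> 1 * \<bar>b j h\<bar>" by (intro mult_right_mono) auto
      finally show ?thesis by simp
    qed
    then have "(\<Sum>j<k. \<P>(\<omega> in M. \<xi> t \<omega> = j \<and> k < \<xi> (t + h) \<omega>)) \<le> (\<Sum>j<k. \<bar>b j h\<bar>)"
      by (intro sum_mono) auto
    moreover have "0 \<le> (\<Sum>j<k. \<P>(\<omega> in M. \<xi> t \<omega> = j \<and> k < \<xi> (t + h) \<omega>))"
      by (intro sum_nonneg) auto
    moreover have "\<bar>p * a k h - h * (?c * p)\<bar> \<le> \<bar>a k h - ?c * h\<bar>"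
    proof -
      have "p * a k h - h * (?c * p) = p * (a k h - ?c * h)" by (simp add: algebra_simps)
      then have "\<bar>p * a k h - h * (?c * p)\<bar> = \<bar>p\<bar> * \<bar>a k h - ?c * h\<bar>" by (simp only: abs_mult)
      also have "\<dots> \<le> 1 * \<bar>a k h - ?c * h\<bar>" by (intro mult_right_mono) (auto simp: p_def)
      finally show ?thesis by simp
    qed
    ultimately show ?thesis unfolding p inc e_def by linarith
  qed
  with e show ?thesis by blast
qed

lemma tail_continuous: "continuous_on {0..} (tail k)"
proof (cases k)
  case 0
  then have "tail k = (\<lambda>t. 1)" by (auto simp: tail_def prob_space)
  then show ?thesis by simp
next
  case (Suc n)
  obtain e where e: "((\<lambda>h. e h / h) \<longlongrightarrow> 0) (at_right 0)" and
    step: "\<And>t h. 0 \<le> t \<Longrightarrow> 0 \<le> h \<Longrightarrow>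
      \<bar>tail (Suc n) (t + h) - tail (Suc n) t - h * (f (real (Suc n)) * (tail n t - tail (Suc n) t))\<bar> \<le> e h"
    using tail_increment[of n] by blast
  have "\<bar>tail n t - tail (Suc n) t\<bar> \<le> 1" for t
    using tail_bounds[of n t] tail_bounds[of "Suc n" t] by (simp add: abs_le_iff)
  then have bound: "\<bar>f (real (Suc n)) * (tail n t - tail (Suc n) t)\<bar> \<le> \<bar>f (real (Suc n))\<bar> * 1" for t
    unfolding abs_mult by (intro mult_left_mono) auto
  show ?thesis
    unfolding Suc by (rule continuous_on_of_uniform_increments[OF step e bound])
qed

text \<open>
  The forward equation \<open>tail\<^sub>k\<^sub>+\<^sub>1' = c (tail\<^sub>k - tail\<^sub>k\<^sub>+\<^sub>1)\<close>, integrated with the factor \<open>exp(c u)\<close>. In this form it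
  determines the tails successively, and it can be compared directly with a convolution.
\<close>

lemma tail_recursion:
  assumes t: "0 \<le> t" and c_def: "c = f (real (Suc k))"
  shows "((\<lambda>u. c * exp (c * u) * tail k u) has_integral exp (c * t) * tail (Suc k) t) {0..t}"
proof -
  obtain e where e: "((\<lambda>h. e h / h) \<longlongrightarrow> 0) (at_right 0)" and
    step: "\<And>t h. 0 \<le> t \<Longrightarrow> 0 \<le> h \<Longrightarrow>
      \<bar>tail (Suc k) (t + h) - tail (Suc k) t - h * (c * (tail k t - tail (Suc k) t))\<bar> \<le> e h"
    using tail_increment[of k] unfolding c_def by blast
  have der: "(tail (Suc k) has_real_derivative c * (tail k u - tail (Suc k) u)) (at u)" if "0 < u" for u
    by (rule has_derivative_of_uniform_increments[OF step e _ that])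
       (auto intro!: continuous_intros tail_continuous)
  have "((\<lambda>u. c * exp (c * u) * tail k u) has_integral
      exp (c * t) * tail (Suc k) t - exp (c * 0) * tail (Suc k) 0) {0..t}"
  proof (rule fundamental_theorem_of_calculus_interior[OF t])
    show "continuous_on {0..t} (\<lambda>u. exp (c * u) * tail (Suc k) u)"
      by (intro continuous_intros continuous_on_subset[OF tail_continuous]) auto
    fix u assume "u \<in> {0<..<t}"
    then show "((\<lambda>u. exp (c * u) * tail (Suc k) u) has_vector_derivative c * exp (c * u) * tail k u) (at u)"
      unfolding has_real_derivative_iff_has_vector_derivative[symmetric]
      by (auto intro!: derivative_eq_intros der simp: algebra_simps)
  qed
  moreover have "tail (Suc k) 0 = 0"
  proof -
    have "AE \<omega> in M. \<xi> 0 \<omega> = 0" using birth by (simp add: pure_birth_process_def)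
    then have "tail (Suc k) 0 = measure M {}"
      unfolding tail_def by (intro finite_measure_eq_AE) auto
    then show ?thesis by simp
  qed
  ultimately show ?thesis by simp
qed

end

section \<open>Birth times as sums of independent exponential variables\<close>

locale iid_exponentials = prob_space N for N :: "'b measure" +
  fixes E :: "nat \<Rightarrow> 'b \<Rightarrow> real"
  assumes E_indep: "indep_vars (\<lambda>_. borel) E UNIV"
    and E_distributed: "distributed N lborel (E i) (exponential_density 1)"

text \<open>
  The coordinate projections on an infinite product of exponential distributions.
\<close>

lemma iid_exponentials_exist: "\<exists>N. iid_exponentials N (\<lambda>i (\<omega> :: nat \<Rightarrow> real). \<omega> i)"
proof -
  define D where "D = density lborel (exponential_density 1)"
  have sets_D: "sets D = sets borel" by (simp add: D_def)
  have D: "prob_space D" unfolding D_def by (rule prob_space_exponential_density) simp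
  define N where "N = PiM (UNIV :: nat set) (\<lambda>_. D)"
  have "prob_space N" unfolding N_def by (intro prob_space_PiM D)
  then interpret prob_space N .
  have sets_N: "sets N = sets (PiM UNIV (\<lambda>_. borel))"
    unfolding N_def by (intro sets_PiM_cong refl sets_D)
  have coord [measurable]: "(\<lambda>\<omega>. \<omega> i) \<in> borel_measurable N" for i
    unfolding measurable_cong_sets[OF sets_N refl] by measurable
  have distr: "distr N borel (\<lambda>\<omega>. \<omega> i) = D" for i
  proof -
    have "distr N borel (\<lambda>\<omega>. \<omega> i) = distr N D (\<lambda>\<omega>. \<omega> i)"
      by (intro distr_cong) (simp_all add: sets_D)
    also have "\<dots> = D" unfolding N_def by (intro distr_PiM_component D) auto
    finally show ?thesis .
  qed
  have "iid_exponentials N (\<lambda>i \<omega>. \<omega> i)"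
  proof unfold_locales
    show "indep_vars (\<lambda>_. borel) (\<lambda>i \<omega>. \<omega> i) UNIV"
    proof (subst indep_vars_iff_distr_eq_PiM)
      have "distr N (PiM UNIV (\<lambda>_. borel)) (\<lambda>x. \<lambda>i\<in>UNIV. x i) = distr N N (\<lambda>x. x)"
        by (intro distr_cong) (simp_all add: sets_N restrict_UNIV)
      also have "\<dots> = PiM UNIV (\<lambda>i. distr N borel (\<lambda>\<omega>. \<omega> i))"
        by (simp add: distr N_def[symmetric])
      finally show "distr N (PiM UNIV (\<lambda>_. borel)) (\<lambda>x. \<lambda>i\<in>UNIV. x i) = PiM UNIV (\<lambda>i. distr N borel (\<lambda>\<omega>. \<omega> i))" .
    qed auto
    show "distributed N lborel (\<lambda>\<omega>. \<omega> i) (exponential_density 1)" for i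
    proof -
      have "distr N lborel (\<lambda>\<omega>. \<omega> i) = distr N borel (\<lambda>\<omega>. \<omega> i)"
        by (intro distr_cong) simp_all
      then show ?thesis
        unfolding distributed_def distr by (auto simp: D_def)
    qed
  qed
  then show ?thesis ..
qed

text \<open>
  Conditioning on the exponential summand: the convolution formula after the substitution
  \<open>u = t - y\<close>. The integrand is cut off at \<open>u \<le> t\<close> by the support of the exponential density and at
  \<open>u \<ge> 0\<close> because \<open>X\<close> is nonnegative.
\<close>

lemma (in prob_space) emeasure_indep_sum_exponential:
  fixes X Y :: "'a \<Rightarrow> real"
  assumes indep: "indep_var borel Y borel X" and nonneg: "AE \<omega> in M. 0 \<le> X \<omega>"
    and Y: "distributed M lborel Y (exponential_density c)" and c: "0 < c"
  shows "emeasure M {\<omega> \<in> space M. X \<omega> + Y \<omega> \<le> t} =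
    (\<integral>\<^sup>+u. ennreal (c * exp (- c * (t - u)) * \<P>(\<omega> in M. X \<omega> \<le> u)) * indicator {0..t} u \<partial>lborel)"
proof -
  have rv [measurable]: "random_variable borel X" "random_variable borel Y"
    using indep by (blast dest: indep_var_rv1 indep_var_rv2)+
  have distr_Y: "distr M borel Y = density lborel (exponential_density c)"
  proof -
    have "distr M borel Y = distr M lborel Y" by (intro distr_cong) simp_all
    then show ?thesis using Y by (simp add: distributed_def)
  qed
  have fin: "finite_measure (distr M borel Z)" if "Z \<in> borel_measurable M" for Z :: "'a \<Rightarrow> real"
    using that by (intro finite_measure_distr)
  define H where "H u = \<P>(\<omega> in M. X \<omega> \<le> u)" for u
  have "mono H" unfolding H_def by (intro monoI finite_measure_mono) auto
  then have [measurable]: "H \<in> borel_measurable borel" by (rule borel_measurable_mono)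
  have H_neg: "H u = 0" if "u < 0" for u
  proof -
    have "H u = measure M {}"
      unfolding H_def by (rule finite_measure_eq_AE) (use nonneg that in \<open>auto elim!: eventually_mono\<close>)
    then show ?thesis by simp
  qed
  have distr_X: "emeasure (distr M borel X) {a. a + y \<in> {..t}} = ennreal (H (t - y))" for y
  proof -
    have "{a. a + y \<in> {..t}} = {..t - y}" by auto
    then show ?thesis
      by (simp add: emeasure_distr H_def emeasure_eq_measure) (auto intro!: arg_cong[where f = prob])
  qed
  have "emeasure M {\<omega> \<in> space M. X \<omega> + Y \<omega> \<le> t} = emeasure (distr M borel (\<lambda>\<omega>. X \<omega> + Y \<omega>)) {..t}"
    by (subst emeasure_distr) (auto intro!: arg_cong[where f = "emeasure M"])
  also have "distr M borel (\<lambda>\<omega>. X \<omega> + Y \<omega>) = convolution (distr M borel Y) (distr M borel X)"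
    using sum_indep_random_variable[OF indep] by (simp add: add.commute)
  also have "emeasure \<dots> {..t} = (\<integral>\<^sup>+y. emeasure (distr M borel X) {a. a + y \<in> {..t}} \<partial>distr M borel Y)"
    by (rule convolution_emeasure) (auto intro: fin)
  also have "\<dots> = (\<integral>\<^sup>+y. ennreal (exponential_density c y) * emeasure (distr M borel X) {a. a + y \<in> {..t}} \<partial>lborel)"
    unfolding distr_Y distr_X by (rule nn_integral_density) measurable
  also have "\<dots> = (\<integral>\<^sup>+y. ennreal (exponential_density c y * H (t - y)) \<partial>lborel)"
    unfolding distr_X using c by (simp add: ennreal_mult' exponential_density_nonneg)
  also have "\<dots> = ennreal \<bar>- 1\<bar> * (\<integral>\<^sup>+u. ennreal (exponential_density c (t + (- 1) * u) * H (t - (t + (- 1) * u))) \<partial>lborel)"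
    by (rule nn_integral_real_affine) auto
  also have "\<dots> = (\<integral>\<^sup>+u. ennreal (c * exp (- c * (t - u)) * H u) * indicator {0..t} u \<partial>lborel)"
    unfolding abs_minus_cancel abs_one ennreal_1 mult_1_left
    by (intro nn_integral_cong) (auto simp: exponential_density_def H_neg algebra_simps split: split_indicator)
  finally show ?thesis unfolding H_def .
qed

context iid_exponentials
begin

definition birth_time :: "(real \<Rightarrow> real) \<Rightarrow> nat \<Rightarrow> 'b \<Rightarrow> real" where
  "birth_time f n \<omega> = (\<Sum>i<n. E i \<omega> / f (real (Suc i)))"

lemma E_measurable [measurable]: "E i \<in> borel_measurable N"
  using E_distributed[of i] by (simp add: distributed_def)

lemma birth_time_measurable [measurable]: "birth_time f n \<in> borel_measurable N"
  unfolding birth_time_def by measurable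

lemma E_nonneg: "AE \<omega> in N. 0 \<le> E i \<omega>"
proof -
  have "AE x in distr N lborel (E i). 0 \<le> x"
    using E_distributed[of i]
    by (simp only: distributed_def) (simp add: AE_density exponential_density_def)
  then show ?thesis by (simp add: AE_distr_iff)
qed

lemma birth_time_nonneg:
  assumes "\<And>i. 1 \<le> i \<Longrightarrow> 0 < f (real i)"
  shows "AE \<omega> in N. 0 \<le> birth_time f n \<omega>"
proof -
  have "AE \<omega> in N. \<forall>i<n. 0 \<le> E i \<omega>" using E_nonneg by (simp add: AE_all_countable)
  then show ?thesis
    by eventually_elim (auto simp: birth_time_def simp del: of_nat_Suc intro!: sum_nonneg divide_nonneg_pos assms)
qed

lemma E_scaled_distributed:
  assumes "0 < c"
  shows "distributed N lborel (\<lambda>\<omega>. E i \<omega> / c) (exponential_density c)"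
proof (subst exponential_distributed_iff[OF assms], intro conjI allI impI)
  fix a :: real assume "0 \<le> a"
  then have "\<P>(\<omega> in N. E i \<omega> \<le> c * a) = 1 - exp (- (c * a) * 1)"
    using assms by (intro exponential_distributedD_le[OF E_distributed]) auto
  then show "\<P>(\<omega> in N. E i \<omega> / c \<le> a) = 1 - exp (- a * c)"
    using assms by (simp add: pos_divide_le_eq mult.commute)
qed measurable

lemma birth_time_indep:
  "indep_var borel (\<lambda>\<omega>. E n \<omega> / f (real (Suc n))) borel (birth_time f n)"
proof -
  have "indep_vars (\<lambda>_. borel) (\<lambda>i \<omega>. E i \<omega> / f (real (Suc i))) (insert n {..<n})"
    by (intro indep_vars_subset[OF indep_vars_compose2[OF E_indep]]) auto
  then show ?thesis
    unfolding birth_time_def[abs_def] by (intro indep_vars_sum) auto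
qed

lemma emeasure_birth_time_Suc:
  assumes f: "\<And>i. 1 \<le> i \<Longrightarrow> 0 < f (real i)" and c: "c = f (real (Suc n))"
  shows "emeasure N {\<omega> \<in> space N. birth_time f (Suc n) \<omega> \<le> t} =
    (\<integral>\<^sup>+u. ennreal (c * exp (- c * (t - u)) * \<P>(\<omega> in N. birth_time f n \<omega> \<le> u)) * indicator {0..t} u \<partial>lborel)"
proof -
  have c0: "0 < c" using f[of "Suc n"] c by simp
  have "emeasure N {\<omega> \<in> space N. birth_time f n \<omega> + E n \<omega> / c \<le> t} =
    (\<integral>\<^sup>+u. ennreal (c * exp (- c * (t - u)) * \<P>(\<omega> in N. birth_time f n \<omega> \<le> u)) * indicator {0..t} u \<partial>lborel)"
    by (rule emeasure_indep_sum_exponential[OF _ birth_time_nonneg E_scaled_distributed[OF c0] c0])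
       (simp_all add: birth_time_indep c f del: of_nat_Suc)
  then show ?thesis by (simp add: birth_time_def c)
qed

end

text \<open>
  Both sides satisfy the recursion \<open>F\<^sub>n\<^sub>+\<^sub>1(t) = \<integral>\<^sub>0\<^sup>t c exp(-c (t - u)) F\<^sub>n(u) du\<close> and equal 1 for \<open>n = 0\<close>. For the
  process this is the integrated forward equation, for birth times the convolution formula.
\<close>

lemma tail_eq_birth_time:
  assumes birth: "birth_process M f \<xi>" and iid: "iid_exponentials N E"
    and f: "\<And>i. 1 \<le> i \<Longrightarrow> 0 < f (real i)" and t: "0 \<le> t"
  shows "\<P>(\<omega> in M. n \<le> \<xi> t \<omega>) = \<P>(\<omega> in N. iid_exponentials.birth_time E f n \<omega> \<le> t)"
proof -
  interpret birth_process M f \<xi> by fact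
  interpret N: iid_exponentials N E by fact
  have "tail n t = \<P>(\<omega> in N. N.birth_time f n \<omega> \<le> t)" using t
  proof (induction n arbitrary: t)
    case 0
    then show ?case by (simp add: tail_def N.birth_time_def prob_space N.prob_space)
  next
    case (Suc n)
    define c where "c = f (real (Suc n))"
    have c0: "0 < c" using f[of "Suc n"] by (simp add: c_def)
    have "((\<lambda>u. exp (- c * t) * (c * exp (c * u) * tail n u)) has_integral
        exp (- c * t) * (exp (c * t) * tail (Suc n) t)) {0..t}"
      by (rule has_integral_mult_right[OF tail_recursion[OF Suc.prems c_def]])
    moreover have "exp (- c * t) * (exp (c * t) * tail (Suc n) t) = tail (Suc n) t"
      by (simp add: mult.assoc[symmetric] flip: exp_add)
    moreover have "exp (- c * t) * (c * exp (c * u) * tail n u) = c * exp (- c * (t - u)) * tail n u" for u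
      by (simp add: right_diff_distrib exp_diff exp_minus field_simps)
    ultimately have int: "((\<lambda>u. c * exp (- c * (t - u)) * tail n u) has_integral tail (Suc n) t) {0..t}"
      by (simp only:)
    have "emeasure N {\<omega> \<in> space N. N.birth_time f (Suc n) \<omega> \<le> t} =
        (\<integral>\<^sup>+u. ennreal (c * exp (- c * (t - u)) * \<P>(\<omega> in N. N.birth_time f n \<omega> \<le> u)) * indicator {0..t} u \<partial>lborel)"
      by (rule N.emeasure_birth_time_Suc) (use f c_def in auto)
    also have "\<dots> = (\<integral>\<^sup>+u. ennreal (c * exp (- c * (t - u)) * tail n u) * indicator {0..t} u \<partial>lborel)"
      by (intro nn_integral_cong) (auto simp: Suc.IH split: split_indicator)
    also have "\<dots> = ennreal (tail (Suc n) t)"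
      using c0 by (intro nn_integral_has_integral_lebesgue'[OF _ int] mult_nonneg_nonneg tail_bounds) auto
    finally show ?case
      using tail_bounds[of "Suc n" t] by (simp add: measure_def)
  qed
  then show ?thesis by (simp add: tail_def)
qed

section \<open>Transforms of centred sums of exponential variables\<close>

text \<open>
  The Laplace transform of the standard exponential law, with primitive \<open>exp((w - 1) x) / (w - 1)\<close>.
  The integrand is dominated by a multiple of the exponential density of rate \<open>1 - Re w\<close>.
\<close>

lemma complex_exp_exponential_density:
  fixes w :: complex
  assumes w: "Re w < 1"
  shows "(\<integral>x. exponential_density 1 x *\<^sub>R exp (w * of_real x) \<partial>lborel) = 1 / (1 - w)"
proof -
  define l where "l = 1 - Re w"
  have l: "0 < l" using w by (simp add: l_def)
  have w1: "w \<noteq> 1" using w by auto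
  define g where "g x = exp ((w - 1) * of_real x)" for x :: real
  have norm_g: "norm (g x) = exp (- l * x)" for x by (simp add: g_def l_def)
  have cont_g: "isCont g x" for x unfolding g_def by (intro continuous_intros)
  have g_meas [measurable]: "g \<in> borel_measurable borel"
    by (intro borel_measurable_continuous_onI) (auto intro!: continuous_at_imp_continuous_on cont_g)
  interpret prob_space "density lborel (exponential_density l)"
    by (rule prob_space_exponential_density[OF l])
  have "integrable (density lborel (exponential_density l)) (\<lambda>x. 1 / l)" by simp
  then have "integrable lborel (\<lambda>x. exponential_density l x * (1 / l))"
    using l by (subst (asm) integrable_real_density) (auto intro: exponential_density_nonneg)
  then have int: "set_integrable lborel (einterval 0 \<infinity>) g"
    unfolding set_integrable_def
    by (rule Bochner_Integration.integrable_bound)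
       (use l in \<open>auto simp: norm_g exponential_density_def einterval_iff indicator_def mult.commute\<close>)
  have "(LBINT x=0..\<infinity>. g x) = 0 - 1 / (w - 1)"
  proof (rule interval_integral_FTC_integrable[where F = "\<lambda>x. g x / (w - 1)"])
    show "((\<lambda>x. g x / (w - 1)) has_vector_derivative g x) (at x)" for x
    proof -
      have "(g has_vector_derivative (w - 1) * g x) (at x)"
        unfolding g_def by (auto intro!: derivative_eq_intros has_vector_derivative_real_field)
      from has_vector_derivative_divide[OF this, of "w - 1"] show ?thesis using w1 by simp
    qed
    show "isCont g x" for x by (rule cont_g)
    show "set_integrable lborel (einterval 0 \<infinity>) g" by (rule int)
    have "((\<lambda>x. g x / (w - 1)) \<longlongrightarrow> g 0 / (w - 1)) (at_right 0)"
      using cont_g[of 0] w1 by (intro tendsto_intros) (auto simp: isCont_def intro: filterlim_mono at_le)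
    then show "(((\<lambda>x. g x / (w - 1)) \<circ> real_of_ereal) \<longlongrightarrow> 1 / (w - 1)) (at_right 0)"
      unfolding zero_ereal_def ereal_tendsto_simps by (simp add: g_def)
    have "((\<lambda>x. norm (g x)) \<longlongrightarrow> 0) at_top"
      unfolding norm_g using l by real_asymp
    then have "((\<lambda>x. g x / (w - 1)) \<longlongrightarrow> 0 / (w - 1)) at_top"
      using w1 by (intro tendsto_intros) (auto simp: tendsto_norm_zero_iff)
    then show "(((\<lambda>x. g x / (w - 1)) \<circ> real_of_ereal) \<longlongrightarrow> 0) (at_left \<infinity>)"
      by (simp add: ereal_tendsto_simps)
  qed simp
  also have "(LBINT x=0..\<infinity>. g x) = (\<integral>x. indicator (einterval 0 \<infinity>) x *\<^sub>R g x \<partial>lborel)"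
    by (simp add: interval_lebesgue_integral_def set_lebesgue_integral_def)
  also have "\<dots> = (\<integral>x. exponential_density 1 x *\<^sub>R exp (w * of_real x) \<partial>lborel)"
  proof (rule integral_cong_AE)
    have "AE x in lborel. x \<noteq> (0::real)" by (rule AE_lborel_singleton)
    then show "AE x in lborel. indicator (einterval 0 \<infinity>) x *\<^sub>R g x
        = exponential_density 1 x *\<^sub>R exp (w * complex_of_real x)"
    proof eventually_elim
      case (elim x)
      have "g x = exp (- complex_of_real x) * exp (w * complex_of_real x)"
        by (simp add: g_def algebra_simps flip: exp_add)
      with elim show ?case
        by (auto simp: indicator_def einterval_iff exponential_density_def scaleR_conv_of_real simp flip: exp_of_real)
    qed
    show "(\<lambda>x. exponential_density 1 x *\<^sub>R exp (w * complex_of_real x)) \<in> borel_measurable lborel"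
      by (intro borel_measurable_scaleR borel_measurable_continuous_onI) (auto intro!: continuous_intros)
  qed auto
  finally show ?thesis using w1 by (simp add: field_simps)
qed

text \<open>
  Exponential tilting: the integrand is a multiple of the exponential density of rate \<open>1 - \<theta>\<close>.
\<close>

lemma exponential_density_exp_moment:
  fixes \<theta> :: real
  assumes \<theta>: "\<theta> < 1"
  shows "has_bochner_integral lborel (\<lambda>x. exponential_density 1 x * exp (\<theta> * x)) (1 / (1 - \<theta>))"
proof -
  define l where "l = 1 - \<theta>"
  have l: "0 < l" using \<theta> by (simp add: l_def)
  interpret prob_space "density lborel (exponential_density l)"
    by (rule prob_space_exponential_density[OF l])
  have "has_bochner_integral (density lborel (exponential_density l)) (\<lambda>x. 1 :: real) 1"
    using prob_space by (simp add: has_bochner_integral_iff)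
  then have "has_bochner_integral lborel (exponential_density l) 1"
    using l integrable_real_density[of "exponential_density l" lborel "\<lambda>_. 1"]
      integral_real_density[of "exponential_density l" lborel "\<lambda>_. 1"]
    by (simp add: has_bochner_integral_iff exponential_density_nonneg)
  then have "has_bochner_integral lborel (\<lambda>x. exponential_density l x * (1 / l)) (1 * (1 / l))"
    by (intro has_bochner_integral_mult_left) auto
  moreover have "exponential_density l x * (1 / l) = exponential_density 1 x * exp (\<theta> * x)" for x
  proof -
    have "exp (- x * l) = exp (- x) * exp (\<theta> * x)" by (simp add: l_def algebra_simps flip: exp_add)
    then show ?thesis using l by (simp add: exponential_density_def)
  qed
  ultimately show ?thesis by (simp only: l_def mult_1_left)
qed

context iid_exponentials
begin

text \<open>
  The sign is chosen so that these sums have the sign of the deviations of the process itself: an early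
  birth makes the process large.
\<close>

definition centred_sum :: "(nat \<Rightarrow> real) \<Rightarrow> nat \<Rightarrow> 'b \<Rightarrow> real" where
  "centred_sum b n \<omega> = (\<Sum>i<n. b i * (1 - E i \<omega>))"

lemma centred_sum_measurable [measurable]: "centred_sum b n \<in> borel_measurable N"
  unfolding centred_sum_def by measurable

lemma real_distribution_centred_sum: "real_distribution (distr N borel (centred_sum b n))"
  by (rule real_distribution_distr) measurable

lemma summands_indep: "indep_vars (\<lambda>_. borel) (\<lambda>i \<omega>. b i * (1 - E i \<omega>)) {..<n}"
  by (rule indep_vars_subset[OF indep_vars_compose2[OF E_indep, where Y = "\<lambda>i x. b i * (1 - x)"]]) auto

lemma char_centred_sum:
  "char (distr N borel (centred_sum b n)) s = (\<Prod>i<n. iexp (s * b i) / (1 + \<i> * (s * b i)))"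
proof -
  have "char (distr N borel (\<lambda>\<omega>. b i * (1 - E i \<omega>))) s = iexp (s * b i) / (1 + \<i> * (s * b i))" for i
  proof -
    define y where "y = s * b i"
    have "char (distr N borel (\<lambda>\<omega>. b i * (1 - E i \<omega>))) s = (CLINT \<omega>|N. iexp (s * (b i * (1 - E i \<omega>))))"
      by (simp add: char_def integral_distr)
    also have "\<dots> = (CLINT \<omega>|N. iexp y * exp (- (\<i> * y) * E i \<omega>))"
      by (intro Bochner_Integration.integral_cong) (simp_all add: y_def algebra_simps flip: exp_add)
    also have "\<dots> = iexp y * (CLINT \<omega>|N. exp (- (\<i> * y) * E i \<omega>))" by simp
    also have "(CLINT \<omega>|N. exp (- (\<i> * y) * E i \<omega>)) =
        (\<integral>x. exponential_density 1 x *\<^sub>R exp (- (\<i> * y) * of_real x) \<partial>lborel)"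
    proof -
      have "(CLINT \<omega>|N. exp (- (\<i> * y) * E i \<omega>)) = (CLINT x|distr N lborel (E i). exp (- (\<i> * y) * of_real x))"
        by (subst integral_distr) (auto intro!: borel_measurable_continuous_onI continuous_intros)
      also have "distr N lborel (E i) = density lborel (exponential_density 1)"
        using E_distributed[of i] by (simp add: distributed_def)
      finally show ?thesis
        by (subst (asm) integral_density)
           (auto intro!: borel_measurable_continuous_onI continuous_intros exponential_density_nonneg AE_I2)
    qed
    also have "\<dots> = 1 / (1 - (- (\<i> * y)))" by (rule complex_exp_exponential_density) simp
    finally show ?thesis by (simp add: y_def)
  qed
  then show ?thesis
    unfolding centred_sum_def[abs_def] by (subst char_distr_sum[OF summands_indep]) simp
qed

lemma exp_moment_centred_sum:
  assumes "\<And>i. i < n \<Longrightarrow> - 1 < \<theta> * b i"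
  shows "integrable N (\<lambda>\<omega>. exp (\<theta> * centred_sum b n \<omega>))" (is ?int)
    and "(\<integral>\<omega>. exp (\<theta> * centred_sum b n \<omega>) \<partial>N) = (\<Prod>i<n. exp (\<theta> * b i) / (1 + \<theta> * b i))" (is ?eq)
proof -
  have one: "integrable N (\<lambda>\<omega>. exp (\<theta> * (b i * (1 - E i \<omega>)))) \<and>
     (\<integral>\<omega>. exp (\<theta> * (b i * (1 - E i \<omega>))) \<partial>N) = exp (\<theta> * b i) / (1 + \<theta> * b i)" if "i < n" for i
  proof -
    have *: "exp (\<theta> * (b i * (1 - E i \<omega>))) = exp (\<theta> * b i) * exp (- (\<theta> * b i) * E i \<omega>)" for \<omega>
      by (simp add: algebra_simps flip: exp_add)
    have "has_bochner_integral lborel (\<lambda>x. exponential_density 1 x * exp (- (\<theta> * b i) * x)) (1 / (1 - - (\<theta> * b i)))"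
      using assms[OF that] by (intro exponential_density_exp_moment) simp
    then have "integrable N (\<lambda>\<omega>. exp (- (\<theta> * b i) * E i \<omega>))"
      "(\<integral>\<omega>. exp (- (\<theta> * b i) * E i \<omega>) \<partial>N) = 1 / (1 + \<theta> * b i)"
      using distributed_integrable[OF E_distributed[of i], of "\<lambda>x. exp (- (\<theta> * b i) * x)"]
        distributed_integral[OF E_distributed[of i], of "\<lambda>x. exp (- (\<theta> * b i) * x)"]
      by (simp_all add: has_bochner_integral_iff exponential_density_nonneg)
    then show ?thesis unfolding * by simp
  qed
  have "indep_vars (\<lambda>_. borel) (\<lambda>i \<omega>. exp (\<theta> * (b i * (1 - E i \<omega>)))) {..<n}"
    by (rule indep_vars_compose2[OF summands_indep, where Y = "\<lambda>i x. exp (\<theta> * x)"]) auto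
  moreover have "exp (\<theta> * centred_sum b n \<omega>) = (\<Prod>i<n. exp (\<theta> * (b i * (1 - E i \<omega>))))" for \<omega>
    by (simp add: centred_sum_def sum_distrib_left exp_sum)
  ultimately show ?int ?eq
    using indep_vars_integrable[of "{..<n}" "\<lambda>i \<omega>. exp (\<theta> * (b i * (1 - E i \<omega>)))"]
      indep_vars_lebesgue_integral[of "{..<n}" "\<lambda>i \<omega>. exp (\<theta> * (b i * (1 - E i \<omega>)))"] one
    by simp_all
qed

end

text \<open>
  The characteristic function of \<open>1 - E\<close> at \<open>y\<close> agrees with that of a standard normal variable up to
  third order. Since \<open>\<bar>1 + i y\<bar> \<ge> 1\<close> the denominator can be cleared first; the Taylor polynomials of degree
  2 then cancel up to \<open>i y\<^sup>3 / 2\<close>.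
\<close>

lemma norm_char_factor_diff:
  fixes y :: real
  assumes y: "\<bar>y\<bar> \<le> 1"
  shows "norm (iexp y / (1 + \<i> * y) - of_real (exp (- y\<^sup>2 / 2))) \<le> \<bar>y\<bar> ^ 3"
proof -
  define d where "d = exp (- y\<^sup>2 / 2) - (1 - y\<^sup>2 / 2)"
  have "(1 + \<i> * y) \<noteq> 0" by (simp add: complex_eq_iff)
  have norm1: "1 \<le> norm (1 + \<i> * complex_of_real y)"
    by (simp add: cmod_def)
  have norm2: "norm (1 + \<i> * complex_of_real y) \<le> 2"
    using y by (intro order_trans[OF norm_triangle_ineq]) (simp add: norm_mult)
  define r where "r = iexp y - (\<Sum>k\<le>2. (\<i> * y) ^ k / fact k)"
  have r: "norm r \<le> \<bar>y\<bar> ^ 3 / 6"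
    using iexp_approx1[of y 2] by (simp add: r_def eval_nat_numeral)
  have d: "\<bar>d\<bar> \<le> \<bar>y\<bar> ^ 3 / 8"
  proof -
    define u where "u = y\<^sup>2 / 2"
    have u: "0 \<le> u" by (simp add: u_def)
    have "\<bar>exp (- u) - (1 - u)\<bar> \<le> u\<^sup>2 / 2"
    proof -
      have "exp (- u) \<le> 1 - u + u\<^sup>2 / 2"
      proof -
        have "1 \<le> (1 + u + u\<^sup>2 / 2) * (1 - u + u\<^sup>2 / 2)"
          using u by (simp add: algebra_simps power2_eq_square)
        also have "\<dots> \<le> exp u * (1 - u + u\<^sup>2 / 2)"
        proof (rule mult_right_mono[OF exp_lower_Taylor_quadratic[OF u]])
          have "0 \<le> (u - 1)\<^sup>2" by simp
          then show "0 \<le> 1 - u + u\<^sup>2 / 2" by (simp add: power2_eq_square algebra_simps)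
        qed
        finally show ?thesis by (simp add: exp_minus field_simps)
      qed
      moreover have "1 - u \<le> exp (- u)" using exp_ge_add_one_self[of "- u"] by simp
      ultimately show ?thesis by simp
    qed
    also have "u\<^sup>2 / 2 = \<bar>y\<bar> ^ 3 / 8 * \<bar>y\<bar>" by (simp add: u_def power_divide power2_eq_square power3_eq_cube)
    also have "\<dots> \<le> \<bar>y\<bar> ^ 3 / 8 * 1" using y by (intro mult_left_mono) auto
    finally show ?thesis by (simp add: d_def u_def)
  qed
  have "norm (iexp y / (1 + \<i> * y) - of_real (exp (- y\<^sup>2 / 2)))
     = norm (iexp y - (1 + \<i> * y) * of_real (exp (- y\<^sup>2 / 2))) / norm (1 + \<i> * complex_of_real y)"
    using \<open>(1 + \<i> * y) \<noteq> 0\<close> by (simp add: field_simps flip: norm_divide)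
  also have "\<dots> \<le> norm (iexp y - (1 + \<i> * y) * of_real (exp (- y\<^sup>2 / 2))) / 1"
    using norm1 by (intro divide_left_mono) auto
  also have "iexp y - (1 + \<i> * y) * of_real (exp (- y\<^sup>2 / 2)) = r + \<i> * y ^ 3 / 2 - (1 + \<i> * y) * of_real d"
    by (simp add: r_def d_def algebra_simps power2_eq_square power3_eq_cube eval_nat_numeral)
  also have "norm (r + \<i> * y ^ 3 / 2 - (1 + \<i> * y) * of_real d) / 1 \<le> norm r + norm (\<i> * complex_of_real y ^ 3 / 2) + norm ((1 + \<i> * y) * of_real d)"
    using norm_triangle_ineq4[of "r + \<i> * y ^ 3 / 2" "(1 + \<i> * y) * of_real d"] norm_triangle_ineq[of r "\<i> * y ^ 3 / 2"]
    by simp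
  also have "\<dots> \<le> \<bar>y\<bar> ^ 3 / 6 + \<bar>y\<bar> ^ 3 / 2 + 2 * (\<bar>y\<bar> ^ 3 / 8)"
    unfolding norm_mult
    by (intro add_mono r mult_mono norm2) (use d in \<open>auto simp: norm_divide norm_mult norm_power\<close>)
  also have "\<dots> \<le> \<bar>y\<bar> ^ 3" by simp
  finally show ?thesis .
qed

lemma norm_char_factor_le_1: "norm (iexp y / (1 + \<i> * complex_of_real y)) \<le> 1"
proof -
  have "1 \<le> norm (1 + \<i> * complex_of_real y)" by (simp add: cmod_def)
  then show ?thesis by (simp add: norm_divide divide_le_eq)
qed

section \<open>Weak limits of centred sums\<close>

text \<open>
  Exponential moments pass to a weak limit if slightly higher ones are bounded. Truncation at height
  \<open>R = j + 1\<close> gives bounded continuous functions, for which weak convergence suffices; the part cut off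
  contributes at most \<open>K R\<^sup>1\<^sup>-\<^sup>p\<close>, uniformly in \<open>n\<close>. Letting \<open>R\<close> grow uses monotone convergence under the
  limit law.
\<close>

lemma exp_moment_weak_limit:
  fixes \<mu> :: "nat \<Rightarrow> real measure"
  assumes \<mu>: "\<And>n. real_distribution (\<mu> n)" and \<nu>: "real_distribution \<nu>"
    and weak: "weak_conv_m \<mu> \<nu>"
    and int: "\<And>n. integrable (\<mu> n) (\<lambda>x. exp (\<theta> * x))"
    and lim: "(\<lambda>n. \<integral>x. exp (\<theta> * x) \<partial>\<mu> n) \<longlonglongrightarrow> m"
    and p: "1 < p" and int_p: "\<And>n. integrable (\<mu> n) (\<lambda>x. exp (p * (\<theta> * x)))"
    and bound: "\<And>n. (\<integral>x. exp (p * (\<theta> * x)) \<partial>\<mu> n) \<le> K"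
  shows "integrable \<nu> (\<lambda>x. exp (\<theta> * x)) \<and> (\<integral>x. exp (\<theta> * x) \<partial>\<nu>) = m"
proof -
  interpret \<mu>: real_distribution "\<mu> n" for n by (rule \<mu>)
  interpret \<nu>: real_distribution \<nu> by (rule \<nu>)
  define g where "g j x = min (exp (\<theta> * x)) (real (Suc j))" for j x
  have g_bound: "norm (g j x) \<le> real (Suc j)" for j x by (simp add: g_def)
  have [measurable]: "g j \<in> borel_measurable borel" for j unfolding g_def by measurable
  have g_int: "integrable M (g j)" if "real_distribution M" for j M
  proof -
    interpret real_distribution M by fact
    show ?thesis by (rule integrable_const_bound[where B = "real (Suc j)"]) (use g_bound in auto)
  qed
  have trunc: "\<bar>m - integral\<^sup>L \<nu> (g j)\<bar> \<le> K * real (Suc j) powr (1 - p)" for j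
  proof (rule LIMSEQ_le_const2)
    have "(\<lambda>n. integral\<^sup>L (\<mu> n) (g j)) \<longlonglongrightarrow> integral\<^sup>L \<nu> (g j)"
      by (rule weak_conv_imp_integral_bdd_continuous_conv[OF \<mu> \<nu> weak _ g_bound])
         (simp add: g_def[abs_def] continuous_intros)
    then show "(\<lambda>n. \<bar>(\<integral>x. exp (\<theta> * x) \<partial>\<mu> n) - integral\<^sup>L (\<mu> n) (g j)\<bar>) \<longlonglongrightarrow> \<bar>m - integral\<^sup>L \<nu> (g j)\<bar>"
      by (intro tendsto_intros lim)
    have "\<bar>(\<integral>x. exp (\<theta> * x) \<partial>\<mu> n) - integral\<^sup>L (\<mu> n) (g j)\<bar> \<le> K * real (Suc j) powr (1 - p)" for n
    proof -
      have pt: "0 \<le> exp (\<theta> * x) - g j x \<and> exp (\<theta> * x) - g j x \<le> exp (p * (\<theta> * x)) * real (Suc j) powr (1 - p)" for x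
      proof (cases "exp (\<theta> * x) \<le> real (Suc j)")
        case False
        then have "ln (real (Suc j)) \<le> \<theta> * x"
          by (metis exp_gt_zero linorder_le_cases ln_exp ln_le_cancel_iff of_nat_0_less_iff zero_less_Suc)
        then have "\<theta> * x \<le> p * (\<theta> * x) + (1 - p) * ln (real (Suc j))"
          using p mult_left_mono[of "ln (real (Suc j))" "\<theta> * x" "p - 1"] by (simp add: algebra_simps)
        then have "exp (\<theta> * x) \<le> exp (p * (\<theta> * x)) * real (Suc j) powr (1 - p)"
          by (simp add: powr_def flip: exp_add)
        moreover have "exp (\<theta> * x) - g j x \<le> exp (\<theta> * x)" "0 \<le> exp (\<theta> * x) - g j x" by (simp_all add: g_def)
        ultimately show ?thesis by linarith
      qed (simp add: g_def)
      have "\<bar>(\<integral>x. exp (\<theta> * x) \<partial>\<mu> n) - integral\<^sup>L (\<mu> n) (g j)\<bar> = \<bar>\<integral>x. exp (\<theta> * x) - g j x \<partial>\<mu> n\<bar>"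
        by (simp add: int g_int[OF \<mu>])
      also have "\<dots> = (\<integral>x. exp (\<theta> * x) - g j x \<partial>\<mu> n)"
        using pt by (simp add: integral_nonneg_AE del: Bochner_Integration.integral_diff)
      also have "\<dots> \<le> (\<integral>x. exp (p * (\<theta> * x)) * real (Suc j) powr (1 - p) \<partial>\<mu> n)"
        using pt by (intro integral_mono) (auto intro!: int int_p g_int[OF \<mu>])
      also have "\<dots> = (\<integral>x. exp (p * (\<theta> * x)) \<partial>\<mu> n) * real (Suc j) powr (1 - p)" by simp
      also have "\<dots> \<le> K * real (Suc j) powr (1 - p)"
        by (intro mult_right_mono bound) simp
      finally show ?thesis .
    qed
    then show "\<exists>N. \<forall>n\<ge>N. \<bar>(\<integral>x. exp (\<theta> * x) \<partial>\<mu> n) - integral\<^sup>L (\<mu> n) (g j)\<bar> \<le> K * real (Suc j) powr (1 - p)"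
      by blast
  qed
  have int_lim: "(\<lambda>j. integral\<^sup>L \<nu> (g j)) \<longlonglongrightarrow> m"
  proof (rule Lim_null_comparison[THEN LIM_zero_cancel])
    show "eventually (\<lambda>j. norm (integral\<^sup>L \<nu> (g j) - m) \<le> K * real (Suc j) powr (1 - p)) sequentially"
      using trunc by (simp add: abs_minus_commute)
    have "(\<lambda>j. real (Suc j) powr (1 - p)) \<longlonglongrightarrow> 0"
      using p by real_asymp
    then show "(\<lambda>j. K * real (Suc j) powr (1 - p)) \<longlonglongrightarrow> 0" by (rule tendsto_mult_right_zero)
  qed
  have pt_lim: "(\<lambda>j. g j x) \<longlonglongrightarrow> exp (\<theta> * x)" for x
  proof (rule tendsto_eventually)
    obtain k where "exp (\<theta> * x) \<le> real k" using real_arch_simple by blast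
    then show "eventually (\<lambda>j. g j x = exp (\<theta> * x)) sequentially"
      by (auto simp: g_def eventually_sequentially intro!: exI[of _ k])
  qed
  have "mono (\<lambda>j. g j x)" for x
    by (intro monoI) (simp add: g_def min.coboundedI2)
  moreover have "0 \<le> g j x" for j x by (simp add: g_def)
  moreover have "(\<lambda>x. exp (\<theta> * x)) \<in> borel_measurable \<nu>" by measurable
  ultimately show ?thesis
    using integral_monotone_convergence_nonneg[of \<nu> g, OF g_int[OF \<nu>] AE_I2 AE_I2 AE_I2[OF pt_lim] int_lim]
    by blast
qed

text \<open>
  Markov's inequality for \<open>exp(s x) + exp(-s x)\<close>.
\<close>

lemma tight_of_exp_moments:
  fixes \<mu> :: "nat \<Rightarrow> real measure"
  assumes \<mu>: "\<And>n. real_distribution (\<mu> n)" and s: "0 < s"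
    and int: "\<And>n. integrable (\<mu> n) (\<lambda>x. exp (s * x))" "\<And>n. integrable (\<mu> n) (\<lambda>x. exp (- s * x))"
    and bound: "\<And>n. (\<integral>x. exp (s * x) \<partial>\<mu> n) \<le> K" "\<And>n. (\<integral>x. exp (- s * x) \<partial>\<mu> n) \<le> K"
  shows "tight \<mu>"
  unfolding tight_def
proof (intro conjI allI impI \<mu>)
  fix \<epsilon> :: real assume \<epsilon>: "0 < \<epsilon>"
  have "((\<lambda>a. 2 * K * exp (- s * a)) \<longlongrightarrow> 0) at_top" using s by real_asymp
  then have "eventually (\<lambda>a. 2 * K * exp (- s * a) < \<epsilon>) at_top" using \<epsilon> by (rule order_tendstoD)
  then have "eventually (\<lambda>a. 0 < a \<and> 2 * K * exp (- s * a) < \<epsilon>) at_top"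
    using eventually_gt_at_top[of 0] by eventually_elim auto
  then obtain a where a: "0 < a" "2 * K * exp (- s * a) < \<epsilon>"
    using eventually_happens'[OF trivial_limit_at_top_linorder] by blast
  have "1 - \<epsilon> < measure (\<mu> n) {- a<..a}" for n
  proof -
    interpret real_distribution "\<mu> n" by (rule \<mu>)
    have "indicator (- {- a<..a}) x \<le> (exp (s * x) + exp (- s * x)) * exp (- s * a)" for x
    proof (cases "x \<in> {- a<..a}")
      case False
      have "s * a \<le> s * x \<or> s * a \<le> - s * x"
        using False s mult_left_mono[of a x s] mult_left_mono[of a "- x" s] by auto
      then have "exp (s * a) \<le> exp (s * x) + exp (- s * x)"
        by (smt (verit) exp_gt_zero exp_le_cancel_iff)
      then have "exp (s * a) * exp (- s * a) \<le> (exp (s * x) + exp (- s * x)) * exp (- s * a)"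
        by (intro mult_right_mono) auto
      with False show ?thesis by (simp flip: exp_add)
    qed simp
    then have "(\<integral>x. indicator (- {- a<..a}) x \<partial>\<mu> n) \<le> (\<integral>x. (exp (s * x) + exp (- s * x)) * exp (- s * a) \<partial>\<mu> n)"
      using int[of n] by (intro integral_mono) (auto simp: integrable_indicator_iff less_top[symmetric])
    also have "\<dots> = ((\<integral>x. exp (s * x) \<partial>\<mu> n) + (\<integral>x. exp (- s * x) \<partial>\<mu> n)) * exp (- s * a)"
      using int[of n] by simp
    also have "\<dots> \<le> (K + K) * exp (- s * a)"
      by (intro mult_right_mono add_mono bound) simp
    also have "\<dots> < \<epsilon>" using a(2) by simp
    finally have "prob (- {- a<..a}) < \<epsilon>" by simp
    moreover have "prob (- {- a<..a}) = 1 - prob {- a<..a}"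
      using prob_compl[of "{- a<..a}"] by (simp add: Compl_eq_Diff_UNIV)
    ultimately show ?thesis by simp
  qed
  then show "\<exists>a b. a < b \<and> (\<forall>n. 1 - \<epsilon> < measure (\<mu> n) {a<..b})"
    using a(1) by (intro exI[of _ "- a"] exI[of _ a]) auto
qed

text \<open>
  Levy's continuity theorem without a limit law given in advance: tightness provides a candidate along
  a subsequence, and its characteristic function must be the pointwise limit.
\<close>

lemma tight_char_convergent_imp_weak_conv:
  fixes \<mu> :: "nat \<Rightarrow> real measure"
  assumes tight: "tight \<mu>" and char: "\<And>s. (\<lambda>n. char (\<mu> n) s) \<longlonglongrightarrow> \<phi> s"
  shows "\<exists>\<nu>. real_distribution \<nu> \<and> weak_conv_m \<mu> \<nu>"
proof -
  have \<mu>: "real_distribution (\<mu> n)" for n using tight by (simp add: tight_def)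
  obtain r \<nu> where r: "strict_mono (r :: nat \<Rightarrow> nat)" "real_distribution \<nu>" "weak_conv_m (\<mu> \<circ> r) \<nu>"
    using tight_imp_convergent_subsubsequence[OF tight strict_mono_id] by auto
  have "char \<nu> s = \<phi> s" for s
  proof (rule LIMSEQ_unique)
    show "(\<lambda>n. char ((\<mu> \<circ> r) n) s) \<longlonglongrightarrow> char \<nu> s"
      by (rule levy_continuity1[OF _ r(2,3)]) (simp add: \<mu>)
    show "(\<lambda>n. char ((\<mu> \<circ> r) n) s) \<longlonglongrightarrow> \<phi> s"
      using LIMSEQ_subseq_LIMSEQ[OF char r(1)] by (simp add: comp_def)
  qed
  then have "weak_conv_m \<mu> \<nu>" using \<mu> r(2) char by (intro levy_continuity) auto
  with r(2) show ?thesis by blast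
qed

context iid_exponentials
begin

text \<open>
  The product of the Gaussian factors is exactly \<open>exp(-s\<^sup>2/2)\<close>, because the squared weights sum to 1
  after normalisation. A product of numbers of modulus at most 1 changes by at most the sum of the
  changes of its factors, hence by at most \<open>\<Sum> \<bar>y\<^sub>i\<bar>\<^sup>3 \<le> max \<bar>y\<^sub>i\<bar> s\<^sup>2\<close>, which tends to 0 since the \<open>b\<^sub>i\<close> are bounded and the
  normalisation diverges.
\<close>

lemma centred_sum_normal_limit:
  assumes b: "\<And>i. 0 \<le> b i" "\<And>i. b i \<le> B"
    and v: "filterlim (\<lambda>n. \<Sum>i<n. (b i)\<^sup>2) at_top sequentially"
  shows "weak_conv_m (\<lambda>n. distr N borel (\<lambda>\<omega>. centred_sum b n \<omega> / sqrt (\<Sum>i<n. (b i)\<^sup>2))) std_normal_distribution"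
proof (rule levy_continuity[OF _ real_dist_normal_dist])
  define c where "c n = sqrt (\<Sum>i<n. (b i)\<^sup>2)" for n
  have c_top: "filterlim c at_top sequentially"
    unfolding c_def by (rule filterlim_compose[OF sqrt_at_top v])
  have scaled: "(\<lambda>\<omega>. centred_sum b n \<omega> / c n) = centred_sum (\<lambda>i. b i / c n) n" for n
    by (simp add: fun_eq_iff centred_sum_def sum_divide_distrib)
  have law: "distr N borel (\<lambda>\<omega>. centred_sum b n \<omega> / sqrt (\<Sum>i<n. (b i)\<^sup>2)) =
      distr N borel (centred_sum (\<lambda>i. b i / c n) n)" for n
    unfolding scaled[symmetric] by (simp add: c_def)
  show "real_distribution (distr N borel (\<lambda>\<omega>. centred_sum b n \<omega> / sqrt (\<Sum>i<n. (b i)\<^sup>2)))" for n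
    unfolding law by (rule real_distribution_centred_sum)
  fix s :: real
  have B: "0 \<le> B" using b[of 0] by linarith
  have diff: "eventually (\<lambda>n. norm (char (distr N borel (centred_sum (\<lambda>i. b i / c n) n)) s - of_real (exp (- s\<^sup>2 / 2)))
      \<le> \<bar>s\<bar> * B * s\<^sup>2 / c n) sequentially"
    using filterlim_at_top_dense[THEN iffD1, OF c_top, rule_format, of "\<bar>s\<bar> * B"]
      filterlim_at_top_dense[THEN iffD1, OF c_top, rule_format, of 0]
  proof eventually_elim
    case (elim n)
    define y where "y i = s * (b i / c n)" for i
    have y_small: "\<bar>y i\<bar> \<le> \<bar>s\<bar> * B / c n" for i
    proof -
      have "\<bar>y i\<bar> = \<bar>s\<bar> * b i / c n" using elim b by (simp add: y_def abs_mult)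
      also have "\<dots> \<le> \<bar>s\<bar> * B / c n"
        using elim b by (intro divide_right_mono mult_left_mono) auto
      finally show ?thesis .
    qed
    have y1: "\<bar>y i\<bar> \<le> 1" for i
      using y_small[of i] elim by (smt (verit) divide_le_eq_1_pos)
    have "(\<Sum>i<n. (y i)\<^sup>2) = s\<^sup>2 * ((\<Sum>i<n. (b i)\<^sup>2) / (c n)\<^sup>2)"
      by (simp add: y_def power_mult_distrib power_divide sum_distrib_left sum_divide_distrib)
    also have "(c n)\<^sup>2 = (\<Sum>i<n. (b i)\<^sup>2)" by (simp add: c_def sum_nonneg)
    also have "s\<^sup>2 * ((\<Sum>i<n. (b i)\<^sup>2) / (\<Sum>i<n. (b i)\<^sup>2)) = s\<^sup>2" using elim by (simp add: c_def)
    finally have sum_y: "(\<Sum>i<n. (y i)\<^sup>2) = s\<^sup>2" .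
    have "norm (char (distr N borel (centred_sum (\<lambda>i. b i / c n) n)) s - of_real (exp (- s\<^sup>2 / 2)))
       = norm ((\<Prod>i<n. iexp (y i) / (1 + \<i> * y i)) - (\<Prod>i<n. of_real (exp (- (y i)\<^sup>2 / 2)) :: complex))"
    proof -
      have "exp (- s\<^sup>2 / 2) = (\<Prod>i<n. exp (- (y i)\<^sup>2 / 2))"
        by (simp add: exp_sum[symmetric] sum_negf flip: sum_y sum_divide_distrib)
      then show ?thesis unfolding char_centred_sum y_def by simp
    qed
    also have "\<dots> \<le> (\<Sum>i<n. norm (iexp (y i) / (1 + \<i> * y i) - of_real (exp (- (y i)\<^sup>2 / 2))))"
      by (intro norm_prod_diff norm_char_factor_le_1) simp
    also have "\<dots> \<le> (\<Sum>i<n. \<bar>s\<bar> * B / c n * (y i)\<^sup>2)"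
    proof (rule sum_mono)
      fix i
      have "norm (iexp (y i) / (1 + \<i> * y i) - of_real (exp (- (y i)\<^sup>2 / 2))) \<le> \<bar>y i\<bar> ^ 3"
        by (rule norm_char_factor_diff[OF y1])
      also have "\<dots> = \<bar>y i\<bar> * (y i)\<^sup>2" by (simp add: power3_eq_cube power2_eq_square)
      also have "\<dots> \<le> \<bar>s\<bar> * B / c n * (y i)\<^sup>2" by (intro mult_right_mono y_small) simp
      finally show "norm (iexp (y i) / (1 + \<i> * y i) - of_real (exp (- (y i)\<^sup>2 / 2))) \<le> \<bar>s\<bar> * B / c n * (y i)\<^sup>2" .
    qed
    also have "\<dots> = \<bar>s\<bar> * B / c n * s\<^sup>2" by (simp only: sum_y sum_distrib_left[symmetric])
    finally show ?case by simp
  qed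
  have "((\<lambda>n. \<bar>s\<bar> * B * s\<^sup>2 / c n) \<longlongrightarrow> 0) sequentially"
    by (rule real_tendsto_divide_at_top[OF tendsto_const c_top])
  from Lim_null_comparison[OF diff this]
  have "(\<lambda>n. char (distr N borel (centred_sum (\<lambda>i. b i / c n) n)) s) \<longlonglongrightarrow> of_real (exp (- s\<^sup>2 / 2))"
    by (rule LIM_zero_cancel)
  then show "(\<lambda>n. char (distr N borel (\<lambda>\<omega>. centred_sum b n \<omega> / sqrt (\<Sum>i<n. (b i)\<^sup>2))) s)
      \<longlonglongrightarrow> char std_normal_distribution s"
    unfolding law char_std_normal_distribution by simp
qed

end

text \<open>
  Expanding \<open>x - ln(1 + x)\<close> in powers of \<open>x = \<theta> b\<^sub>i\<close> turns the logarithm of the product over \<open>i < n\<close> into a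
  power series in \<open>\<theta>\<close> whose \<open>k\<close>th coefficient involves \<open>\<Sum>\<^bsub>i<n\<^esub> b\<^sub>i\<^sup>k \<le> \<Sum>\<^sub>i b\<^sub>i\<^sup>2 = 1\<close> for \<open>k \<ge> 2\<close>. The geometric majorant
  \<open>\<bar>\<theta>\<bar>\<^sup>k\<close> allows \<open>n\<close> to tend to infinity inside the series by Tannery's theorem.
\<close>

lemma cumulant_series:
  fixes b :: "nat \<Rightarrow> real"
  assumes b: "\<And>i. 0 \<le> b i" and b_sums: "(\<lambda>i. (b i)\<^sup>2) sums 1" and \<theta>: "\<bar>\<theta>\<bar> < 1"
  shows "(\<lambda>k. (- \<theta>) ^ k / real k * (\<Sum>i. b i ^ k)) summable_on {2..}"
    and "(\<lambda>n. \<Prod>i<n. exp (\<theta> * b i) / (1 + \<theta> * b i)) \<longlonglongrightarrow>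
      exp (\<Sum>\<^sub>\<infinity>k\<in>{2..}. (- \<theta>) ^ k / real k * (\<Sum>i. b i ^ k))"
proof -
  have partial: "(\<Sum>i\<in>I. (b i)\<^sup>2) \<le> 1" if "finite I" for I
    using sum_le_suminf[OF sums_summable[OF b_sums] that] b_sums by (simp add: sums_iff)
  have b1: "b i \<le> 1" for i
    using partial[of "{i}"] b[of i] by (simp add: power2_le_iff_abs_le abs_square_le_1)
  have pow_le: "b i ^ k \<le> (b i)\<^sup>2" if "2 \<le> k" for i k
    using that b b1 by (intro power_decreasing) auto
  have pow_summable: "summable (\<lambda>i. b i ^ k)" if "2 \<le> k" for k
    by (rule summable_comparison_test'[OF sums_summable[OF b_sums], of 0])
       (use b pow_le[OF that] in auto)
  define c where "c k = (if 2 \<le> k then (- \<theta>) ^ k / real k else 0)" for k :: nat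
  have c_bound: "\<bar>c k\<bar> \<le> \<bar>\<theta>\<bar> ^ k" for k
    by (auto simp: c_def power_abs[symmetric] abs_mult divide_le_eq mult_le_cancel_left1)
  have arg: "0 < 1 + \<theta> * b i" "\<bar>\<theta> * b i\<bar> < 1" for i
  proof -
    have "\<bar>\<theta> * b i\<bar> \<le> \<bar>\<theta>\<bar> * 1" unfolding abs_mult using b[of i] b1[of i] by (intro mult_left_mono) auto
    then show "\<bar>\<theta> * b i\<bar> < 1" using \<theta> by linarith
    then show "0 < 1 + \<theta> * b i" by linarith
  qed
  have log_series: "(\<lambda>k. c k * b i ^ k) sums (\<theta> * b i - ln (1 + \<theta> * b i))" for i
  proof -
    define x where "x = \<theta> * b i"
    have "(\<lambda>k. (if k = 1 then x else 0) - - ((- x) ^ k) / real k) sums (x - ln (1 + x))"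
      using arg(2)[of i] by (intro sums_diff sums_single ln_series') (simp add: x_def)
    moreover have "(if k = 1 then x else 0) - - ((- x) ^ k) / real k = c k * b i ^ k" for k
    proof -
      consider "k = 0" | "k = 1" | "2 \<le> k" by linarith
      then show ?thesis
        by cases (auto simp: c_def x_def simp flip: power_mult_distrib)
    qed
    ultimately show ?thesis by (simp add: x_def)
  qed
  define a where "a k n = c k * (\<Sum>i<n. b i ^ k)" for k n
  have T: "eventually (\<lambda>n. summable (\<lambda>k. norm (a k n))) sequentially \<and>
      summable (\<lambda>k. norm (c k * (\<Sum>i. b i ^ k))) \<and>
      (\<lambda>n. suminf (\<lambda>k. a k n)) \<longlonglongrightarrow> suminf (\<lambda>k. c k * (\<Sum>i. b i ^ k))"
  proof (rule tannerys_theorem)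
    show "(\<lambda>n. a k n) \<longlonglongrightarrow> c k * (\<Sum>i. b i ^ k)" for k
    proof (cases "2 \<le> k")
      case True
      then show ?thesis
        unfolding a_def by (intro tendsto_mult_left summable_LIMSEQ pow_summable)
    qed (simp add: a_def c_def)
    have "norm (a k n) \<le> \<bar>\<theta>\<bar> ^ k" for k n
    proof (cases "2 \<le> k")
      case True
      have "(\<Sum>i<n. b i ^ k) \<le> (\<Sum>i<n. (b i)\<^sup>2)" by (intro sum_mono pow_le True)
      also have "\<dots> \<le> 1" by (rule partial) simp
      finally have "\<bar>c k\<bar> * \<bar>\<Sum>i<n. b i ^ k\<bar> \<le> \<bar>\<theta>\<bar> ^ k * 1"
        using b by (intro mult_mono c_bound) (auto simp: abs_of_nonneg sum_nonneg)
      then show ?thesis by (simp add: a_def abs_mult)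
    qed (simp add: a_def c_def)
    then show "eventually (\<lambda>(k, n). norm (a k n) \<le> \<bar>\<theta>\<bar> ^ k) (sequentially \<times>\<^sub>F sequentially)"
      by (simp add: always_eventually)
    show "summable (\<lambda>k. \<bar>\<theta>\<bar> ^ k)" using \<theta> by (intro summable_geometric) simp
  qed simp
  from T have T2: "summable (\<lambda>k. norm (c k * (\<Sum>i. b i ^ k)))" by blast
  have "((\<lambda>k. c k * (\<Sum>i. b i ^ k)) has_sum suminf (\<lambda>k. c k * (\<Sum>i. b i ^ k))) UNIV"
    by (rule norm_summable_imp_has_sum[OF T2 summable_sums[OF summable_norm_cancel[OF T2]]])
  then have has: "((\<lambda>k. (- \<theta>) ^ k / real k * (\<Sum>i. b i ^ k)) has_sum suminf (\<lambda>k. c k * (\<Sum>i. b i ^ k))) {2..}"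
    by (rule has_sum_cong_neutral[THEN iffD1, rotated -1]) (auto simp: c_def)
  then show "(\<lambda>k. (- \<theta>) ^ k / real k * (\<Sum>i. b i ^ k)) summable_on {2..}"
    by (rule has_sum_imp_summable)
  have "(\<Prod>i<n. exp (\<theta> * b i) / (1 + \<theta> * b i)) = exp (suminf (\<lambda>k. a k n))" for n
  proof -
    have "(\<lambda>k. a k n) sums (\<Sum>i<n. \<theta> * b i - ln (1 + \<theta> * b i))"
      unfolding a_def sum_distrib_left by (intro sums_sum log_series)
    then have "suminf (\<lambda>k. a k n) = (\<Sum>i<n. \<theta> * b i - ln (1 + \<theta> * b i))" by (simp add: sums_iff)
    then show ?thesis using arg(1) by (simp add: exp_sum exp_diff)
  qed
  moreover have "(\<lambda>n. exp (suminf (\<lambda>k. a k n))) \<longlonglongrightarrow> exp (suminf (\<lambda>k. c k * (\<Sum>i. b i ^ k)))"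
    by (rule tendsto_exp[OF T[THEN conjunct2, THEN conjunct2]])
  moreover have "suminf (\<lambda>k. c k * (\<Sum>i. b i ^ k)) = (\<Sum>\<^sub>\<infinity>k\<in>{2..}. (- \<theta>) ^ k / real k * (\<Sum>i. b i ^ k))"
    by (rule infsumI[OF has, symmetric])
  ultimately show "(\<lambda>n. \<Prod>i<n. exp (\<theta> * b i) / (1 + \<theta> * b i)) \<longlonglongrightarrow>
      exp (\<Sum>\<^sub>\<infinity>k\<in>{2..}. (- \<theta>) ^ k / real k * (\<Sum>i. b i ^ k))"
    by (simp only:)
qed

text \<open>
  The factors differ from 1 by at most twice the square of their argument, so the product converges
  absolutely.
\<close>

lemma char_product_convergent:
  fixes b :: "nat \<Rightarrow> real"
  assumes b: "summable (\<lambda>i. (b i)\<^sup>2)"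
  shows "convergent (\<lambda>n. \<Prod>i<n. iexp (s * b i) / (1 + \<i> * (s * b i)))"
proof -
  define z where "z i = iexp (s * b i) / (1 + \<i> * (s * b i))" for i
  have "summable (\<lambda>i. norm (z i - 1))"
  proof (rule summable_comparison_test_ev)
    have "(\<lambda>i. sqrt ((b i)\<^sup>2)) \<longlonglongrightarrow> sqrt 0"
      by (intro tendsto_real_sqrt summable_LIMSEQ_zero[OF b])
    then have "(\<lambda>i. \<bar>s\<bar> * \<bar>b i\<bar>) \<longlonglongrightarrow> \<bar>s\<bar> * 0" by (intro tendsto_mult_left) simp
    then have "eventually (\<lambda>i. \<bar>s\<bar> * \<bar>b i\<bar> < 1) sequentially" by (rule order_tendstoD) simp
    then show "eventually (\<lambda>i. norm (norm (z i - 1)) \<le> 2 * s\<^sup>2 * (b i)\<^sup>2) sequentially"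
    proof eventually_elim
      case (elim i)
      define y where "y = s * b i"
      have y: "\<bar>y\<bar> \<le> 1" using elim by (simp add: y_def abs_mult)
      have "norm (z i - of_real (exp (- y\<^sup>2 / 2))) \<le> \<bar>y\<bar> ^ 3"
        using norm_char_factor_diff[OF y] by (simp add: z_def y_def)
      moreover have "\<bar>y\<bar> ^ 3 \<le> y\<^sup>2"
        using power_decreasing[of 2 3 "\<bar>y\<bar>"] y by simp
      moreover have "norm (of_real (exp (- y\<^sup>2 / 2)) - 1 :: complex) \<le> y\<^sup>2"
      proof -
        have "1 + - y\<^sup>2 / 2 \<le> exp (- y\<^sup>2 / 2)" by (rule exp_ge_add_one_self)
        moreover have "exp (- y\<^sup>2 / 2) \<le> 1" by simp
        moreover have "norm (of_real (exp (- y\<^sup>2 / 2)) - 1 :: complex) = \<bar>exp (- y\<^sup>2 / 2) - 1\<bar>"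
          by (metis norm_of_real of_real_1 of_real_diff)
        ultimately show ?thesis using zero_le_power2[of y] by linarith
      qed
      ultimately have "norm (z i - 1) \<le> y\<^sup>2 + y\<^sup>2"
        using norm_triangle_ineq[of "z i - of_real (exp (- y\<^sup>2 / 2))" "of_real (exp (- y\<^sup>2 / 2)) - 1"] by simp
      then show ?case by (simp add: y_def power_mult_distrib)
    qed
    show "summable (\<lambda>i. 2 * s\<^sup>2 * (b i)\<^sup>2)" by (intro summable_mult b)
  qed
  then have "convergent_prod z"
    by (intro abs_convergent_prod_imp_convergent_prod) (simp add: abs_convergent_prod_conv_summable)
  then have "convergent (\<lambda>n. \<Prod>i\<le>n. z i)" by (rule convergent_prod_imp_convergent)
  then have "convergent (\<lambda>n. \<Prod>i<Suc n. z i)" by (simp add: lessThan_Suc_atMost)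
  then have "convergent (\<lambda>n. \<Prod>i<n. z i)" by (rule convergent_Suc_iff[THEN iffD1])
  then show ?thesis by (simp add: z_def)
qed

text \<open>
  The exponential moments converge for every \<open>\<bar>\<theta>\<bar> < 1\<close>. Those at \<open>\<theta> = \<plusminus>1/2\<close> give tightness, hence a weak limit;
  those slightly beyond \<open>\<theta>\<close> give the uniform integrability that identifies its moment generating
  function.
\<close>

lemma (in iid_exponentials) centred_sum_limit_finite_variance:
  assumes b: "\<And>i. 0 \<le> b i" and b_sums: "(\<lambda>i. (b i)\<^sup>2) sums 1"
  shows "\<exists>\<nu>. real_distribution \<nu> \<and> weak_conv_m (\<lambda>n. distr N borel (centred_sum b n)) \<nu> \<and>
    (\<forall>\<theta>. \<bar>\<theta>\<bar> < 1 \<longrightarrow> integrable \<nu> (\<lambda>x. exp (\<theta> * x)) \<and>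
      (\<integral>x. exp (\<theta> * x) \<partial>\<nu>) = exp (\<Sum>\<^sub>\<infinity>k\<in>{2..}. (- \<theta>) ^ k / real k * (\<Sum>i. b i ^ k)))"
proof -
  define \<mu> where "\<mu> n = distr N borel (centred_sum b n)" for n
  have \<mu>: "real_distribution (\<mu> n)" for n
    unfolding \<mu>_def by (rule real_distribution_centred_sum)
  have b1: "b i \<le> 1" for i
    using sum_le_suminf[OF sums_summable[OF b_sums], of "{i}"] b_sums b[of i]
    by (simp add: sums_iff abs_square_le_1)
  have arg: "- 1 < \<theta> * b i" if "\<bar>\<theta>\<bar> < 1" for i \<theta>
  proof -
    have "\<bar>\<theta> * b i\<bar> \<le> \<bar>\<theta>\<bar> * 1" unfolding abs_mult using b[of i] b1[of i] by (intro mult_left_mono) auto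
    then show ?thesis using that by linarith
  qed
  have mgf: "integrable (\<mu> n) (\<lambda>x. exp (\<theta> * x))"
    "(\<integral>x. exp (\<theta> * x) \<partial>\<mu> n) = (\<Prod>i<n. exp (\<theta> * b i) / (1 + \<theta> * b i))" if "\<bar>\<theta>\<bar> < 1" for \<theta> n
    using exp_moment_centred_sum[of n \<theta> b] arg[OF that]
    by (simp_all add: \<mu>_def integrable_distr_eq integral_distr)
  have bounded: "\<exists>K. \<forall>n. (\<integral>x. exp (\<theta> * x) \<partial>\<mu> n) \<le> K" if "\<bar>\<theta>\<bar> < 1" for \<theta>
  proof -
    have "convergent (\<lambda>n. \<integral>x. exp (\<theta> * x) \<partial>\<mu> n)"
      unfolding mgf(2)[OF that] using cumulant_series(2)[OF b b_sums that] by (rule convergentI)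
    from convergent_imp_Bseq[OF this] obtain K where "\<And>n. \<bar>\<integral>x. exp (\<theta> * x) \<partial>\<mu> n\<bar> \<le> K"
      by (auto simp: Bseq_def)
    then show ?thesis by (metis abs_le_D1)
  qed
  obtain K1 where K1: "\<And>n. (\<integral>x. exp (1 / 2 * x) \<partial>\<mu> n) \<le> K1" using bounded[of "1 / 2"] by auto
  obtain K2 where K2: "\<And>n. (\<integral>x. exp (- (1 / 2) * x) \<partial>\<mu> n) \<le> K2" using bounded[of "- (1 / 2)"] by auto
  have tight: "tight \<mu>"
    by (rule tight_of_exp_moments[OF \<mu>, where s = "1 / 2" and K = "max K1 K2"])
       (use K1 K2 mgf(1)[of "1 / 2"] mgf(1)[of "- (1 / 2)"] in \<open>auto simp: le_max_iff_disj\<close>)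
  have char: "(\<lambda>n. char (\<mu> n) s) \<longlonglongrightarrow> lim (\<lambda>n. \<Prod>i<n. iexp (s * b i) / (1 + \<i> * (s * b i)))" for s
    unfolding \<mu>_def char_centred_sum
    using char_product_convergent[OF sums_summable[OF b_sums]] by (simp add: convergent_LIMSEQ_iff)
  obtain \<nu> where \<nu>: "real_distribution \<nu>" "weak_conv_m \<mu> \<nu>"
    using tight_char_convergent_imp_weak_conv[OF tight char] by blast
  have "integrable \<nu> (\<lambda>x. exp (\<theta> * x)) \<and>
      (\<integral>x. exp (\<theta> * x) \<partial>\<nu>) = exp (\<Sum>\<^sub>\<infinity>k\<in>{2..}. (- \<theta>) ^ k / real k * (\<Sum>i. b i ^ k))"
    if \<theta>: "\<bar>\<theta>\<bar> < 1" for \<theta>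
  proof -
    \<comment> \<open>This choice satisfies both \<open>1 < p\<close> and \<open>p * \<bar>\<theta>\<bar> < 1\<close>, also for \<open>\<theta> = 0\<close>.\<close>
    define p where "p = 2 / (1 + \<bar>\<theta>\<bar>)"
    have p: "1 < p" using \<theta> by (simp add: p_def)
    have "\<bar>p * \<theta>\<bar> = 2 * \<bar>\<theta>\<bar> / (1 + \<bar>\<theta>\<bar>)" by (simp add: p_def abs_mult)
    also have "\<dots> < 1" using \<theta> by (simp add: divide_less_eq)
    finally have p\<theta>: "\<bar>p * \<theta>\<bar> < 1" .
    obtain K where K: "\<And>n. (\<integral>x. exp (p * \<theta> * x) \<partial>\<mu> n) \<le> K" using bounded[OF p\<theta>] by auto
    show ?thesis
    proof (rule exp_moment_weak_limit[OF \<mu> \<nu> mgf(1)[OF \<theta>] _ p])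
      show "(\<lambda>n. \<integral>x. exp (\<theta> * x) \<partial>\<mu> n) \<longlonglongrightarrow> exp (\<Sum>\<^sub>\<infinity>k\<in>{2..}. (- \<theta>) ^ k / real k * (\<Sum>i. b i ^ k))"
        unfolding mgf(2)[OF \<theta>] by (rule cumulant_series(2)[OF b b_sums \<theta>])
      show "integrable (\<mu> n) (\<lambda>x. exp (p * (\<theta> * x)))" for n
        using mgf(1)[OF p\<theta>] by (simp add: mult.assoc)
      show "(\<integral>x. exp (p * (\<theta> * x)) \<partial>\<mu> n) \<le> K" for n
        using K[of n] by (simp add: mult.assoc)
    qed
  qed
  with \<nu> show ?thesis unfolding \<mu>_def by blast
qed

section \<open>The mean birth time and its inverse\<close>

lemma G_fun_nat: "G_fun f k (real n) = (\<Sum>j=1..n. 1 / f (real j) ^ k)"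
  by (simp add: G_fun_def)

lemma sum_difference_linear_approx:
  fixes g :: "nat \<Rightarrow> real"
  assumes "\<And>j. j \<in> {min n r<..max n r} \<Longrightarrow> \<bar>g j - a\<bar> \<le> d"
  shows "\<bar>(\<Sum>j=1..n. g j) - (\<Sum>j=1..r. g j) - (real n - real r) * a\<bar> \<le> d * \<bar>real n - real r\<bar>"
proof -
  have *: "\<bar>(\<Sum>j=1..n. g j) - (\<Sum>j=1..r. g j) - (real n - real r) * a\<bar> \<le> d * (real n - real r)"
    if "r \<le> n" "\<And>j. j \<in> {r<..n} \<Longrightarrow> \<bar>g j - a\<bar> \<le> d" for n r
    using that
  proof (induction n rule: dec_induct)
    case (step n)
    have "\<bar>g (Suc n) - a\<bar> \<le> d" using step by auto
    moreover have "\<bar>(\<Sum>j=1..n. g j) - (\<Sum>j=1..r. g j) - (real n - real r) * a\<bar> \<le> d * (real n - real r)"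
      using step by auto
    moreover have "(\<Sum>j=1..Suc n. g j) - (\<Sum>j=1..r. g j) - (real (Suc n) - real r) * a =
        ((\<Sum>j=1..n. g j) - (\<Sum>j=1..r. g j) - (real n - real r) * a) + (g (Suc n) - a)"
      by (simp add: algebra_simps)
    moreover have "d * (real (Suc n) - real r) = d * (real n - real r) + d" by (simp add: algebra_simps)
    ultimately show ?case by linarith
  qed simp
  show ?thesis
  proof (cases "r \<le> n")
    case True
    then show ?thesis using *[of r n] assms by (simp add: max_def min_def split: if_splits)
  next
    case False
    then have "\<bar>(\<Sum>j=1..r. g j) - (\<Sum>j=1..n. g j) - (real r - real n) * a\<bar> \<le> d * (real r - real n)"
      using assms by (intro *) (auto simp: max_def min_def)
    with False show ?thesis by (simp add: algebra_simps abs_le_iff)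
  qed
qed

context regularly_varying_rates
begin

lemma V_eq: "V_fun f t = f (real r) * sqrt (G_fun f 2 (real r))" if "r_fun f t = int r"
  by (simp add: V_fun_def that)

lemma G2_pos: "1 \<le> r \<Longrightarrow> 0 < G_fun f 2 (real r)"
  unfolding G_fun_nat by (intro sum_pos divide_pos_pos zero_less_power f_pos) auto

text \<open>
  Between \<open>r\<close> and \<open>n\<close> the rate stays within a factor close to 1 of \<open>f(r)\<close>, because the distance is
  \<open>O(V) = o(r)\<close>. So \<open>G\<^sub>1\<close> is linear there with slope \<open>1/f(r)\<close>, up to an error small compared with \<open>V/f(r)\<close>, and
  \<open>G\<^sub>2\<close> changes by at most \<open>4 \<bar>n - r\<bar> / f(r)\<^sup>2\<close>, which relative to \<open>G\<^sub>2(r) = V\<^sup>2/f(r)\<^sup>2\<close> is \<open>O(1/V)\<close>.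
\<close>

lemma local_increments:
  assumes K: "0 \<le> K" and r: "filterlim r at_top F"
    and near: "eventually (\<lambda>t. \<bar>real (n t) - real (r t)\<bar> \<le> K * (f (r t) * sqrt (G_fun f 2 (r t)))) F"
  shows "((\<lambda>t. ((G_fun f 1 (n t) - G_fun f 1 (r t)) * f (r t) - (real (n t) - real (r t)))
      / (f (r t) * sqrt (G_fun f 2 (r t)))) \<longlongrightarrow> 0) F"
    and "((\<lambda>t. G_fun f 2 (n t) / G_fun f 2 (r t)) \<longlongrightarrow> 1) F"
proof -
  define v where "v r = f (real r) * sqrt (G_fun f 2 (real r))" for r :: nat
  have v_small: "(\<lambda>r. v r / real r) \<longlonglongrightarrow> 0"
    using scale_sublinear unfolding v_def G_fun_nat by simp
  have v_top: "filterlim v at_top sequentially"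
    using scale_at_top unfolding v_def G_fun_nat by simp
  have near': "eventually (\<lambda>t. \<bar>real (n t) - real (r t)\<bar> \<le> K * v (r t)) F"
    using near by (simp add: v_def)
  have close: "eventually (\<lambda>t. 1 \<le> r t \<and> 0 < v (r t) \<and>
      (\<forall>j. j \<in> {min (n t) (r t)<..max (n t) (r t)} \<longrightarrow> \<bar>f (r t) / f j - 1\<bar> \<le> e)) F" if e: "0 < e" for e
  proof -
    obtain \<delta> R where \<delta>: "0 < \<delta>" "\<And>r y. R \<le> r \<Longrightarrow> \<bar>y - r\<bar> \<le> \<delta> * r \<Longrightarrow> \<bar>f r / f y - 1\<bar> \<le> e"
      using ratio_near_1[OF e] by blast
    have "(\<lambda>r. K * (v r / real r)) \<longlonglongrightarrow> K * 0" by (intro tendsto_mult_left v_small)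
    then have "eventually (\<lambda>r. K * (v r / real r) < \<delta>) sequentially"
      using \<delta>(1) by (intro order_tendstoD(2)) auto
    moreover have "eventually (\<lambda>r. 0 < v r) sequentially"
      using v_top by (simp add: filterlim_at_top_dense)
    ultimately have "eventually (\<lambda>r. K * (v r / real r) < \<delta> \<and> 0 < v r \<and> max 1 (nat \<lceil>R\<rceil>) \<le> r) sequentially"
      using eventually_ge_at_top[of "max 1 (nat \<lceil>R\<rceil>)"] by eventually_elim auto
    then have "eventually (\<lambda>t. K * (v (r t) / real (r t)) < \<delta> \<and> 0 < v (r t) \<and> max 1 (nat \<lceil>R\<rceil>) \<le> r t) F"
      by (rule eventually_compose_filterlim[OF _ r])
    then show ?thesis
      using near'
    proof eventually_elim
      case (elim t)
      have "nat \<lceil>R\<rceil> \<le> r t" using elim by simp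
      then have rt: "1 \<le> r t" "R \<le> real (r t)" using elim by (simp, linarith)
      have "\<bar>f (r t) / f j - 1\<bar> \<le> e" if j: "j \<in> {min (n t) (r t)<..max (n t) (r t)}" for j
      proof (rule \<delta>(2)[OF rt(2)])
        have "\<bar>real j - real (r t)\<bar> \<le> \<bar>real (n t) - real (r t)\<bar>"
          using j by (auto simp: min_def max_def split: if_splits)
        also have "\<dots> \<le> K * v (r t)"
          using elim by simp
        also have "\<dots> \<le> \<delta> * real (r t)" using elim rt by (simp add: field_simps)
        finally show "\<bar>real j - real (r t)\<bar> \<le> \<delta> * real (r t)" .
      qed
      with elim rt show ?case by blast
    qed
  qed
  show "((\<lambda>t. ((G_fun f 1 (n t) - G_fun f 1 (r t)) * f (r t) - (real (n t) - real (r t)))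
      / (f (r t) * sqrt (G_fun f 2 (r t)))) \<longlongrightarrow> 0) F"
    unfolding v_def[symmetric]
  proof (rule tendstoI)
    fix \<epsilon> :: real assume \<epsilon>: "0 < \<epsilon>"
    \<comment> \<open>The final estimate is \<open>e * K\<close>; the summand 1 covers \<open>K = 0\<close>.\<close>
    define e where "e = \<epsilon> / (K + 1)"
    have e: "0 < e" "e * K < \<epsilon>" using \<epsilon> K by (auto simp: e_def field_simps add_pos_nonneg)
    show "eventually (\<lambda>t. dist (((G_fun f 1 (n t) - G_fun f 1 (r t)) * f (r t) - (real (n t) - real (r t))) / v (r t)) 0 < \<epsilon>) F"
      using close[OF e(1)] near'
    proof eventually_elim
      case (elim t)
      have fr: "0 < f (r t)" using elim f_pos by simp
      have "\<bar>(\<Sum>j=1..n t. 1 / f (real j) ^ 1) - (\<Sum>j=1..r t. 1 / f (real j) ^ 1)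
          - (real (n t) - real (r t)) * (1 / f (r t))\<bar> \<le> e / f (r t) * \<bar>real (n t) - real (r t)\<bar>"
      proof (rule sum_difference_linear_approx)
        fix j assume "j \<in> {min (n t) (r t)<..max (n t) (r t)}"
        then have "\<bar>f (r t) / f j - 1\<bar> \<le> e" using elim by blast
        then have "\<bar>f (r t) / f j - 1\<bar> / f (r t) \<le> e / f (r t)"
          using fr by (intro divide_right_mono) auto
        moreover have "\<bar>f (r t) / f j - 1\<bar> / f (r t) = \<bar>(f (r t) / f j - 1) / f (r t)\<bar>"
          using fr by simp
        moreover have "(f (r t) / f j - 1) / f (r t) = 1 / f j ^ 1 - 1 / f (r t)"
          using fr by (simp add: diff_divide_distrib)
        ultimately show "\<bar>1 / f j ^ 1 - 1 / f (r t)\<bar> \<le> e / f (r t)" by simp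
      qed
      then have "\<bar>G_fun f 1 (n t) - G_fun f 1 (r t) - (real (n t) - real (r t)) / f (r t)\<bar> * f (r t)
          \<le> e / f (r t) * \<bar>real (n t) - real (r t)\<bar> * f (r t)"
        unfolding G_fun_nat using fr by (intro mult_right_mono) auto
      moreover have "\<bar>G_fun f 1 (n t) - G_fun f 1 (r t) - (real (n t) - real (r t)) / f (r t)\<bar> * f (r t) =
          \<bar>(G_fun f 1 (n t) - G_fun f 1 (r t) - (real (n t) - real (r t)) / f (r t)) * f (r t)\<bar>"
        using fr by (simp add: abs_mult)
      moreover have "(G_fun f 1 (n t) - G_fun f 1 (r t) - (real (n t) - real (r t)) / f (r t)) * f (r t) =
          (G_fun f 1 (n t) - G_fun f 1 (r t)) * f (r t) - (real (n t) - real (r t))"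
        using fr by (simp add: field_simps)
      ultimately have "\<bar>(G_fun f 1 (n t) - G_fun f 1 (r t)) * f (r t) - (real (n t) - real (r t))\<bar>
          \<le> e * \<bar>real (n t) - real (r t)\<bar>"
        using fr by simp
      also have "\<dots> \<le> e * (K * v (r t))"
        using elim e by (intro mult_left_mono) auto
      also have "\<dots> < \<epsilon> * v (r t)" using e(2) elim by (simp add: mult.assoc[symmetric])
      finally show ?case using elim by (simp add: dist_real_def pos_divide_less_eq)
    qed
  qed
  show "((\<lambda>t. G_fun f 2 (n t) / G_fun f 2 (r t)) \<longlongrightarrow> 1) F"
  proof (rule LIM_zero_cancel, rule Lim_null_comparison)
    show "eventually (\<lambda>t. norm (G_fun f 2 (n t) / G_fun f 2 (r t) - 1) \<le> 4 * K / v (r t)) F"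
      using close[of 1, simplified] near'
    proof eventually_elim
      case (elim t)
      have fr: "0 < f (r t)" using elim f_pos by simp
      have Gr: "0 < G_fun f 2 (r t)" using elim by (intro G2_pos) auto
      have "\<bar>(\<Sum>j=1..n t. 1 / f (real j) ^ 2) - (\<Sum>j=1..r t. 1 / f (real j) ^ 2)
          - (real (n t) - real (r t)) * 0\<bar> \<le> 4 / f (r t) ^ 2 * \<bar>real (n t) - real (r t)\<bar>"
      proof (rule sum_difference_linear_approx)
        fix j assume "j \<in> {min (n t) (r t)<..max (n t) (r t)}"
        then have "\<bar>f (r t) / f j - 1\<bar> \<le> 1" "1 \<le> real j" using elim by auto
        then have "f (r t) / f j \<le> 2" "0 \<le> f (r t) / f j"
          using fr f_pos[of j] by auto
        then have "(f (r t) / f j)\<^sup>2 \<le> 2\<^sup>2" by (rule power_mono)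
        then have "(f (r t) / f j)\<^sup>2 / f (r t) ^ 2 \<le> 4 / f (r t) ^ 2"
          using fr by (intro divide_right_mono) auto
        then show "\<bar>1 / f j ^ 2 - 0\<bar> \<le> 4 / f (r t) ^ 2" using fr by (simp add: power_divide)
      qed
      then have "\<bar>G_fun f 2 (n t) - G_fun f 2 (r t)\<bar> \<le> 4 / f (r t) ^ 2 * \<bar>real (n t) - real (r t)\<bar>"
        unfolding G_fun_nat by simp
      also have "\<dots> \<le> 4 / f (r t) ^ 2 * (K * v (r t))"
        using elim by (intro mult_left_mono) auto
      finally have "\<bar>G_fun f 2 (n t) - G_fun f 2 (r t)\<bar> / G_fun f 2 (r t)
          \<le> 4 / f (r t) ^ 2 * (K * v (r t)) / G_fun f 2 (r t)"
        using Gr by (intro divide_right_mono) auto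
      also have "\<dots> = 4 * K * v (r t) / (v (r t))\<^sup>2"
        using Gr by (simp add: v_def power_mult_distrib)
      also have "\<dots> = 4 * K / v (r t)" using elim by (simp add: power2_eq_square)
      finally have "\<bar>G_fun f 2 (n t) - G_fun f 2 (r t)\<bar> / G_fun f 2 (r t) \<le> 4 * K / v (r t)" .
      moreover have "\<bar>G_fun f 2 (n t) / G_fun f 2 (r t) - 1\<bar> = \<bar>G_fun f 2 (n t) - G_fun f 2 (r t)\<bar> / G_fun f 2 (r t)"
        using Gr by (simp add: abs_if field_simps)
      ultimately show ?case by simp
    qed
    show "((\<lambda>t. 4 * K / v (r t)) \<longlongrightarrow> 0) F"
      by (rule real_tendsto_divide_at_top[OF tendsto_const filterlim_compose[OF v_top r]])
  qed
qed

end

lemma G1_strict_mono: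
  assumes f: "\<And>i. 1 \<le> i \<Longrightarrow> 0 < f (real i)" and xy: "0 \<le> x" "x < y"
  shows "G_fun f 1 x < G_fun f 1 y"
proof -
  define m n where "m = nat \<lfloor>x\<rfloor>" and "n = nat \<lfloor>y\<rfloor>"
  have mn: "\<lfloor>x\<rfloor> = int m" "\<lfloor>y\<rfloor> = int n" using xy by (auto simp: m_def n_def)
  have fl: "real m \<le> x" "x < real m + 1" "real n \<le> y" "y < real n + 1"
    using mn by linarith+
  have "m \<le> n" using xy by (auto simp: m_def n_def intro!: nat_mono floor_mono)
  have Gx: "G_fun f 1 x = (\<Sum>j=1..m. 1 / f (real j)) + (x - real m) / f (real (Suc m))"
    by (simp add: G_fun_def mn add.commute)
  have Gy: "G_fun f 1 y = (\<Sum>j=1..n. 1 / f (real j)) + (y - real n) / f (real (Suc n))"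
    by (simp add: G_fun_def mn add.commute)
  have pos: "0 < f (real (Suc m))" "0 < f (real (Suc n))" using f[of "Suc m"] f[of "Suc n"] by auto
  show ?thesis
  proof (cases "m = n")
    case True
    then show ?thesis unfolding Gx Gy using xy pos by (simp add: divide_strict_right_mono)
  next
    case False
    have "(x - real m) / f (real (Suc m)) < 1 / f (real (Suc m))"
      using fl pos by (intro divide_strict_right_mono) auto
    then have "G_fun f 1 x < (\<Sum>j=1..Suc m. 1 / f (real j))" unfolding Gx by simp
    also have "\<dots> \<le> (\<Sum>j=1..n. 1 / f (real j))"
      using False \<open>m \<le> n\<close> f by (intro sum_mono2) (auto intro: less_imp_le)
    also have "\<dots> \<le> G_fun f 1 y" unfolding Gy using fl pos by simp
    finally show ?thesis .
  qed
qed

text \<open>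
  \<open>G\<^sub>1\<close> is unbounded because the rates grow at most linearly and the harmonic series diverges.
\<close>

lemma G1_surjective:
  assumes f: "\<And>i. 1 \<le> i \<Longrightarrow> 0 < f (real i)" and C: "\<And>i::nat. 1 \<le> i \<Longrightarrow> f (real i) \<le> C * real i"
    and t: "0 \<le> t"
  shows "\<exists>y\<ge>0. G_fun f 1 y = t"
proof -
  define S where "S n = (\<Sum>j=1..n. 1 / f (real j))" for n :: nat
  have C0: "0 < C" using f[of 1] C[of 1] by simp
  have "\<exists>n. t < S n"
  proof (rule ccontr)
    assume "\<not> ?thesis"
    then have le: "S n \<le> t" for n by (simp add: not_less)
    have "summable (\<lambda>j. 1 / f (real (Suc j)))"
    proof (rule summableI_nonneg_bounded)
      show "0 \<le> 1 / f (real (Suc j))" for j using f[of "Suc j"] by simp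
      show "(\<Sum>j<n. 1 / f (real (Suc j))) \<le> t" for n
        using le[of n] by (simp add: S_def sum.atLeast1_atMost_eq)
    qed
    then have "summable (\<lambda>j. C * (1 / f (real (Suc j))))" by (rule summable_mult)
    then have "summable (\<lambda>j. inverse (real (Suc j)))"
    proof (rule summable_comparison_test'[where N = 0])
      fix j
      show "norm (inverse (real (Suc j))) \<le> C * (1 / f (real (Suc j)))"
        using C[of "Suc j"] f[of "Suc j"] by (simp add: field_simps)
    qed
    then show False
      using not_summable_harmonic[where 'a = real] summable_Suc_iff[of "\<lambda>n. inverse (real n)"] by simp
  qed
  then obtain n where n: "t < S n" "\<And>k. k < n \<Longrightarrow> S k \<le> t"
    using exists_least_iff[of "\<lambda>n. t < S n"] by (auto simp: not_less)
  obtain m where m: "n = Suc m" using n(1) t by (cases n) (auto simp: S_def)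
  have Sm: "S m \<le> t" "t < S m + 1 / f (real (Suc m))" using n m by (auto simp: S_def)
  have pos: "0 < f (real (Suc m))" using f[of "Suc m"] by simp
  define y where "y = real m + (t - S m) * f (real (Suc m))"
  have "0 \<le> (t - S m) * f (real (Suc m))" "(t - S m) * f (real (Suc m)) < 1"
    using Sm pos by (auto simp: field_simps)
  then have "\<lfloor>y\<rfloor> = int m" "0 \<le> y" unfolding y_def by (auto simp: floor_unique)
  then show ?thesis
    using pos by (intro exI[of _ y]) (simp add: G_fun_def S_def y_def add.commute)
qed

lemma G1_inv_correct:
  assumes f: "\<And>i. 1 \<le> i \<Longrightarrow> 0 < f (real i)" and C: "\<And>i::nat. 1 \<le> i \<Longrightarrow> f (real i) \<le> C * real i"
    and t: "0 \<le> t"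
  shows "0 \<le> G1_inv f t" "G_fun f 1 (G1_inv f t) = t"
proof -
  have inj: "inj_on (G_fun f 1) {0..}"
  proof (rule inj_onI)
    fix x y assume "x \<in> {0..}" "y \<in> {0..}" and eq: "G_fun f 1 x = G_fun f 1 y"
    then show "x = y"
      using G1_strict_mono[of f x y, OF f] G1_strict_mono[of f y x, OF f]
      by (cases x y rule: linorder_cases) auto
  qed
  obtain y where "0 \<le> y" "G_fun f 1 y = t" using G1_surjective[of f C t] f C t by blast
  then have "t \<in> G_fun f 1 ` {0..}" by force
  then show "0 \<le> G1_inv f t" "G_fun f 1 (G1_inv f t) = t"
    using the_inv_into_into[OF inj _ order_refl] f_the_inv_into_f[OF inj] by (auto simp: G1_inv_def)
qed

text \<open>
  The threshold \<open>z\<close> is eventually caught between continuity points of the limit on either side of \<open>x\<close>.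
  These exist arbitrarily close to \<open>x\<close> as a distribution function has countably many discontinuities.
\<close>

lemma weak_conv_moving_threshold:
  fixes \<mu> :: "nat \<Rightarrow> real measure" and n :: "'t \<Rightarrow> nat"
  assumes \<mu>: "\<And>n. real_distribution (\<mu> n)" and \<nu>: "real_distribution \<nu>"
    and weak: "weak_conv_m \<mu> \<nu>" and x: "isCont (cdf \<nu>) x"
    and n: "filterlim n at_top F" and z: "(z \<longlongrightarrow> x) F"
  shows "((\<lambda>t. measure (\<mu> (n t)) {..<z t}) \<longlongrightarrow> cdf \<nu> x) F"
proof (rule tendstoI)
  interpret \<nu>: real_distribution \<nu> by (rule \<nu>)
  interpret \<mu>: real_distribution "\<mu> k" for k by (rule \<mu>)
  fix \<epsilon> :: real assume \<epsilon>: "0 < \<epsilon>"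
  obtain d where d: "0 < d" "\<And>y. \<bar>y - x\<bar> < d \<Longrightarrow> \<bar>cdf \<nu> y - cdf \<nu> x\<bar> < \<epsilon> / 2"
    using x \<epsilon> unfolding continuous_at_eps_delta by (metis dist_real_def half_gt_zero)
  have countable: "countable {y. \<not> isCont (cdf \<nu>) y}"
    by (rule mono_ctble_discont) (simp add: monoI \<nu>.cdf_nondecreasing)
  have pick: "\<exists>y. a < y \<and> y < b \<and> isCont (cdf \<nu>) y" if ab: "a < b" for a b
    using open_minus_countable[OF countable, of "{a<..<b}"] ab by auto
  obtain x1 where x1: "x - d < x1" "x1 < x" "isCont (cdf \<nu>) x1" using pick[of "x - d" x] d(1) by auto
  obtain x2 where x2: "x < x2" "x2 < x + d" "isCont (cdf \<nu>) x2" using pick[of x "x + d"] d(1) by auto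
  have conv: "eventually (\<lambda>t. \<bar>cdf (\<mu> (n t)) y - cdf \<nu> y\<bar> < \<epsilon> / 2) F" if "isCont (cdf \<nu>) y" for y
  proof -
    have "(\<lambda>n. cdf (\<mu> n) y) \<longlonglongrightarrow> cdf \<nu> y"
      using weak that by (simp add: weak_conv_m_def weak_conv_def)
    then have "((\<lambda>t. cdf (\<mu> (n t)) y) \<longlongrightarrow> cdf \<nu> y) F" by (rule filterlim_compose[OF _ n])
    from tendstoD[OF this, of "\<epsilon> / 2"] show ?thesis using \<epsilon> by (simp add: dist_real_def)
  qed
  have "eventually (\<lambda>t. x1 < z t) F" "eventually (\<lambda>t. z t < x2) F"
    using z x1 x2 by (auto intro: order_tendstoD)
  then show "eventually (\<lambda>t. dist (measure (\<mu> (n t)) {..<z t}) (cdf \<nu> x) < \<epsilon>) F"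
    using conv[OF x1(3)] conv[OF x2(3)]
  proof eventually_elim
    case (elim t)
    have "cdf (\<mu> (n t)) x1 \<le> measure (\<mu> (n t)) {..<z t}"
      unfolding cdf_def using elim by (intro \<mu>.finite_measure_mono) auto
    moreover have "measure (\<mu> (n t)) {..<z t} \<le> cdf (\<mu> (n t)) x2"
      unfolding cdf_def using elim by (intro \<mu>.finite_measure_mono) auto
    moreover have "\<bar>cdf \<nu> x1 - cdf \<nu> x\<bar> < \<epsilon> / 2" "\<bar>cdf \<nu> x2 - cdf \<nu> x\<bar> < \<epsilon> / 2"
      using x1 x2 by (intro d(2); linarith)+
    ultimately show ?case using elim unfolding dist_real_def by linarith
  qed
qed

section \<open>The limit law of the birth process\<close>

lemma G_fun_lessThan: "G_fun f k (real n) = (\<Sum>i<n. (1 / f (real (Suc i))) ^ k)"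
  unfolding G_fun_nat by (simp add: sum.atLeast1_atMost_eq power_one_over)

lemma (in iid_exponentials) birth_time_eq_centred_sum:
  "birth_time f n \<omega> = G_fun f 1 (real n) - centred_sum (\<lambda>i. 1 / f (real (Suc i))) n \<omega>"
  unfolding G_fun_lessThan centred_sum_def birth_time_def sum_subtractf[symmetric]
  by (intro sum.cong refl) (simp add: algebra_simps diff_divide_distrib)

text \<open>
  The defining limit exists because the partial sums increase.
\<close>

lemma G_infty_cases:
  assumes f: "\<And>i. 1 \<le> i \<Longrightarrow> 0 < f (real i)"
  shows "(G_infty f k = \<infinity> \<and> filterlim (\<lambda>n. G_fun f k (real n)) at_top sequentially) \<or>
    (\<exists>s. G_infty f k = ereal s \<and> (\<lambda>i. (1 / f (real (Suc i))) ^ k) sums s)"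
proof -
  have pos: "0 \<le> (1 / f (real (Suc i))) ^ k" for i using f[of "Suc i"] by simp
  have mono: "mono (\<lambda>n. ereal (G_fun f k (real n)))"
    unfolding G_fun_lessThan using pos by (intro monoI) (auto intro: sum_mono2)
  then have lim: "(\<lambda>n. ereal (G_fun f k (real n))) \<longlonglongrightarrow> G_infty f k"
    unfolding G_infty_def using LIMSEQ_SUP[of "\<lambda>n. ereal (G_fun f k (real n))"] by (auto simp: limI)
  show ?thesis
  proof (cases "G_infty f k")
    case (real s)
    then have "(\<lambda>n. G_fun f k (real n)) \<longlonglongrightarrow> s" using lim by simp
    then show ?thesis using real unfolding sums_def G_fun_lessThan by blast
  next
    case PInf
    then show ?thesis using lim by (simp add: tendsto_PInfty_eq_at_top)
  next
    case MInf
    have "ereal (G_fun f k (real 0)) \<le> G_infty f k"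
      by (rule incseq_le[OF mono lim])
    then show ?thesis using MInf by simp
  qed
qed

text \<open>
  The translation between the process and its birth times, for any limit law \<open>\<nu>\<close> of the normalised
  centred sums. The normalisation \<open>c\<close> is left open up to asymptotic equivalence with \<open>sqrt(G\<^sub>2(n))\<close>, so
  that a constant can be used when \<open>G\<^sub>2\<close> is bounded.
\<close>

lemma birth_process_convergence:
  fixes \<nu> :: "real measure"
  assumes rates: "regularly_varying_rates f L \<alpha>" and C: "\<And>i::nat. 1 \<le> i \<Longrightarrow> f (real i) \<le> C * real i"
    and process: "birth_process M f \<xi>" and iid: "iid_exponentials N E"
    and c: "(\<lambda>n. c n / sqrt (G_fun f 2 (real n))) \<longlonglongrightarrow> 1"
    and \<nu>: "real_distribution \<nu>"
    and weak: "weak_conv_m (\<lambda>n. distr N borel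
      (\<lambda>\<omega>. iid_exponentials.centred_sum E (\<lambda>i. 1 / f (real (Suc i))) n \<omega> / c n)) \<nu>"
  shows "converges_in_distribution M (\<lambda>t \<omega>. (real (\<xi> t \<omega>) - G1_inv f t) / V_fun f t) at_top \<nu> (\<lambda>x. x)"
proof -
  interpret regularly_varying_rates f L \<alpha> by fact
  interpret birth_process M f \<xi> by (rule process)
  interpret N: iid_exponentials N E by (rule iid)
  have fpos: "0 < f (real i)" if "1 \<le> i" for i using f_pos that by simp
  define y where "y t = G1_inv f t" for t
  have y: "0 \<le> y t" "G_fun f 1 (y t) = t" if "0 \<le> t" for t
    using G1_inv_correct[of f C t] fpos C that by (auto simp: y_def)
  have y_top: "filterlim y at_top at_top"
    unfolding filterlim_at_top
  proof
    fix Z :: real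
    \<comment> \<open>If \<open>y t\<close> stayed below \<open>Z\<close>, monotonicity of \<open>G\<^sub>1\<close> would bound \<open>t\<close>.\<close>
    show "eventually (\<lambda>t. Z \<le> y t) at_top"
      using eventually_gt_at_top[of "max 0 (G_fun f 1 (max 0 Z))"]
    proof eventually_elim
      case (elim t)
      show ?case
      proof (rule ccontr)
        assume "\<not> Z \<le> y t"
        then have "y t < max 0 Z" by simp
        then have "G_fun f 1 (y t) < G_fun f 1 (max 0 Z)"
          using y(1)[of t] elim fpos by (intro G1_strict_mono) auto
        then show False using y(2)[of t] elim by simp
      qed
    qed
  qed
  define r where "r t = nat \<lceil>y t\<rceil>" for t
  have r_top: "filterlim r at_top at_top"
    unfolding filterlim_at_top
  proof
    fix Z :: nat
    show "eventually (\<lambda>t. Z \<le> r t) at_top"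
      using filterlim_at_top[THEN iffD1, OF y_top, rule_format, of "real Z"]
      by eventually_elim (unfold r_def, linarith)
  qed
  define v where "v r = f (real r) * sqrt (G_fun f 2 (real r))" for r :: nat
  have v_top: "filterlim v at_top sequentially"
    using scale_at_top unfolding v_def G_fun_nat by simp
  have v_small: "(\<lambda>r. v r / real r) \<longlonglongrightarrow> 0"
    using scale_sublinear unfolding v_def G_fun_nat by simp
  have vr_top: "filterlim (\<lambda>t. v (r t)) at_top at_top" by (rule filterlim_compose[OF v_top r_top])
  have large: "eventually (\<lambda>t. 0 < t \<and> 0 < y t \<and> 1 \<le> r t \<and> 1 < v (r t)) at_top"
    using eventually_gt_at_top[of 0] filterlim_at_top_dense[THEN iffD1, OF y_top, rule_format, of 0]
      filterlim_at_top_dense[THEN iffD1, OF vr_top, rule_format, of 1]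
  proof eventually_elim
    case (elim t)
    then show ?case by (simp add: r_def Suc_le_eq)
  qed
  have V: "V_fun f t = v (r t)" if "0 < t" for t
    using y(1)[of t] that unfolding v_def by (intro V_eq) (simp add: r_fun_def r_def y_def)
  have r_y: "0 \<le> real (r t) - y t \<and> real (r t) - y t < 1 \<and>
      G_fun f 1 (r t) - t = (real (r t) - y t) / f (r t)" if t: "0 < t" "0 < y t" for t
  proof (intro conjI)
    have ceil: "\<lceil>y t\<rceil> = int (r t)" using t by (simp add: r_def)
    then show b: "0 \<le> real (r t) - y t" "real (r t) - y t < 1" by linarith+
    show "G_fun f 1 (r t) - t = (real (r t) - y t) / f (r t)"
    proof (cases "y t = real (r t)")
      case True
      then show ?thesis using y(2)[of t] t by simp
    next
      case False
      obtain m where m: "r t = Suc m" using t(2) b by (cases "r t") auto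
      have fl: "\<lfloor>y t\<rfloor> = int m" using b False m by (intro floor_unique) auto
      have "t = (\<Sum>j=1..m. 1 / f (real j)) + (y t - real m) / f (real (Suc m))"
        using y(2)[of t] t by (simp add: G_fun_def fl add.commute)
      moreover have "G_fun f 1 (r t) = (\<Sum>j=1..m. 1 / f (real j)) + 1 / f (real (Suc m))"
        by (simp only: G_fun_nat m) simp
      moreover have "real (r t) = real m + 1" by (simp add: m)
      ultimately show ?thesis
        unfolding m by (simp add: diff_divide_distrib add_divide_distrib)
    qed
  qed
  define X where "X n \<omega> = N.centred_sum (\<lambda>i. 1 / f (real (Suc i))) n \<omega> / c n" for n \<omega>
  have X_meas [measurable]: "X n \<in> borel_measurable N" for n unfolding X_def by measurable
  show ?thesis
    unfolding converges_in_distribution_def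
  proof (intro allI impI)
    interpret \<nu>: real_distribution \<nu> by (rule \<nu>)
    have \<nu>_id: "distr \<nu> borel (\<lambda>x. x) = \<nu>" by (rule distr_id2) simp
    fix x assume "isCont (cdf (distr \<nu> borel (\<lambda>x. x))) x"
    then have cont: "isCont (cdf \<nu>) x" by (simp only: \<nu>_id)
    \<comment> \<open>The least integer strictly above \<open>y + x * V\<close>, so that \<open>\<xi> < n\<close> is the same as \<open>\<xi> \<le> y + x * V\<close>.\<close>
    define n where "n t = nat (\<lfloor>y t + x * v (r t)\<rfloor> + 1)" for t
    have "eventually (\<lambda>t. \<bar>x\<bar> * (v (r t) / real (r t)) < 1 / 2) at_top"
    proof -
      have "((\<lambda>t. \<bar>x\<bar> * (v (r t) / real (r t))) \<longlongrightarrow> \<bar>x\<bar> * 0) at_top"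
        by (intro tendsto_mult_left filterlim_compose[OF v_small r_top])
      then show ?thesis by (rule order_tendstoD) simp
    qed
    then have half: "eventually (\<lambda>t. \<bar>x * v (r t)\<bar> \<le> real (r t) / 2) at_top"
      using large
    proof eventually_elim
      case (elim t)
      then show ?case by (simp add: abs_mult field_simps)
    qed
    have n_bounds: "eventually (\<lambda>t. 0 < real (n t) - (y t + x * v (r t)) \<and> real (n t) - (y t + x * v (r t)) \<le> 1
        \<and> real (r t) / 2 - 1 \<le> real (n t)) at_top"
      using half large filterlim_at_top[THEN iffD1, OF r_top, rule_format, of 2]
    proof eventually_elim
      case (elim t)
      have lower: "real (r t) / 2 - 1 \<le> y t + x * v (r t)"
        using r_y[of t] elim by linarith
      then have "0 \<le> y t + x * v (r t)" using elim by linarith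
      then have "real (n t) = real_of_int \<lfloor>y t + x * v (r t)\<rfloor> + 1" by (simp add: n_def)
      then show ?case using lower by linarith
    qed
    have near: "eventually (\<lambda>t. \<bar>real (n t) - real (r t)\<bar> \<le> (\<bar>x\<bar> + 1) * (f (r t) * sqrt (G_fun f 2 (r t)))) at_top"
      using n_bounds large
    proof eventually_elim
      case (elim t)
      have "\<bar>real (n t) - real (r t)\<bar> \<le> \<bar>x * v (r t)\<bar> + 1" using elim r_y[of t] by linarith
      also have "\<dots> \<le> \<bar>x\<bar> * v (r t) + 1 * v (r t)" using elim by (simp add: abs_mult)
      finally show ?case by (simp add: v_def algebra_simps)
    qed
    have n_top: "filterlim n at_top at_top"
      unfolding filterlim_at_top
    proof
      fix Z :: nat
      show "eventually (\<lambda>t. Z \<le> n t) at_top"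
        using n_bounds filterlim_at_top[THEN iffD1, OF r_top, rule_format, of "2 * Z + 2"]
      proof eventually_elim
        case (elim t)
        then have "real Z \<le> real (n t)" by linarith
        then show ?case by simp
      qed
    qed
    define z where "z t = (G_fun f 1 (n t) - t) / c (n t)" for t
    have z: "(z \<longlongrightarrow> x) at_top"
    proof -
      define q where "q t = ((G_fun f 1 (n t) - G_fun f 1 (r t)) * f (r t) - (real (n t) - real (r t)))
          / (f (r t) * sqrt (G_fun f 2 (r t)))" for t
      have q: "(q \<longlongrightarrow> 0) at_top"
        unfolding q_def by (rule local_increments(1)[OF _ r_top near]) simp
      have G2: "((\<lambda>t. G_fun f 2 (n t) / G_fun f 2 (r t)) \<longlongrightarrow> 1) at_top"
        by (rule local_increments(2)[OF _ r_top near]) simp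
      \<comment> \<open>The rounding error, which lies between 0 and 1 and is negligible as \<open>V\<close> tends to infinity.\<close>
      define \<rho> where "\<rho> t = real (n t) - (y t + x * v (r t))" for t
      have "((\<lambda>t. \<rho> t / v (r t)) \<longlongrightarrow> 0) at_top"
      proof (rule Lim_null_comparison)
        show "eventually (\<lambda>t. norm (\<rho> t / v (r t)) \<le> 1 / v (r t)) at_top"
          using n_bounds large
        proof eventually_elim
          case (elim t)
          then show ?case by (simp add: \<rho>_def divide_right_mono)
        qed
        show "((\<lambda>t. 1 / v (r t)) \<longlongrightarrow> 0) at_top"
          by (rule real_tendsto_divide_at_top[OF tendsto_const vr_top])
      qed
      then have "((\<lambda>t. (q t + x + \<rho> t / v (r t)) * (1 / (c (n t) / sqrt (G_fun f 2 (n t)))) *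
          (1 / sqrt (G_fun f 2 (n t) / G_fun f 2 (r t)))) \<longlongrightarrow> (0 + x + 0) * (1 / 1) * (1 / sqrt 1)) at_top"
        by (intro tendsto_intros q G2 filterlim_compose[OF c n_top]) auto
      moreover have "eventually (\<lambda>t. (q t + x + \<rho> t / v (r t)) * (1 / (c (n t) / sqrt (G_fun f 2 (n t)))) *
          (1 / sqrt (G_fun f 2 (n t) / G_fun f 2 (r t))) = z t) at_top"
        using n_bounds large filterlim_at_top[THEN iffD1, OF n_top, rule_format, of 1]
      proof eventually_elim
        case (elim t)
        have fr: "0 < f (r t)" using fpos elim by simp
        have Gr: "0 < G_fun f 2 (r t)" using elim by (intro G2_pos) simp
        have Gn: "0 < G_fun f 2 (n t)" using elim by (intro G2_pos) simp
        have "(G_fun f 1 (n t) - t) * f (r t)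
            = (G_fun f 1 (n t) - G_fun f 1 (r t)) * f (r t) + (G_fun f 1 (r t) - t) * f (r t)"
          by (simp add: algebra_simps)
        also have "(G_fun f 1 (r t) - t) * f (r t) = real (r t) - y t" using r_y[of t] elim fr by simp
        finally have "(G_fun f 1 (n t) - t) * f (r t) =
            (G_fun f 1 (n t) - G_fun f 1 (r t)) * f (r t) + (real (r t) - y t)" .
        moreover have "q t * v (r t) = (G_fun f 1 (n t) - G_fun f 1 (r t)) * f (r t) - (real (n t) - real (r t))"
          using elim by (simp add: q_def v_def[symmetric])
        moreover have "(q t + x + \<rho> t / v (r t)) * v (r t) = q t * v (r t) + x * v (r t) + \<rho> t"
          using elim by (simp add: distrib_right)
        ultimately have "(G_fun f 1 (n t) - t) * f (r t) = (q t + x + \<rho> t / v (r t)) * v (r t)"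
          unfolding \<rho>_def by linarith
        then have D: "G_fun f 1 (n t) - t = (q t + x + \<rho> t / v (r t)) * sqrt (G_fun f 2 (r t))"
          using fr by (simp add: v_def)
        show ?case unfolding z_def D using Gr Gn by (simp add: real_sqrt_divide)
      qed
      ultimately show ?thesis by (simp add: Lim_transform_eventually)
    qed
    have c_pos: "eventually (\<lambda>t. 0 < c (n t)) at_top"
    proof (rule eventually_compose_filterlim[OF _ n_top])
      have "eventually (\<lambda>n. 0 < c n / sqrt (G_fun f 2 (real n))) sequentially"
        using c by (rule order_tendstoD) simp
      then show "eventually (\<lambda>n. 0 < c n) sequentially"
        using eventually_ge_at_top[of 1]
      proof eventually_elim
        case (elim n)
        then show ?case using G2_pos[of n] by (simp add: zero_less_divide_iff)
      qed
    qed
    have "((\<lambda>t. measure (distr N borel (X (n t))) {..<z t}) \<longlongrightarrow> cdf \<nu> x) at_top"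
      by (rule weak_conv_moving_threshold[OF _ \<nu> _ cont n_top z])
         (use weak in \<open>auto simp: X_def[abs_def] intro!: N.real_distribution_distr\<close>)
    moreover have "eventually (\<lambda>t. measure (distr N borel (X (n t))) {..<z t} =
        cdf (distr M borel (\<lambda>\<omega>. (real (\<xi> t \<omega>) - G1_inv f t) / V_fun f t)) x) at_top"
      using large n_bounds half c_pos
    proof eventually_elim
      case (elim t)
      have t [arith]: "0 \<le> t" using elim by simp
      have "cdf (distr M borel (\<lambda>\<omega>. (real (\<xi> t \<omega>) - G1_inv f t) / V_fun f t)) x
          = \<P>(\<omega> in M. (real (\<xi> t \<omega>) - y t) / v (r t) \<le> x)"
        using elim unfolding cdf_def by (subst measure_distr) (auto simp: V y_def intro!: arg_cong[where f = prob])
      also have "\<dots> = \<P>(\<omega> in M. \<not> n t \<le> \<xi> t \<omega>)"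
      proof -
        have "(real k - y t) / v (r t) \<le> x \<longleftrightarrow> \<not> n t \<le> k" for k :: nat
        proof -
          have "(real k - y t) / v (r t) \<le> x \<longleftrightarrow> real k \<le> y t + x * v (r t)"
            using elim by (simp add: pos_divide_le_eq algebra_simps)
          also have "\<dots> \<longleftrightarrow> \<not> n t \<le> k"
          proof
            assume "real k \<le> y t + x * v (r t)"
            then have "real k < real (n t)" using elim by linarith
            then show "\<not> n t \<le> k" by simp
          next
            assume "\<not> n t \<le> k"
            then have "real k + 1 \<le> real (n t)" by linarith
            then show "real k \<le> y t + x * v (r t)" using elim by linarith
          qed
          finally show ?thesis .
        qed
        then show ?thesis by simp
      qed
      also have "\<dots> = 1 - \<P>(\<omega> in M. n t \<le> \<xi> t \<omega>)"
        by (rule prob_neg) measurable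
      also have "\<P>(\<omega> in M. n t \<le> \<xi> t \<omega>) = \<P>(\<omega> in N. N.birth_time f (n t) \<omega> \<le> t)"
        by (rule tail_eq_birth_time[OF process iid]) (use fpos in auto)
      also have "1 - \<dots> = \<P>(\<omega> in N. \<not> N.birth_time f (n t) \<omega> \<le> t)"
        by (rule N.prob_neg[symmetric]) measurable
      also have "\<dots> = \<P>(\<omega> in N. X (n t) \<omega> < z t)"
        using elim by (simp add: N.birth_time_eq_centred_sum X_def z_def divide_strict_right_mono divide_less_cancel not_le)
           (simp add: algebra_simps)
      also have "\<dots> = measure (distr N borel (X (n t))) {..<z t}"
        by (subst measure_distr) (auto intro!: arg_cong[where f = "measure N"])
      finally show ?case ..
    qed
    ultimately show "((\<lambda>t. cdf (distr M borel (\<lambda>\<omega>. (real (\<xi> t \<omega>) - G1_inv f t) / V_fun f t)) x)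
        \<longlongrightarrow> cdf (distr \<nu> borel (\<lambda>x. x)) x) at_top"
      unfolding \<nu>_id by (rule Lim_transform_eventually)
  qed
qed

theorem proposition3:
  fixes f L :: "real \<Rightarrow> real" and \<alpha> :: real
    and M :: "'a measure" and \<xi> :: "real \<Rightarrow> 'a \<Rightarrow> nat"
  assumes f_def: "\<And>x. 1 \<le> x \<Longrightarrow> f x = x powr \<alpha> * L x"
    and f_pos: "\<And>x. 1 \<le> x \<Longrightarrow> 0 < f x"
    and alpha: "0 \<le> \<alpha>" "\<alpha> \<le> 1"
    and L_measurable: "L \<in> borel_measurable (restrict_space lebesgue {1..})"
    and L_slow: "slowly_varying L"
    and L_zero: "\<alpha> = 1 \<Longrightarrow> (L \<longlongrightarrow> 0) at_top"
    and standing: "standing_assumption f"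
    and birth: "pure_birth_process M f \<xi>"
  shows "\<exists>(N :: real measure) Z.
    prob_space N \<and> Z \<in> borel_measurable N \<and>
    converges_in_distribution M (\<lambda>t \<omega>. (real (\<xi> t \<omega>) - G1_inv f t) / V_fun f t) at_top N Z \<and>
    (G_infty f 2 = \<infinity> \<longrightarrow> distr N borel Z = std_normal_distribution) \<and>
    (G_infty f 2 < \<infinity> \<longrightarrow>
      (\<forall>\<theta>. \<bar>\<theta>\<bar> < 1 \<longrightarrow>
        integrable N (\<lambda>\<omega>. exp (\<theta> * Z \<omega>)) \<and>
        (\<lambda>k. (- \<theta>) ^ k / real k * a_coeff f k) summable_on {2..} \<and>
        (\<integral>\<omega>. exp (\<theta> * Z \<omega>) \<partial>N) =
          exp (\<Sum>\<^sub>\<infinity>k\<in>{2..}. (- \<theta>) ^ k / real k * a_coeff f k)))"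
proof -
  have rates: "regularly_varying_rates f L \<alpha>"
    by unfold_locales (fact f_def f_pos alpha L_measurable L_slow L_zero)+
  interpret regularly_varying_rates f L \<alpha> by (rule rates)
  have process: "birth_process M f \<xi>" by unfold_locales (rule birth)
  obtain N :: "(nat \<Rightarrow> real) measure" where iid: "iid_exponentials N (\<lambda>i \<omega>. \<omega> i)"
    using iid_exponentials_exist by blast
  interpret N: iid_exponentials N "\<lambda>i \<omega>. \<omega> i" by (rule iid)
  have fpos: "0 < f (real i)" if "1 \<le> i" for i using f_pos that by simp
  obtain C where C: "\<And>k::nat. 1 \<le> k \<Longrightarrow> f (real k) \<le> C * real k"
    using standing unfolding standing_assumption_def by blast
  define \<delta> where "\<delta> = (INF i\<in>{1::nat..}. f (real i))"
  have \<delta>: "0 < \<delta>" using standing by (simp add: standing_assumption_def \<delta>_def)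
  have f_lower: "\<delta> \<le> f (real i)" if "1 \<le> i" for i
    unfolding \<delta>_def
    by (rule cINF_lower) (use that fpos in \<open>auto intro!: bdd_belowI2[where m = 0] less_imp_le\<close>)
  define b where "b i = 1 / f (real (Suc i))" for i
  have b: "0 < b i" "b i \<le> 1 / \<delta>" for i
    using fpos[of "Suc i"] f_lower[of "Suc i"] \<delta> by (auto simp: b_def intro!: divide_left_mono)
  have G2: "G_fun f 2 (real n) = (\<Sum>i<n. (b i)\<^sup>2)" for n
    by (simp only: G_fun_lessThan b_def)
  have suffices: ?thesis
    if \<nu>: "real_distribution \<nu>" and weak: "weak_conv_m (\<lambda>n. distr N borel (\<lambda>\<omega>. N.centred_sum b n \<omega> / c n)) \<nu>"
      and c: "(\<lambda>n. c n / sqrt (G_fun f 2 (real n))) \<longlonglongrightarrow> 1"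
      and normal: "G_infty f 2 = \<infinity> \<Longrightarrow> \<nu> = std_normal_distribution"
      and mgf: "\<And>\<theta>. G_infty f 2 < \<infinity> \<Longrightarrow> \<bar>\<theta>\<bar> < 1 \<Longrightarrow> integrable \<nu> (\<lambda>x. exp (\<theta> * x)) \<and>
        (\<lambda>k. (- \<theta>) ^ k / real k * a_coeff f k) summable_on {2..} \<and>
        (\<integral>x. exp (\<theta> * x) \<partial>\<nu>) = exp (\<Sum>\<^sub>\<infinity>k\<in>{2..}. (- \<theta>) ^ k / real k * a_coeff f k)"
    for \<nu> c
  proof (intro exI[of _ \<nu>] exI[of _ "\<lambda>x::real. x"] conjI impI allI)
    interpret \<nu>: real_distribution \<nu> by (rule \<nu>)
    show "prob_space \<nu>" by unfold_locales
    show "(\<lambda>x. x) \<in> borel_measurable \<nu>" by simp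
    show "converges_in_distribution M (\<lambda>t \<omega>. (real (\<xi> t \<omega>) - G1_inv f t) / V_fun f t) at_top \<nu> (\<lambda>x. x)"
      by (rule birth_process_convergence[OF rates C process iid c \<nu>])
         (use weak in \<open>simp_all add: b_def[abs_def]\<close>)
    show "distr \<nu> borel (\<lambda>x. x) = std_normal_distribution" if "G_infty f 2 = \<infinity>"
    proof -
      have "distr \<nu> borel (\<lambda>x. x) = \<nu>" by (rule distr_id2) simp
      then show ?thesis using normal[OF that] by simp
    qed
  qed (use mgf in blast)+
  from G_infty_cases[of f 2, OF fpos] consider
    (infinite) "G_infty f 2 = \<infinity>" "filterlim (\<lambda>n. G_fun f 2 (real n)) at_top sequentially"
    | (finite) s where "G_infty f 2 = ereal s" "(\<lambda>i. (b i)\<^sup>2) sums s"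
    unfolding b_def by blast
  then show ?thesis
  proof cases
    case infinite
    have "(\<lambda>n. sqrt (\<Sum>i<n. (b i)\<^sup>2) / sqrt (G_fun f 2 (real n))) \<longlonglongrightarrow> 1"
    proof (rule tendsto_eventually)
      show "eventually (\<lambda>n. sqrt (\<Sum>i<n. (b i)\<^sup>2) / sqrt (G_fun f 2 (real n)) = 1) sequentially"
        using eventually_ge_at_top[of 1]
      proof eventually_elim
        case (elim n)
        then show ?case using G2_pos[of n] by (simp add: G2)
      qed
    qed
    then show ?thesis
      using infinite b by (intro suffices[OF real_dist_normal_dist N.centred_sum_normal_limit])
        (auto simp: G2 intro: less_imp_le)
  next
    case finite
    have s: "0 < s"
      using suminf_pos[OF sums_summable[OF finite(2)] zero_less_power[OF b(1)]] finite(2) by (simp add: sums_iff)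
    define \<sigma> where "\<sigma> = sqrt s"
    have \<sigma>: "0 < \<sigma>" "\<sigma>\<^sup>2 = s" using s by (auto simp: \<sigma>_def)
    have scaled_sums: "(\<lambda>i. (b i / \<sigma>)\<^sup>2) sums 1"
      using sums_divide[OF finite(2), of s] s \<sigma> by (simp add: power_divide)
    have a: "a_coeff f k = (\<Sum>i. (b i / \<sigma>) ^ k)" if k: "2 \<le> k" for k
    proof -
      have "summable (\<lambda>i. b i ^ k)"
      proof (rule summable_comparison_test'[of _ 0])
        show "summable (\<lambda>i. (1 / \<delta>) ^ (k - 2) * (b i)\<^sup>2)"
          by (intro summable_mult sums_summable[OF finite(2)])
        fix i
        have "b i ^ (k - 2) * (b i)\<^sup>2 \<le> (1 / \<delta>) ^ (k - 2) * (b i)\<^sup>2"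
          using b[of i] by (intro mult_right_mono power_mono) auto
        moreover have "b i ^ (k - 2) * (b i)\<^sup>2 = b i ^ k"
          using k power_add[of "b i" "k - 2" 2] by (simp only: le_add_diff_inverse2)
        ultimately show "norm (b i ^ k) \<le> (1 / \<delta>) ^ (k - 2) * (b i)\<^sup>2"
          using b[of i] by simp
      qed
      then have bk: "(\<lambda>i. b i ^ k) sums (\<Sum>i. b i ^ k)" by (rule summable_sums)
      have "G_infty f k = ereal (\<Sum>i. b i ^ k)"
        using bk unfolding G_infty_def G_fun_lessThan b_def sums_def
        by (intro limI) simp
      moreover have "s powr (real k / 2) = \<sigma> ^ k"
        using s by (simp add: \<sigma>_def powr_half_sqrt[symmetric] powr_powr flip: powr_realpow)
      ultimately have "a_coeff f k = (\<Sum>i. b i ^ k) / \<sigma> ^ k"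
        by (simp add: a_coeff_def finite(1))
      also have "\<dots> = (\<Sum>i. b i ^ k / \<sigma> ^ k)" by (rule suminf_divide[symmetric]) (rule sums_summable[OF bk])
      finally show ?thesis by (simp add: power_divide)
    qed
    have nonneg: "0 \<le> b i / \<sigma>" for i using b[of i] \<sigma> by simp
    obtain \<nu> where \<nu>: "real_distribution \<nu>"
      "weak_conv_m (\<lambda>n. distr N borel (N.centred_sum (\<lambda>i. b i / \<sigma>) n)) \<nu>"
      and mgf: "\<And>\<theta>. \<bar>\<theta>\<bar> < 1 \<Longrightarrow> integrable \<nu> (\<lambda>x. exp (\<theta> * x)) \<and>
        (\<integral>x. exp (\<theta> * x) \<partial>\<nu>) = exp (\<Sum>\<^sub>\<infinity>k\<in>{2..}. (- \<theta>) ^ k / real k * (\<Sum>i. (b i / \<sigma>) ^ k))"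
      using N.centred_sum_limit_finite_variance[OF nonneg scaled_sums] by blast
    have scaled: "N.centred_sum (\<lambda>i. b i / \<sigma>) n = (\<lambda>\<omega>. N.centred_sum b n \<omega> / \<sigma>)" for n
      by (simp add: fun_eq_iff N.centred_sum_def sum_divide_distrib)
    show ?thesis
    proof (rule suffices[OF \<nu>(1), of "\<lambda>_. \<sigma>"])
      show "weak_conv_m (\<lambda>n. distr N borel (\<lambda>\<omega>. N.centred_sum b n \<omega> / \<sigma>)) \<nu>"
        using \<nu>(2) unfolding scaled .
      have "(\<lambda>n. G_fun f 2 (real n)) \<longlonglongrightarrow> s" using finite(2) unfolding G2 sums_def .
      then have "(\<lambda>n. \<sigma> / sqrt (G_fun f 2 (real n))) \<longlonglongrightarrow> \<sigma> / sqrt s"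
        using s by (intro tendsto_intros) auto
      then show "(\<lambda>n. \<sigma> / sqrt (G_fun f 2 (real n))) \<longlonglongrightarrow> 1" using \<sigma> by (simp add: \<sigma>_def)
      show "\<nu> = std_normal_distribution" if "G_infty f 2 = \<infinity>" using that finite(1) by simp
      fix \<theta> :: real assume \<theta>: "\<bar>\<theta>\<bar> < 1"
      have "(\<lambda>k. (- \<theta>) ^ k / real k * a_coeff f k) summable_on {2..} \<longleftrightarrow>
          (\<lambda>k. (- \<theta>) ^ k / real k * (\<Sum>i. (b i / \<sigma>) ^ k)) summable_on {2..}"
        by (intro summable_on_cong) (simp add: a)
      moreover have "(\<Sum>\<^sub>\<infinity>k\<in>{2..}. (- \<theta>) ^ k / real k * a_coeff f k) =
          (\<Sum>\<^sub>\<infinity>k\<in>{2..}. (- \<theta>) ^ k / real k * (\<Sum>i. (b i / \<sigma>) ^ k))"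
        by (intro infsum_cong) (simp add: a)
      ultimately show "integrable \<nu> (\<lambda>x. exp (\<theta> * x)) \<and>
        (\<lambda>k. (- \<theta>) ^ k / real k * a_coeff f k) summable_on {2..} \<and>
        (\<integral>x. exp (\<theta> * x) \<partial>\<nu>) = exp (\<Sum>\<^sub>\<infinity>k\<in>{2..}. (- \<theta>) ^ k / real k * a_coeff f k)"
        using mgf[OF \<theta>] cumulant_series(1)[OF nonneg scaled_sums \<theta>] by simp
    qed
  qed
qed

end
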